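(* Let $T>0$, $p\in[1,\infty)$, $p'\in(p,\infty)$. Assume that $b:[0,T]\times\mathbb{R}^{d+n}\times\mathcal{P}_p(\mathbb{R}^{d+n})\to\mathbb{R}^d$ is a measurable function and there exists a constant $K_b$ such that $$|b(t,x,\mu)-b(t,x',\mu')|^p\le K_b\big(|x-x'|^p+\mathcal{W}_{\mathbb{R}^{d+n},p}(\mu,\mu')^p\big)$$ for all $t\in[0,T]$, $x,x'\in\mathbb{R}^{d+n}$, $\mu,\mu'\in\mathcal{P}_p(\mathbb{R}^{d+n})$. Let $(\Omega,\mathcal{A},\mathbb{P})$ be a probability space. On this space consider independent families $(\zeta^i)_{i\ge1}\subset L^{p'}(\Omega,\mathbb{R}^d)$ and $(W^i)_{i\ge1}\subset L^{p'}(\Omega,C_T(\mathbb{R}^d))$ of i.i.d. random variables. Let $\bar\zeta$ be distributed as $\zeta^1$ and let $\bar W$ be distributed as $W^1$ and independent of $\bar\zeta$. Moreover, for each $N$, let $R^{(N)}=(R^{i,N})_{1\le i\le N}$ be a family of independent random variables in $L^{p'}(\Omega,C_T(\mathbb{R}^n))$, which are independent from the others. Let $\bar R$ be a $C_T(\mathbb{R}^n)$-valued random variable such that $\bar\zeta,\bar W,\bar R$ are independent. Let $X^{(N)}=(X^{i,N})_{1\le i\le N}$ be the solution of $$dX^{i,N}_t=b\big(t,X^{i,N}_t,R^{i,N}_t,L^N(X^{(N)}_t,R^{(N)}_t)\big)dt+dW^i_t,\qquad X^{i,N}_0=\zeta^i,\qquad i=1,\dots,N,$$ and $\bar X$ the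 solution of $$d\bar X_t=b\big(t,\bar X_t,\bar R_t,\mathcal{L}(\bar X_t,\bar R_t)\big)dt+d\bar W_t,\qquad\bar X_0=\bar\zeta.$$ If $$\mathcal{W}_{C_T(\mathbb{R}^n),p'}\big(L^N(R^{(N)}),\mathcal{L}(\bar R)\big)\to0\quad\mathbb{P}\text{-a.s. as }N\to\infty,$$ then also $$\mathcal{W}_{C_T(\mathbb{R}^{d+n}),p}\big(L^N(X^{(N)},R^{(N)}),\mathcal{L}(\bar X,\bar R)\big)\to0\quad\mathbb{P}\text{-a.s. as }N\to\infty.$$
   Context: $C_T(\mathbb{R}^m):=C([0,T],\mathbb{R}^m)$ with the supremum norm. $\mathcal{P}_p(E)$ is the set of Borel probability measures on $E$ with finite $p$-th moment and $\mathcal{W}_{E,p}$ the $p$-Wasserstein metric. $L^N(y^{(N)}):=\frac1N\sum_{i=1}^N\delta_{y^i}$; in particular $L^N(X^{(N)},R^{(N)})=\frac1N\sum_i\delta_{(X^{i,N},R^{i,N})}$. $\mathcal{L}$ denotes law. $L^q(\Omega,E)$ denotes $E$-valued random variables with finite $q$-th moment. Equations are understood pathwise, in integrated form. *)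

theory Defs
  imports "HOL-Probability.Probability"
begin

section \<open>Path spaces\<close>

text \<open>
  A continuous path on \<open>[0,T]\<close> is identified with its extension to the real line that is
  constant on \<open>(-\<infinity>,0]\<close> and on \<open>[T,\<infinity>)\<close>. On such functions the distance of the type
  of bounded continuous functions is the supremum distance over \<open>[0,T]\<close>, so this is an
  isometric copy of \<open>C([0,T],'a)\<close>, a closed subset of the ambient type.
\<close>

definition paths :: "real \<Rightarrow> (real \<Rightarrow>\<^sub>C 'a::metric_space) set"
  where "paths T = {f. (\<forall>t\<le>0. apply_bcontfun f t = apply_bcontfun f 0) \<and>
                       (\<forall>t\<ge>T. apply_bcontfun f t = apply_bcontfun f T)}"

definition CT :: "real \<Rightarrow> (real \<Rightarrow>\<^sub>C 'a::metric_space) measure"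
  where "CT T = restrict_space borel (paths T)"

text \<open>
  \<open>\<real>\<^sup>d\<^sup>+\<^sup>n\<close> is represented by the product of \<open>\<real>\<^sup>d\<close> and \<open>\<real>\<^sup>n\<close>, whose norm in the library is the
  Euclidean one. Accordingly a pair of paths is turned into one path in the product.
\<close>

definition pair_path ::
  "(real \<Rightarrow>\<^sub>C 'a::metric_space) \<Rightarrow> (real \<Rightarrow>\<^sub>C 'b::metric_space) \<Rightarrow> (real \<Rightarrow>\<^sub>C ('a \<times> 'b))"
  where "pair_path f g = Bcontfun (\<lambda>t. (apply_bcontfun f t, apply_bcontfun g t))"

lemma apply_pair_path [simp]:
  "apply_bcontfun (pair_path f g) t = (apply_bcontfun f t, apply_bcontfun g t)"
proof -
  have "range (\<lambda>t. (apply_bcontfun f t, apply_bcontfun g t))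
      \<subseteq> range (apply_bcontfun f) \<times> range (apply_bcontfun g)"
    by auto
  moreover have "bounded (range (apply_bcontfun f) \<times> range (apply_bcontfun g))"
    by (intro bounded_Times) auto
  ultimately have "(\<lambda>t. (apply_bcontfun f t, apply_bcontfun g t)) \<in> bcontfun"
    by (auto simp: bcontfun_def intro!: continuous_intros intro: bounded_subset)
  then show ?thesis
    by (simp add: pair_path_def Bcontfun_inverse)
qed

lemma pair_path_in_paths: "f \<in> paths T \<Longrightarrow> g \<in> paths T \<Longrightarrow> pair_path f g \<in> paths T"
  unfolding paths_def mem_Collect_eq apply_pair_path prod.inject by blast


section \<open>Wasserstein distances\<close>

text \<open>
  A metric space \<open>E\<close> with its Borel sets is given as a measure whose distance is that of the
  type: \<open>borel\<close> for a Euclidean space, \<open>CT T\<close> for a path space. Both are separable, so the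
  product \<open>E \<Otimes>\<^sub>M E\<close> carries the Borel sets of the product space.
\<close>

definition Pp :: "'e::real_normed_vector measure \<Rightarrow> real \<Rightarrow> 'e measure set"
  where "Pp E p = {\<mu>. prob_space \<mu> \<and> sets \<mu> = sets E \<and>
                       (\<integral>\<^sup>+x. ennreal (norm x powr p) \<partial>\<mu>) < \<infinity>}"

definition couplings ::
  "'e measure \<Rightarrow> 'e measure \<Rightarrow> 'e measure \<Rightarrow> ('e \<times> 'e) measure set"
  where "couplings E \<mu> \<nu> = {\<pi>. sets \<pi> = sets (E \<Otimes>\<^sub>M E) \<and>
                                distr \<pi> E fst = \<mu> \<and> distr \<pi> E snd = \<nu>}"

definition transport_cost ::
  "'e::metric_space measure \<Rightarrow> real \<Rightarrow> 'e measure \<Rightarrow> 'e measure \<Rightarrow> ennreal"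
  where "transport_cost E p \<mu> \<nu> =
    (INF \<pi>\<in>couplings E \<mu> \<nu>. \<integral>\<^sup>+z. ennreal (dist (fst z) (snd z) powr p) \<partial>\<pi>)"

text \<open>
  The distance is extended-valued, so that it does not silently vanish on measures without a
  finite \<open>p\<close>-th moment. It is finite on \<open>Pp E p\<close>.
\<close>

definition wasserstein ::
  "'e::metric_space measure \<Rightarrow> real \<Rightarrow> 'e measure \<Rightarrow> 'e measure \<Rightarrow> ennreal"
  where "wasserstein E p \<mu> \<nu> =
    (if transport_cost E p \<mu> \<nu> = \<infinity> then \<infinity>
     else ennreal (enn2real (transport_cost E p \<mu> \<nu>) powr (1 / p)))"

text \<open>The Borel sigma-algebra of \<open>Pp E p\<close> under the Wasserstein distance.\<close>

definition Pp_borel :: "'e::real_normed_vector measure \<Rightarrow> real \<Rightarrow> 'e measure measure"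
  where "Pp_borel E p = sigma (Pp E p)
    {U. U \<subseteq> Pp E p \<and>
        (\<forall>\<mu>\<in>U. \<exists>e>0. \<forall>\<nu>\<in>Pp E p. wasserstein E p \<mu> \<nu> < ennreal e \<longrightarrow> \<nu> \<in> U)}"

definition empirical :: "'e measure \<Rightarrow> nat \<Rightarrow> (nat \<Rightarrow> 'e) \<Rightarrow> 'e measure"
  where "empirical E N y = measure_of (space E) (sets E)
    (\<lambda>A. (\<Sum>i=1..N. emeasure (return E (y i)) A) / of_nat N)"

lemma sets_empirical [simp]: "sets (empirical E N y) = sets E"
  by (simp add: empirical_def sets.sets_measure_of_eq)

lemma emeasure_empirical:
  assumes "A \<in> sets E"
  shows "emeasure (empirical E N y) A = (\<Sum>i=1..N. indicator A (y i)) / of_nat N"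
proof -
  let ?f = "\<lambda>A. (\<Sum>i=1..N. emeasure (return E (y i)) A) / of_nat N"
  have "countably_additive (sets E) ?f"
  proof (rule countably_additiveI)
    fix F :: "nat \<Rightarrow> 'a set"
    assume F: "range F \<subseteq> sets E" "disjoint_family F"
    have "(\<Sum>n. ?f (F n)) = (\<Sum>n. \<Sum>i=1..N. emeasure (return E (y i)) (F n)) / of_nat N"
      by (simp only: divide_ennreal_def ennreal_suminf_multc)
    also have "(\<Sum>n. \<Sum>i=1..N. emeasure (return E (y i)) (F n))
        = (\<Sum>i=1..N. \<Sum>n. emeasure (return E (y i)) (F n))"
      by (intro suminf_sum) auto
    also have "\<dots> = (\<Sum>i=1..N. emeasure (return E (y i)) (\<Union>n. F n))"
      by (intro sum.cong refl suminf_emeasure) (use F in auto)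
    finally show "(\<Sum>n. ?f (F n)) = ?f (\<Union>n. F n)" .
  qed
  moreover have "positive (sets E) ?f"
    by (simp add: positive_def)
  ultimately have "emeasure (empirical E N y) A = ?f A"
    using assms by (intro emeasure_measure_of[OF empirical_def]) (auto simp: sets.space_closed)
  then show ?thesis
    using assms by simp
qed


section \<open>Random variables and independence\<close>

definition Lq :: "'w measure \<Rightarrow> 'e::real_normed_vector measure \<Rightarrow> real \<Rightarrow> ('w \<Rightarrow> 'e) set"
  where "Lq M E q = {X \<in> M \<rightarrow>\<^sub>M E. integrable M (\<lambda>\<omega>. norm (X \<omega>) powr q)}"

definition rv_events :: "'w measure \<Rightarrow> 'e measure \<Rightarrow> ('w \<Rightarrow> 'e) \<Rightarrow> 'w set set"
  where "rv_events M E X = {X -` A \<inter> space M | A. A \<in> sets E}"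

text \<open>
  Joint independence of all members of three families of random variables. The library's
  \<open>indep_vars\<close> needs one common value type; this is the same notion for three value types.
\<close>

definition indep_families where
  "indep_families M E1 X1 I1 E2 X2 I2 E3 X3 I3 \<longleftrightarrow>
     prob_space.indep_sets M
       (case_sum (\<lambda>i. rv_events M E1 (X1 i))
         (case_sum (\<lambda>i. rv_events M E2 (X2 i)) (\<lambda>i. rv_events M E3 (X3 i))))
       (I1 <+> (I2 <+> I3))"


section \<open>The equations\<close>

text \<open>
  \<open>dx = \<beta> dt + dw\<close> on \<open>[0,T]\<close> with \<open>x 0 = z\<close>, in integrated form. The increment \<open>w t - w 0\<close>
  appears because the driving path need not start at the origin.
\<close>

definition integrated_eq ::
  "real \<Rightarrow> (real \<Rightarrow> 'a::euclidean_space) \<Rightarrow> 'a \<Rightarrow> (real \<Rightarrow>\<^sub>C 'a) \<Rightarrow> (real \<Rightarrow>\<^sub>C 'a) \<Rightarrow> bool"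
  where "integrated_eq T \<beta> z w x \<longleftrightarrow>
    set_integrable lborel {0..T} \<beta> \<and>
    (\<forall>t\<in>{0..T}. x t = z + (LINT s:{0..t}|lborel. \<beta> s) + (w t - w 0))"

definition particle_solution ::
  "'w measure \<Rightarrow> real \<Rightarrow>
   (real \<Rightarrow> 'a::euclidean_space \<times> 'b::euclidean_space \<Rightarrow> ('a \<times> 'b) measure \<Rightarrow> 'a) \<Rightarrow> nat \<Rightarrow>
   (nat \<Rightarrow> 'w \<Rightarrow> 'a) \<Rightarrow> (nat \<Rightarrow> 'w \<Rightarrow> (real \<Rightarrow>\<^sub>C 'a)) \<Rightarrow> (nat \<Rightarrow> 'w \<Rightarrow> (real \<Rightarrow>\<^sub>C 'b)) \<Rightarrow>
   (nat \<Rightarrow> 'w \<Rightarrow> (real \<Rightarrow>\<^sub>C 'a)) \<Rightarrow> bool"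
  where "particle_solution M T b N \<zeta> W R X \<longleftrightarrow>
    (\<forall>i\<in>{1..N}. X i \<in> M \<rightarrow>\<^sub>M CT T) \<and>
    (AE \<omega> in M. \<forall>i\<in>{1..N}.
       integrated_eq T
         (\<lambda>s. b s (X i \<omega> s, R i \<omega> s) (empirical borel N (\<lambda>j. (X j \<omega> s, R j \<omega> s))))
         (\<zeta> i \<omega>) (W i \<omega>) (X i \<omega>))"

text \<open>
  The drift is only meaningful on measures with finite \<open>p\<close>-th moment, hence the condition on
  the marginal laws.
\<close>

definition mckean_vlasov_solution ::
  "'w measure \<Rightarrow> real \<Rightarrow> real \<Rightarrow>
   (real \<Rightarrow> 'a::euclidean_space \<times> 'b::euclidean_space \<Rightarrow> ('a \<times> 'b) measure \<Rightarrow> 'a) \<Rightarrow>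
   ('w \<Rightarrow> 'a) \<Rightarrow> ('w \<Rightarrow> (real \<Rightarrow>\<^sub>C 'a)) \<Rightarrow> ('w \<Rightarrow> (real \<Rightarrow>\<^sub>C 'b)) \<Rightarrow>
   ('w \<Rightarrow> (real \<Rightarrow>\<^sub>C 'a)) \<Rightarrow> bool"
  where "mckean_vlasov_solution M T p b \<zeta> W R X \<longleftrightarrow>
    X \<in> M \<rightarrow>\<^sub>M CT T \<and>
    (\<forall>t\<in>{0..T}. distr M borel (\<lambda>\<omega>. (X \<omega> t, R \<omega> t)) \<in> Pp borel p) \<and>
    (AE \<omega> in M.
       integrated_eq T
         (\<lambda>s. b s (X \<omega> s, R \<omega> s) (distr M borel (\<lambda>\<omega>'. (X \<omega>' s, R \<omega>' s))))
         (\<zeta> \<omega>) (W \<omega>) (X \<omega>))"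

end

theory Submission
  imports Defs
begin

text \<open>
  On \<open>{1..N} \<times> \<Omega>\<close> a coupling of the empirical measure of points \<open>y 1, \<dots>, y N\<close> with the law of a random
  variable on \<open>\<Omega>\<close> is given by a density, that is, by weights \<open>h i\<close> on \<open>\<Omega>\<close> with mean \<open>1\<close> and average \<open>1\<close>
  over \<open>i\<close>. The same weights couple the input data \<open>(\<zeta>, W, R)\<close> and the solutions, so a pathwise
  Gronwall-type estimate bounds the transport cost of the solutions by a constant times that of the
  inputs.

  For the inputs, let \<open>f\<close>, \<open>g\<close>, \<open>u\<close> be Lipschitz functions from fine partitions of the three spaces.
  Hoeffding's inequality shows that the averages of \<open>(f (\<zeta> i) g (W i) - E f E g) u (R N i)\<close> vanish almost
  surely, and the averages of \<open>u (R N i)\<close> converge by assumption. Hence almost all mass can be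
  transported inside small cells. The remaining mass is cheap, since moments of some order \<open>q\<close> with
  \<open>p < q < p'\<close> stay bounded along almost every sequence.
\<close>


section \<open>Path spaces\<close>

text \<open>Convergence of the empirical measures of \<open>R\<close> alone is not enough: the
  triples \<open>(\<zeta> i, W i, R N i)\<close> have to behave like a sample from a product law,
  although the \<open>R N i\<close> need not be identically distributed and rows with different
  \<open>N\<close> may depend on each other in any way. Hence averages of functions of
  \<open>R\<close> are never centred; only the factor in \<open>\<zeta>\<close> and \<open>W\<close>
  is, and the limit of the rest is read off the hypothesis. Describing couplings by weights avoids
  both optimal couplings and gluing: one \<open>h\<close> yields couplings of the data, of the time
  marginals entering the drift, and of whole paths. Two points of \<Omega> are in play: a fixed one
  supplies the particles, another is integrated and supplies the limit law, so particles and limit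
  variables may share \<Omega> with any joint dependence. The rate \<open>8 * L\<close> in the
  exponential weight leaves room for two absorptions: one in the pathwise estimate, and one for the
  Wasserstein distance of the time marginals, where a factor 2 lost in splitting \<open>p\<close>-th
  powers has to be compensated.\<close>

lemma measurable_apply_bcontfun [measurable]:
  "(\<lambda>f. apply_bcontfun f t) \<in> borel_measurable (borel :: (real \<Rightarrow>\<^sub>C 'a::metric_space) measure)"
proof (rule borel_measurable_continuous_onI)
  show "continuous_on UNIV (\<lambda>f. apply_bcontfun f t :: 'a)"
    unfolding continuous_on_iff by (meson dist_fun_lt_imp_dist_val_lt)
qed

lemma measurable_CT_imp_borel:
  assumes "f \<in> M \<rightarrow>\<^sub>M CT T"
  shows "f \<in> borel_measurable M"
  using assms unfolding CT_def by (rule measurable_restrict_space2_iff[THEN iffD1, THEN conjunct1])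

lemma space_CT [simp]: "space (CT T) = paths T"
  by (simp add: CT_def space_restrict_space)

lemma measurable_CT_space: "f \<in> M \<rightarrow>\<^sub>M CT T \<Longrightarrow> x \<in> space M \<Longrightarrow> f x \<in> paths T"
  using measurable_space[of f M "CT T" x] by simp

lemma measurable_apply_CT [measurable]:
  "(\<lambda>f. apply_bcontfun f t) \<in> borel_measurable (CT T)"
  unfolding CT_def by (rule measurable_restrict_space1) measurable

text \<open>Continuity reduces the supremum over time to countably many times. Distances of random
  paths thus become measurable from evaluations alone, which matters because the ambient space of
  bounded continuous functions is in general not separable.\<close>

lemma dist_bcontfun_le_iff_Rats:
  fixes f g :: "real \<Rightarrow>\<^sub>C 'a::metric_space"
  shows "dist f g \<le> c \<longleftrightarrow> (\<forall>q::rat. dist (f (of_rat q)) (g (of_rat q)) \<le> c)"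
proof
  assume *: "\<forall>q::rat. dist (f (of_rat q)) (g (of_rat q)) \<le> c"
  have "dist (f t) (g t) \<le> c" for t
  proof (rule continuous_le_on_closure[where f = "\<lambda>t. dist (f t) (g t)" and S = "\<rat>"])
    show "continuous_on (closure \<rat>) (\<lambda>t. dist (f t) (g t))"
      by (intro continuous_on_dist continuous_on_apply_bcontfun)
  qed (use * in \<open>auto elim!: Rats_cases simp: Rats_closure_real\<close>)
  then show "dist f g \<le> c"
    by (rule dist_bound)
qed (meson dist_bounded order_trans)

lemma borel_measurable_dist_bcontfun:
  fixes f g :: "'w \<Rightarrow> (real \<Rightarrow>\<^sub>C 'a::{metric_space, second_countable_topology})"
  assumes [measurable]: "\<And>t. (\<lambda>\<omega>. f \<omega> t) \<in> borel_measurable M"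
    and [measurable]: "\<And>t. (\<lambda>\<omega>. g \<omega> t) \<in> borel_measurable M"
  shows "(\<lambda>\<omega>. dist (f \<omega>) (g \<omega>)) \<in> borel_measurable M"
proof (rule borel_measurableI_le)
  fix c
  have [measurable]: "(\<lambda>\<omega>. dist (f \<omega> t) (g \<omega> t)) \<in> borel_measurable M" for t
    by measurable
  have "{\<omega> \<in> space M. dist (f \<omega>) (g \<omega>) \<le> c} = 
      {\<omega> \<in> space M. \<forall>q::rat. dist (f \<omega> (of_rat q)) (g \<omega> (of_rat q)) \<le> c}"
    by (simp add: dist_bcontfun_le_iff_Rats)
  also have "\<dots> \<in> sets M"
    by measurable
  finally show "{\<omega> \<in> space M. dist (f \<omega>) (g \<omega>) \<le> c} \<in> sets M" .
qed

lemma measurable_dist_CT: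
  "(\<lambda>z. dist (fst z) (snd z)) \<in>
    borel_measurable (CT T \<Otimes>\<^sub>M (CT T :: (real \<Rightarrow>\<^sub>C 'a::{metric_space, second_countable_topology}) measure))"
  by (rule borel_measurable_dist_bcontfun) measurable

lemma dist_paths_le:
  assumes "f \<in> paths T" "g \<in> paths T" "0 \<le> T"
    and "\<And>t. t \<in> {0..T} \<Longrightarrow> dist (apply_bcontfun f t) (apply_bcontfun g t) \<le> c"
  shows "dist f g \<le> c"
proof (rule dist_bound)
  fix t
  show "dist (apply_bcontfun f t) (apply_bcontfun g t) \<le> c"
  proof (cases "t \<in> {0..T}")
    case False
    then consider "t \<le> 0" | "T \<le> t"
      by fastforce
    then show ?thesis
    proof cases
      case 1
      then show ?thesis
        using assms unfolding paths_def by (metis (mono_tags, lifting) atLeastAtMost_iff mem_Collect_eq order_refl)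
    next
      case 2
      then show ?thesis
        using assms unfolding paths_def by (metis (mono_tags, lifting) atLeastAtMost_iff mem_Collect_eq order_refl)
    qed
  qed (use assms in auto)
qed

text \<open>The dense set picks one path for each rational discretisation of the values on a grid
  together with a bound on the oscillation over the cells of the grid.\<close>

lemma separable_paths:
  assumes "0 < T"
  obtains D :: "(real \<Rightarrow>\<^sub>C 'a::{metric_space, second_countable_topology}) set"
  where "countable D" "D \<subseteq> paths T" "\<And>f e. f \<in> paths T \<Longrightarrow> 0 < e \<Longrightarrow> \<exists>g\<in>D. dist g f < e"
proof -
  obtain Q :: "'a set" where Q: "countable Q" "\<And>U. open U \<Longrightarrow> U \<noteq> {} \<Longrightarrow> \<exists>q\<in>Q. q \<in> U"
    using countable_dense_setE by metis
  \<comment> \<open>A code \<open>(k, m, v)\<close> stands for the mesh \<open>T / Suc k\<close>,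
    the tolerance \<open>1 / Suc m\<close> and approximate values \<open>v\<close> at the grid
    points \<open>j \<le> Suc k\<close>, both endpoints included.\<close>
  define good where "good = (\<lambda>(k, m, v) (f :: real \<Rightarrow>\<^sub>C 'a). f \<in> paths T \<and>
     (\<forall>j\<le>Suc k. dist (f (T * real j / real (Suc k))) (v ! j) \<le> 1 / real (Suc m)) \<and>
     (\<forall>s\<in>{0..T}. \<forall>t\<in>{0..T}. \<bar>s - t\<bar> \<le> T / real (Suc k) \<longrightarrow> dist (f s) (f t) \<le> 1 / real (Suc m)))"
  define A where "A = {a \<in> UNIV \<times> UNIV \<times> lists Q. \<exists>f. good a f}"
  define D where "D = (\<lambda>a. SOME f. good a f) ` A"
  have good_D: "good a (SOME f. good a f)" if "a \<in> A" for a
    using that unfolding A_def by (metis (mono_tags, lifting) mem_Collect_eq someI_ex)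
  have "countable A"
    unfolding A_def by (rule countable_subset[of _ "UNIV \<times> UNIV \<times> lists Q"]) (use Q in auto)
  then have "countable D"
    unfolding D_def by simp
  moreover have "D \<subseteq> paths T"
    unfolding D_def using good_D by (fastforce simp: good_def)
  moreover have "\<exists>g\<in>D. dist g f < e" if f: "f \<in> paths T" and e: "0 < e" for f e
  proof -
    \<comment> \<open>Two paths with the same code differ by at most four tolerances: two for moving
      to the grid point, two for the values recorded there.\<close>
    obtain m where m: "inverse (real (Suc m)) < e / 5"
      using reals_Archimedean[of "e / 5"] e by auto
    have "uniformly_continuous_on {0..T} f"
      by (rule compact_uniformly_continuous) auto
    then obtain d where d: "0 < d"
      "\<And>s t. s \<in> {0..T} \<Longrightarrow> t \<in> {0..T} \<Longrightarrow> dist s t < d \<Longrightarrow> dist (f s) (f t) < 1 / real (Suc m)"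
      unfolding uniformly_continuous_on_def by (metis of_nat_0_less_iff zero_less_Suc zero_less_divide_1_iff)
    obtain k where k: "inverse (real (Suc k)) < d / T"
      using reals_Archimedean[of "d / T"] d assms by auto
    then have k: "T / real (Suc k) < d"
      using assms by (simp add: field_simps)
    have "\<exists>q\<in>Q. dist (f t) q < 1 / real (Suc m)" for t
      using Q(2)[of "ball (f t) (1 / real (Suc m))"] by auto
    then obtain q where q: "\<And>t. q t \<in> Q" "\<And>t. dist (f t) (q t) < 1 / real (Suc m)"
      by metis
    define v where "v = map (\<lambda>j. q (T * real j / real (Suc k))) [0..<Suc (Suc k)]"
    have v: "v ! j = q (T * real j / real (Suc k))" if "j \<le> Suc k" for j
      using that unfolding v_def by (subst nth_map) (auto simp del: upt_Suc)
    have gf: "good (k, m, v) f"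
      using f q(2) d(2) k by (fastforce simp: good_def v dist_real_def intro: less_imp_le)
    have "v \<in> lists Q"
      using q by (auto simp: v_def simp del: upt_Suc)
    then have A: "(k, m, v) \<in> A"
      using gf unfolding A_def by blast
    define g where "g = (SOME f. good (k, m, v) f)"
    have g: "good (k, m, v) g" "g \<in> D"
      using good_D[OF A] A unfolding g_def D_def by auto
    have "dist g f \<le> 4 / real (Suc m)"
    proof (rule dist_paths_le)
      fix t assume t: "t \<in> {0..T}"
      \<comment> \<open>The last grid point not after \<open>t\<close>; either path moves by at most
        one tolerance from there to \<open>t\<close>.\<close>
      define j where "j = nat \<lfloor>t * real (Suc k) / T\<rfloor>"
      have nn: "0 \<le> t * real (Suc k) / T"
        using t assms by auto
      have jr: "real j = of_int \<lfloor>t * real (Suc k) / T\<rfloor>"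
        using nn unfolding j_def by simp
      have j1: "real j \<le> t * real (Suc k) / T" "t * real (Suc k) / T < real j + 1"
        unfolding jr by linarith+
      have "t * real (Suc k) / T \<le> real (Suc k)"
        using t assms by (simp add: divide_le_eq mult.commute mult_left_mono)
      then have j: "j \<le> Suc k"
        using j1 by linarith
      define s where "s = T * real j / real (Suc k)"
      have s: "s \<le> t" "t \<le> s + T / real (Suc k)" "0 \<le> s"
        using j1 assms unfolding s_def by (auto simp del: of_nat_Suc simp: field_simps simp flip: add_divide_distrib)
      then have st: "\<bar>t - s\<bar> \<le> T / real (Suc k)" "s \<in> {0..T}"
        using t by auto
      have 1: "dist (f s) (v ! j) \<le> 1 / real (Suc m)" "dist (f t) (f s) \<le> 1 / real (Suc m)"
        using gf j st t unfolding good_def s_def by auto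
      have 2: "dist (g s) (v ! j) \<le> 1 / real (Suc m)" "dist (g t) (g s) \<le> 1 / real (Suc m)"
        using g(1) j st t unfolding good_def s_def by auto
      have "dist (g t) (f t) \<le> dist (g t) (g s) + dist (g s) (v ! j) + dist (f s) (v ! j) + dist (f t) (f s)"
        by metric
      also have "\<dots> \<le> 4 / real (Suc m)"
        using 1 2 by (auto simp: field_simps)
      finally show "dist (g t) (f t) \<le> 4 / real (Suc m)" .
    qed (use g f assms in \<open>auto simp: good_def\<close>)
    also have "\<dots> < e"
      using m e by (simp add: field_simps)
    finally show ?thesis
      using g by blast
  qed
  ultimately show ?thesis
    using that by blast
qed

text \<open>By separability, the trace of an open set on \<open>paths T\<close> is covered by
  countably many balls inside that set, and balls are measurable through evaluations. So
  measurability into \<open>CT T\<close> can be checked one time at a time.\<close>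

lemma measurable_CT_I:
  fixes f :: "'w \<Rightarrow> (real \<Rightarrow>\<^sub>C 'a::{metric_space, second_countable_topology})"
  assumes T: "0 < T" and f: "\<And>\<omega>. \<omega> \<in> space M \<Longrightarrow> f \<omega> \<in> paths T"
    and [measurable]: "\<And>t. (\<lambda>\<omega>. f \<omega> t) \<in> borel_measurable M"
  shows "f \<in> M \<rightarrow>\<^sub>M CT T"
  unfolding CT_def
proof (rule measurable_restrict_space2)
  obtain D :: "(real \<Rightarrow>\<^sub>C 'a) set" where D: "countable D" "D \<subseteq> paths T"
    "\<And>f e. f \<in> paths T \<Longrightarrow> 0 < e \<Longrightarrow> \<exists>g\<in>D. dist g f < e"
    using separable_paths[OF T] by blast
  show "f \<in> borel_measurable M"
  proof (rule borel_measurableI)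
    fix U :: "(real \<Rightarrow>\<^sub>C 'a) set" assume "open U"
    define J where "J = {(g, n). g \<in> D \<and> ball g (1 / real (Suc n)) \<subseteq> U}"
    have "countable J"
      by (rule countable_subset[of _ "D \<times> UNIV"]) (use D in \<open>auto simp: J_def\<close>)
    have eq: "f -` U \<inter> space M = (\<Union>(g, n)\<in>J. {\<omega> \<in> space M. dist g (f \<omega>) < 1 / real (Suc n)})"
    proof safe
      fix \<omega> assume \<omega>: "f \<omega> \<in> U" "\<omega> \<in> space M"
      then obtain e where e: "0 < e" "ball (f \<omega>) e \<subseteq> U"
        using \<open>open U\<close> openE by blast
      obtain n where n: "inverse (real (Suc n)) < e / 2"
        using reals_Archimedean[of "e / 2"] e by auto
      obtain g where g: "g \<in> D" "dist g (f \<omega>) < 1 / real (Suc n)"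
        using D(3)[OF f[OF \<omega>(2)], of "1 / real (Suc n)"] by auto
      have "ball g (1 / real (Suc n)) \<subseteq> ball (f \<omega>) e"
      proof
        fix h assume h: "h \<in> ball g (1 / real (Suc n))"
        have "dist (f \<omega>) h \<le> dist g (f \<omega>) + dist g h"
          by metric
        also have "\<dots> < e"
          using h g(2) n by (simp add: inverse_eq_divide)
        finally show "h \<in> ball (f \<omega>) e"
          by simp
      qed
      then have "(g, n) \<in> J"
        using g e by (auto simp: J_def)
      then show "\<omega> \<in> (\<Union>(g, n)\<in>J. {\<omega> \<in> space M. dist g (f \<omega>) < 1 / real (Suc n)})"
        using g \<omega> by blast
    qed (auto simp: J_def)
    show "f -` U \<inter> space M \<in> sets M"
      unfolding eq
    proof (rule sets.countable_UN'')
      fix a assume "a \<in> J"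
      have "(\<lambda>\<omega>. dist (fst a) (f \<omega>)) \<in> borel_measurable M"
        by (rule borel_measurable_dist_bcontfun) auto
      then show "(case a of (g, n) \<Rightarrow> {\<omega> \<in> space M. dist g (f \<omega>) < 1 / real (Suc n)}) \<in> sets M"
        by (cases a) simp
    qed fact
  qed
qed (use f in auto)

lemma measurable_pair_path:
  fixes f :: "'w \<Rightarrow> (real \<Rightarrow>\<^sub>C 'a::{metric_space, second_countable_topology})"
    and g :: "'w \<Rightarrow> (real \<Rightarrow>\<^sub>C 'b::{metric_space, second_countable_topology})"
  assumes T: "0 < T" and f: "f \<in> M \<rightarrow>\<^sub>M CT T" and g: "g \<in> M \<rightarrow>\<^sub>M CT T"
  shows "(\<lambda>\<omega>. pair_path (f \<omega>) (g \<omega>)) \<in> M \<rightarrow>\<^sub>M CT T"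
proof (rule measurable_CT_I[OF T])
  fix t
  have [measurable]: "(\<lambda>\<omega>. f \<omega> t) \<in> borel_measurable M" "(\<lambda>\<omega>. g \<omega> t) \<in> borel_measurable M"
    using f g by (auto intro: measurable_compose[OF _ measurable_apply_CT])
  show "(\<lambda>\<omega>. pair_path (f \<omega>) (g \<omega>) t) \<in> borel_measurable M"
    by simp
qed (use f g in \<open>auto intro!: pair_path_in_paths dest: measurable_CT_space\<close>)


section \<open>Couplings of an empirical measure with a law\<close>

text \<open>Comparing with the maximum instead of using convexity gives a cruder constant, but one
  valid for every exponent \<open>q \<ge> 0\<close>.\<close>

lemma powr_add_le:
  fixes a b q :: real
  assumes "0 \<le> a" "0 \<le> b" "0 \<le> q"
  shows "(a + b) powr q \<le> 2 powr q * (a powr q + b powr q)"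
proof -
  have "(a + b) powr q \<le> (2 * max a b) powr q"
    using assms by (intro powr_mono2) auto
  also have "\<dots> = 2 powr q * max a b powr q"
    using assms by (simp add: powr_mult)
  also have "max a b powr q \<le> a powr q + b powr q"
    by (cases "a \<le> b") (auto simp: max_def)
  finally show ?thesis
    by simp
qed

text \<open>These are the densities of couplings of the uniform law on \<open>{1..N}\<close> with
  \<open>M\<close>, scaled by \<open>N\<close>. The sum condition is imposed at every point of the
  space, not just almost surely, so that \<open>h i \<omega> \<le> N\<close> holds
  everywhere.\<close>

definition coupling_weights :: "'w measure \<Rightarrow> nat \<Rightarrow> (nat \<Rightarrow> 'w \<Rightarrow> real) \<Rightarrow> bool"
  where "coupling_weights M N h \<longleftrightarrow>
    (\<forall>i\<in>{1..N}. h i \<in> borel_measurable M \<and> (\<forall>\<omega>\<in>space M. 0 \<le> h i \<omega>) \<and>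
                 (\<integral>\<^sup>+\<omega>. ennreal (h i \<omega>) \<partial>M) = 1) \<and>
    (\<forall>\<omega>\<in>space M. (\<Sum>i=1..N. h i \<omega>) = real N)"

text \<open>The cost \<open>D i \<omega>\<close> is an arbitrary function rather than a distance of
  fixed variables, so that data, time marginals and paths can be compared under the same
  weights.\<close>

definition weighted_cost :: "'w measure \<Rightarrow> nat \<Rightarrow> (nat \<Rightarrow> 'w \<Rightarrow> real) \<Rightarrow> (nat \<Rightarrow> 'w \<Rightarrow> real) \<Rightarrow> ennreal"
  where "weighted_cost M N h D = (\<Sum>i=1..N. \<integral>\<^sup>+\<omega>. ennreal (h i \<omega> * D i \<omega>) \<partial>M) / of_nat N"

lemma coupling_weightsD:
  assumes "coupling_weights M N h"
  shows "i \<in> {1..N} \<Longrightarrow> h i \<in> borel_measurable M"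
    and "i \<in> {1..N} \<Longrightarrow> \<omega> \<in> space M \<Longrightarrow> 0 \<le> h i \<omega>"
    and "i \<in> {1..N} \<Longrightarrow> (\<integral>\<^sup>+\<omega>. ennreal (h i \<omega>) \<partial>M) = 1"
    and "\<omega> \<in> space M \<Longrightarrow> (\<Sum>i=1..N. h i \<omega>) = real N"
  using assms unfolding coupling_weights_def by blast+

text \<open>The coupling is the image of the measure with density \<open>h / N\<close> on \<open>{1..N} \<times> \<Omega>\<close>.\<close>

lemma transport_cost_le_weighted_cost:
  fixes E :: "'e::metric_space measure"
  assumes M: "prob_space M" and N: "1 \<le> N"
    and h: "coupling_weights M N h"
    and y: "\<And>i. i \<in> {1..N} \<Longrightarrow> y i \<in> space E"
    and Y [measurable]: "Y \<in> M \<rightarrow>\<^sub>M E"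
    and dist [measurable]: "(\<lambda>z. dist (fst z) (snd z)) \<in> borel_measurable (E \<Otimes>\<^sub>M E)"
  shows "transport_cost E p (empirical E N y) (distr M E Y)
    \<le> weighted_cost M N h (\<lambda>i \<omega>. dist (y i) (Y \<omega>) powr p)"
proof -
  interpret prob_space M by fact
  define P where "P = count_space {1..N} \<Otimes>\<^sub>M M"
  define H where "H = (\<lambda>(i, \<omega>). ennreal (h i \<omega>) / of_nat N)"
  define g where "g = (\<lambda>(i, \<omega>). (y i, Y \<omega>))"
  note [measurable] = coupling_weightsD(1)[OF h]
  have [measurable]: "H \<in> borel_measurable P"
    unfolding P_def H_def by (rule measurable_pair_measure_countable1) (auto simp: divide_ennreal_def)
  have [measurable]: "g \<in> P \<rightarrow>\<^sub>M E \<Otimes>\<^sub>M E"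
    unfolding P_def g_def by (rule measurable_pair_measure_countable1) (use y in auto)
  define \<pi> where "\<pi> = distr (density P H) (E \<Otimes>\<^sub>M E) g"
  have sets_\<pi>: "sets \<pi> = sets (E \<Otimes>\<^sub>M E)"
    by (simp add: \<pi>_def)
  \<comment> \<open>Both marginals and the transport cost of \<open>\<pi>\<close> are instances of
    this formula: the first marginal uses the mean of each weight, the second the sum of the weights
    over \<open>i\<close>.\<close>
  have I: "(\<integral>\<^sup>+z. f z \<partial>\<pi>) = (\<Sum>i=1..N. \<integral>\<^sup>+\<omega>. ennreal (h i \<omega>) * f (y i, Y \<omega>) \<partial>M) / of_nat N"
    if [measurable]: "f \<in> borel_measurable (E \<Otimes>\<^sub>M E)" for f :: "'e \<times> 'e \<Rightarrow> ennreal"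
  proof -
    have [measurable]: "(\<lambda>\<omega>. f (y i, Y \<omega>)) \<in> borel_measurable M" if "i \<in> {1..N}" for i
      using y[OF that] by measurable
    have "(\<integral>\<^sup>+z. f z \<partial>\<pi>) = (\<integral>\<^sup>+x. H x * f (g x) \<partial>P)"
      unfolding \<pi>_def by (simp add: nn_integral_distr nn_integral_density)
    also have "\<dots> = (\<integral>\<^sup>+i. (\<integral>\<^sup>+\<omega>. H (i, \<omega>) * f (g (i, \<omega>)) \<partial>M) \<partial>count_space {1..N})"
      unfolding P_def by (rule nn_integral_fst[symmetric]) (simp only: P_def[symmetric], measurable)
    also have "\<dots> = (\<Sum>i=1..N. \<integral>\<^sup>+\<omega>. ennreal (h i \<omega>) * f (y i, Y \<omega>) / of_nat N \<partial>M)"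
      by (simp add: nn_integral_count_space_finite H_def g_def divide_ennreal_def mult_ac)
    also have "\<dots> = (\<Sum>i=1..N. (\<integral>\<^sup>+\<omega>. ennreal (h i \<omega>) * f (y i, Y \<omega>) \<partial>M) / of_nat N)"
      by (intro sum.cong refl nn_integral_divide) measurable
    finally show ?thesis
      by (simp add: divide_ennreal_def sum_distrib_right)
  qed
  have "distr \<pi> E fst = empirical E N y"
  proof (rule measure_eqI)
    fix A assume "A \<in> sets (distr \<pi> E fst)"
    then have A [measurable]: "A \<in> sets E" by simp
    have "emeasure (distr \<pi> E fst) A = (\<integral>\<^sup>+x. indicator A x \<partial>distr \<pi> E fst)"
      by simp
    also have "\<dots> = (\<integral>\<^sup>+z. indicator A (fst z) \<partial>\<pi>)"
      by (rule nn_integral_distr) (auto simp: measurable_cong_sets[OF sets_\<pi> refl])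
    also have "\<dots> = (\<Sum>i=1..N. \<integral>\<^sup>+\<omega>. ennreal (h i \<omega>) * indicator A (y i) \<partial>M) / of_nat N"
      by (subst I) auto
    also have "\<dots> = (\<Sum>i=1..N. indicator A (y i)) / of_nat N"
      using coupling_weightsD(3)[OF h] by (simp add: nn_integral_multc)
    finally show "emeasure (distr \<pi> E fst) A = emeasure (empirical E N y) A"
      by (simp add: emeasure_empirical)
  qed simp
  moreover have "distr \<pi> E snd = distr M E Y"
  proof (rule measure_eqI)
    fix A assume "A \<in> sets (distr \<pi> E snd)"
    then have A [measurable]: "A \<in> sets E" by simp
    have "emeasure (distr \<pi> E snd) A = (\<integral>\<^sup>+x. indicator A x \<partial>distr \<pi> E snd)"
      by simp
    also have "\<dots> = (\<integral>\<^sup>+z. indicator A (snd z) \<partial>\<pi>)"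
      by (rule nn_integral_distr) (auto simp: measurable_cong_sets[OF sets_\<pi> refl])
    also have "\<dots> = (\<Sum>i=1..N. \<integral>\<^sup>+\<omega>. ennreal (h i \<omega>) * indicator A (Y \<omega>) \<partial>M) / of_nat N"
      by (subst I) auto
    also have "(\<Sum>i=1..N. \<integral>\<^sup>+\<omega>. ennreal (h i \<omega>) * indicator A (Y \<omega>) \<partial>M)
        = (\<integral>\<^sup>+\<omega>. (\<Sum>i=1..N. ennreal (h i \<omega>) * indicator A (Y \<omega>)) \<partial>M)"
      by (rule nn_integral_sum[symmetric]) measurable
    also have "\<dots> = (\<integral>\<^sup>+\<omega>. of_nat N * indicator A (Y \<omega>) \<partial>M)"
    proof (rule nn_integral_cong)
      fix \<omega> assume \<omega>: "\<omega> \<in> space M"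
      have "(\<Sum>i=1..N. ennreal (h i \<omega>)) = ennreal (real N)"
        using coupling_weightsD(2,4)[OF h] \<omega> by (subst sum_ennreal) auto
      then show "(\<Sum>i=1..N. ennreal (h i \<omega>) * indicator A (Y \<omega>)) = of_nat N * indicator A (Y \<omega>)"
        by (simp add: ennreal_of_nat_eq_real_of_nat flip: sum_distrib_right)
    qed
    also have "\<dots> / of_nat N = (\<integral>\<^sup>+\<omega>. indicator A (Y \<omega>) \<partial>M)"
      using N by (subst nn_integral_cmult, simp) (subst mult.commute, auto intro!: mult_divide_eq_ennreal)
    also have "\<dots> = (\<integral>\<^sup>+x. indicator A x \<partial>distr M E Y)"
      by (rule nn_integral_distr[symmetric]) auto
    finally show "emeasure (distr \<pi> E snd) A = emeasure (distr M E Y) A"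
      by simp
  qed simp
  ultimately have "\<pi> \<in> couplings E (empirical E N y) (distr M E Y)"
    unfolding couplings_def using sets_\<pi> by simp
  then have "transport_cost E p (empirical E N y) (distr M E Y)
      \<le> (\<integral>\<^sup>+z. ennreal (dist (fst z) (snd z) powr p) \<partial>\<pi>)"
    unfolding transport_cost_def by (rule INF_lower)
  also have "\<dots> = (\<Sum>i=1..N. \<integral>\<^sup>+\<omega>. ennreal (h i \<omega>) * ennreal (dist (y i) (Y \<omega>) powr p) \<partial>M) / of_nat N"
    by (subst I) auto
  also have "\<dots> = weighted_cost M N h (\<lambda>i \<omega>. dist (y i) (Y \<omega>) powr p)"
    unfolding weighted_cost_def
    by (intro arg_cong2[where f = "(/)"] sum.cong refl nn_integral_cong)
      (simp add: ennreal_mult'' coupling_weightsD(2)[OF h])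
  finally show ?thesis .
qed

text \<open>As an image of the uniform measure, the empirical measure inherits the change of
  variables formulas, so its integrals become finite averages.\<close>

lemma empirical_eq_distr:
  assumes N: "1 \<le> N" and y: "\<And>i. i \<in> {1..N} \<Longrightarrow> y i \<in> space E"
  shows "empirical E N y = distr (uniform_count_measure {1..N}) E y"
proof (rule measure_eqI)
  fix A assume "A \<in> sets (empirical E N y)"
  then have A [measurable]: "A \<in> sets E" by simp
  have [measurable]: "y \<in> uniform_count_measure {1..N} \<rightarrow>\<^sub>M E"
    using y by (auto simp: measurable_def sets_uniform_count_measure space_uniform_count_measure)
  have "emeasure (distr (uniform_count_measure {1..N}) E y) A
      = ennreal (real (card (y -` A \<inter> {1..N})) / real N)"
    using N by (simp add: emeasure_distr emeasure_uniform_count_measure space_uniform_count_measure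
        del: One_nat_def)
  also have "real (card (y -` A \<inter> {1..N})) = (\<Sum>i=1..N. indicator A (y i))"
    by (simp add: indicator_def sum.If_cases Int_def vimage_def conj_commute)
  finally show "emeasure (empirical E N y) A = emeasure (distr (uniform_count_measure {1..N}) E y) A"
    using N by (simp add: emeasure_empirical divide_ennreal[symmetric] sum_nonneg ennreal_of_nat_eq_real_of_nat
       flip: sum_ennreal) (simp add: indicator_def ennreal_of_nat_eq_real_of_nat)
qed simp

lemma prob_space_empirical:
  assumes N: "1 \<le> N" and y: "\<And>i. i \<in> {1..N} \<Longrightarrow> y i \<in> space E"
  shows "prob_space (empirical E N y)"
  using assms by (subst empirical_eq_distr) (auto intro!: prob_space.prob_space_distr prob_space_uniform_count_measure
      simp: measurable_def sets_uniform_count_measure space_uniform_count_measure)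

lemma nn_integral_empirical:
  assumes N: "1 \<le> N" and y: "\<And>i. i \<in> {1..N} \<Longrightarrow> y i \<in> space E" and f: "f \<in> borel_measurable E"
  shows "(\<integral>\<^sup>+x. f x \<partial>empirical E N y) = (\<Sum>i=1..N. f (y i)) / of_nat N"
proof -
  have [measurable]: "y \<in> uniform_count_measure {1..N} \<rightarrow>\<^sub>M E"
    using y by (auto simp: measurable_def sets_uniform_count_measure space_uniform_count_measure)
  have "(\<integral>\<^sup>+x. f x \<partial>empirical E N y) = (\<integral>\<^sup>+i. f (y i) \<partial>uniform_count_measure {1..N})"
    using f N y by (subst empirical_eq_distr) (auto simp: nn_integral_distr simp del: One_nat_def)
  also have "\<dots> = (\<Sum>i=1..N. ennreal (1 / real N) * f (y i))"
    unfolding uniform_count_measure_def by (simp add: nn_integral_point_measure_finite)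
  also have "\<dots> = (\<Sum>i=1..N. f (y i)) / of_nat N"
    using N unfolding sum_distrib_left[symmetric] divide_ennreal_def
    by (subst mult.commute) (simp add: ennreal_of_nat_eq_real_of_nat inverse_ennreal inverse_eq_divide)
  finally show ?thesis .
qed

lemma integral_empirical:
  fixes f :: "'e \<Rightarrow> real"
  assumes N: "1 \<le> N" and y: "\<And>i. i \<in> {1..N} \<Longrightarrow> y i \<in> space E" and f: "f \<in> borel_measurable E"
  shows "(\<integral>x. f x \<partial>empirical E N y) = (\<Sum>i=1..N. f (y i)) / real N"
proof -
  have [measurable]: "y \<in> uniform_count_measure {1..N} \<rightarrow>\<^sub>M E"
    using y by (auto simp: measurable_def sets_uniform_count_measure space_uniform_count_measure)
  have "(\<integral>x. f x \<partial>empirical E N y) = (\<integral>i. f (y i) \<partial>uniform_count_measure {1..N})"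
    using f N y by (subst empirical_eq_distr) (auto simp: integral_distr simp del: One_nat_def)
  also have "\<dots> = (\<Sum>i=1..N. f (y i)) / real N"
    unfolding uniform_count_measure_def
    by (simp add: lebesgue_integral_point_measure_finite sum_divide_distrib)
  finally show ?thesis .
qed

text \<open>Instead of Jensen's inequality, \<open>d \<le> e + e\<^sup>1\<^sup>-\<^sup>q d\<^sup>q\<close> is used for every \<open>e > 0\<close>.\<close>

lemma transport_cost_lipschitz:
  fixes E :: "'e::metric_space measure" and \<phi> :: "'e \<Rightarrow> real"
  assumes cost: "transport_cost E q \<mu> \<nu> < ennreal c" and c: "0 \<le> c"
    and \<mu>: "prob_space \<mu>" "sets \<mu> = sets E" and \<nu>: "prob_space \<nu>" "sets \<nu> = sets E"
    and q: "1 \<le> q" and e: "0 < e"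
    and \<phi> [measurable]: "\<phi> \<in> borel_measurable E" and lip: "C-lipschitz_on UNIV \<phi>"
    and \<phi>01: "\<And>x. \<phi> x \<in> {0..1}"
    and dist [measurable]: "(\<lambda>z. dist (fst z) (snd z)) \<in> borel_measurable (E \<Otimes>\<^sub>M E)"
  shows "\<bar>(\<integral>x. \<phi> x \<partial>\<mu>) - (\<integral>x. \<phi> x \<partial>\<nu>)\<bar> \<le> C * (e + e powr (1 - q) * c)"
proof -
  obtain \<pi> where \<pi>: "\<pi> \<in> couplings E \<mu> \<nu>"
    and I: "(\<integral>\<^sup>+z. ennreal (dist (fst z) (snd z) powr q) \<partial>\<pi>) < ennreal c"
    using cost unfolding transport_cost_def by (auto simp: INF_less_iff)
  have sets_\<pi> [measurable_cong]: "sets \<pi> = sets (E \<Otimes>\<^sub>M E)"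
    and \<mu>_eq: "\<mu> = distr \<pi> E fst" and \<nu>_eq: "\<nu> = distr \<pi> E snd"
    using \<pi> unfolding couplings_def by auto
  interpret prob_space \<pi>
    by (rule prob_space_distrD[of fst _ E]) (use \<mu> \<mu>_eq in auto)
  have C: "0 \<le> C"
    using lip by (rule lipschitz_on_nonneg)
  define d where "d = (\<lambda>z::'e \<times> 'e. dist (fst z) (snd z))"
  have [measurable]: "d \<in> borel_measurable \<pi>"
    unfolding d_def by measurable
  have int: "integrable \<pi> (\<lambda>z. d z powr q)"
    using I by (intro integrableI_nonneg) (auto simp: d_def intro: less_trans)
  have "ennreal (\<integral>z. d z powr q \<partial>\<pi>) \<le> ennreal c"
    using I int by (subst nn_integral_eq_integral[symmetric]) (auto simp: d_def)
  then have le: "(\<integral>z. d z powr q \<partial>\<pi>) \<le> c"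
    using c by (simp add: ennreal_le_iff)
  have bd: "integrable \<pi> (\<lambda>z. \<phi> (fst z))" "integrable \<pi> (\<lambda>z. \<phi> (snd z))"
    using \<phi>01 by (auto intro!: integrable_const_bound[where B = 1])
  have "\<bar>\<phi> (fst z) - \<phi> (snd z)\<bar> \<le> C * (e + e powr (1 - q) * d z powr q)" for z
  proof -
    have "d z \<le> e + e powr (1 - q) * d z powr q"
    proof (cases "d z \<le> e")
      case False
      \<comment> \<open>Since \<open>1 - q \<le> 0\<close>, the factor
        \<open>d z powr (1 - q)\<close> is at most \<open>e powr (1 - q)\<close> beyond the
        threshold \<open>e\<close>.\<close>
      have "d z = d z powr (1 - q) * d z powr q"
        using False e by (simp flip: powr_add)
      also have "\<dots> \<le> e powr (1 - q) * d z powr q"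
        using False e q by (intro mult_right_mono powr_mono2') auto
      finally show ?thesis
        using e by linarith
    qed (simp add: add_increasing2)
    then show ?thesis
      using lipschitz_onD[OF lip, of "fst z" "snd z"] C
      by (simp add: dist_real_def d_def) (meson mult_left_mono order_trans)
  qed
  then have "(\<integral>z. \<bar>\<phi> (fst z) - \<phi> (snd z)\<bar> \<partial>\<pi>) \<le> (\<integral>z. C * (e + e powr (1 - q) * d z powr q) \<partial>\<pi>)"
    using bd int by (intro integral_mono) auto
  also have "\<dots> = C * (e + e powr (1 - q) * (\<integral>z. d z powr q \<partial>\<pi>))"
    using int by (simp add: prob_space)
  also have "\<dots> \<le> C * (e + e powr (1 - q) * c)"
    using C le by (intro mult_left_mono add_left_mono) auto
  finally have "(\<integral>z. \<bar>\<phi> (fst z) - \<phi> (snd z)\<bar> \<partial>\<pi>) \<le> C * (e + e powr (1 - q) * c)" .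
  moreover have "(\<integral>x. \<phi> x \<partial>\<mu>) - (\<integral>x. \<phi> x \<partial>\<nu>) = (\<integral>z. \<phi> (fst z) - \<phi> (snd z) \<partial>\<pi>)"
    unfolding \<mu>_eq \<nu>_eq using bd by (simp add: integral_distr)
  moreover have "\<bar>\<integral>z. \<phi> (fst z) - \<phi> (snd z) \<partial>\<pi>\<bar> \<le> (\<integral>z. \<bar>\<phi> (fst z) - \<phi> (snd z)\<bar> \<partial>\<pi>)"
    by (rule integral_abs_bound)
  ultimately show ?thesis
    by linarith
qed

text \<open>This is the triangle inequality under a coupling of cost below \<open>c\<close>. Both
  directions are used: the second gives the limit \<open>Rbar\<close> a finite moment, the first
  then bounds the moments of the empirical measures.\<close>

lemma transport_cost_moments:
  fixes E :: "'e::real_normed_vector measure"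
  assumes cost: "transport_cost E q \<mu> \<nu> < ennreal c" and c: "0 \<le> c" and q: "0 \<le> q"
    and norm [measurable]: "norm \<in> borel_measurable E"
    and dist [measurable]: "(\<lambda>z. dist (fst z) (snd z)) \<in> borel_measurable (E \<Otimes>\<^sub>M E)"
  shows "(\<integral>\<^sup>+x. ennreal (norm x powr q) \<partial>\<mu>) \<le> ennreal (2 powr q) * ((\<integral>\<^sup>+x. ennreal (norm x powr q) \<partial>\<nu>) + ennreal c)"
    and "(\<integral>\<^sup>+x. ennreal (norm x powr q) \<partial>\<nu>) \<le> ennreal (2 powr q) * ((\<integral>\<^sup>+x. ennreal (norm x powr q) \<partial>\<mu>) + ennreal c)"
proof -
  obtain \<pi> where \<pi>: "\<pi> \<in> couplings E \<mu> \<nu>"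
    and I: "(\<integral>\<^sup>+z. ennreal (dist (fst z) (snd z) powr q) \<partial>\<pi>) < ennreal c"
    using cost unfolding transport_cost_def by (auto simp: INF_less_iff)
  have sets_\<pi> [measurable_cong]: "sets \<pi> = sets (E \<Otimes>\<^sub>M E)"
    and \<mu>_eq: "\<mu> = distr \<pi> E fst" and \<nu>_eq: "\<nu> = distr \<pi> E snd"
    using \<pi> unfolding couplings_def by auto
  have \<mu>I: "(\<integral>\<^sup>+x. ennreal (norm x powr q) \<partial>\<mu>) = (\<integral>\<^sup>+z. ennreal (norm (fst z) powr q) \<partial>\<pi>)"
    and \<nu>I: "(\<integral>\<^sup>+x. ennreal (norm x powr q) \<partial>\<nu>) = (\<integral>\<^sup>+z. ennreal (norm (snd z) powr q) \<partial>\<pi>)"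
    unfolding \<mu>_eq \<nu>_eq by (simp_all add: nn_integral_distr)
  have *: "(\<integral>\<^sup>+z. ennreal (norm (s z) powr q) \<partial>\<pi>)
      \<le> ennreal (2 powr q) * ((\<integral>\<^sup>+z. ennreal (norm (t z) powr q) \<partial>\<pi>) + ennreal c)"
    if [measurable]: "s \<in> E \<Otimes>\<^sub>M E \<rightarrow>\<^sub>M E" "t \<in> E \<Otimes>\<^sub>M E \<rightarrow>\<^sub>M E"
      and st: "\<And>z. norm (s z) \<le> norm (t z) + dist (fst z) (snd z)" for s t :: "'e \<times> 'e \<Rightarrow> 'e"
  proof -
    have "(\<integral>\<^sup>+z. ennreal (norm (s z) powr q) \<partial>\<pi>)
        \<le> (\<integral>\<^sup>+z. ennreal (2 powr q) * (ennreal (norm (t z) powr q) + ennreal (dist (fst z) (snd z) powr q)) \<partial>\<pi>)"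
    proof (rule nn_integral_mono)
      fix z
      have "norm (s z) powr q \<le> (norm (t z) + dist (fst z) (snd z)) powr q"
        using st q by (intro powr_mono2) auto
      also have "\<dots> \<le> 2 powr q * (norm (t z) powr q + dist (fst z) (snd z) powr q)"
        using q by (intro powr_add_le) auto
      finally show "ennreal (norm (s z) powr q)
          \<le> ennreal (2 powr q) * (ennreal (norm (t z) powr q) + ennreal (dist (fst z) (snd z) powr q))"
        by (simp flip: ennreal_plus ennreal_mult)
    qed
    also have "\<dots> = ennreal (2 powr q) * ((\<integral>\<^sup>+z. ennreal (norm (t z) powr q) \<partial>\<pi>)
        + (\<integral>\<^sup>+z. ennreal (dist (fst z) (snd z) powr q) \<partial>\<pi>))"
      by (simp add: nn_integral_cmult nn_integral_add)
    also have "\<dots> \<le> ennreal (2 powr q) * ((\<integral>\<^sup>+z. ennreal (norm (t z) powr q) \<partial>\<pi>) + ennreal c)"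
      using I by (intro mult_left_mono add_left_mono) auto
    finally show ?thesis .
  qed
  show "(\<integral>\<^sup>+x. ennreal (norm x powr q) \<partial>\<mu>) \<le> ennreal (2 powr q) * ((\<integral>\<^sup>+x. ennreal (norm x powr q) \<partial>\<nu>) + ennreal c)"
    unfolding \<mu>I \<nu>I by (rule *) (auto simp: dist_norm norm_triangle_sub)
  show "(\<integral>\<^sup>+x. ennreal (norm x powr q) \<partial>\<nu>) \<le> ennreal (2 powr q) * ((\<integral>\<^sup>+x. ennreal (norm x powr q) \<partial>\<mu>) + ennreal c)"
    unfolding \<mu>I \<nu>I
    by (rule *) (simp_all add: dist_norm norm_minus_commute[of "fst _" "snd _"] norm_triangle_sub)
qed


section \<open>Stability of the equations\<close>

text \<open>A weighted supremum norm replaces Gronwall's inequality: with the weight \<open>exp (- 8 L t)\<close>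
  the integral operator has norm at most \<open>1/8\<close>.\<close>

lemma integrated_eq_diff_bound:
  fixes x x' w w' :: "real \<Rightarrow>\<^sub>C 'a::euclidean_space"
  assumes eq: "integrated_eq T \<beta> z w x" "integrated_eq T \<beta>' z' w' x'"
    and L: "0 < L" and T: "0 < T" and \<rho>: "0 \<le> \<rho>" and m: "0 \<le> m"
    and lip: "\<And>s. s \<in> {0..T} \<Longrightarrow>
      norm (\<beta> s - \<beta>' s) \<le> L * (norm (x s - x' s) + \<rho> + m * exp (8 * L * s))"
    and t: "t \<in> {0..T}"
  shows "norm (x t - x' t)
    \<le> exp (8 * L * t) * (2 * (norm (z - z') + 2 * dist w w' + L * T * \<rho>) + m / 4)"
proof -
  \<comment> \<open>The 2 comes from the increments \<open>w t - w 0\<close>, which see the driving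
    paths at two times. In the applications \<open>\<rho>\<close> is the distance of the paths
    \<open>r\<close> and \<open>m\<close> the weighted distance of the time marginals;
    \<open>m\<close> is kept apart because it is absorbed later.\<close>
  define a where "a = norm (z - z') + 2 * dist w w'"
  have a: "0 \<le> a"
    by (simp add: a_def)
  have inv: "exp (8 * L * t) * (exp (- (8 * L * t)) * y) = y" "exp (- (8 * L * t)) * (exp (8 * L * t) * y) = y" for t y
    by (simp_all add: exp_minus)
  define u where "u = (\<lambda>t. exp (- (8 * L * t)) * norm (x t - x' t))"
  define d where "d = (SUP t\<in>{0..T}. u t)"
  have "u t \<le> dist x x'" if "t \<in> {0..T}" for t
  proof -
    have "u t \<le> 1 * norm (x t - x' t)"
      unfolding u_def using that L by (intro mult_right_mono) auto
    also have "\<dots> \<le> dist x x'"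
      using dist_bounded[of x t x'] by (simp add: dist_norm)
    finally show ?thesis .
  qed
  then have bdd: "bdd_above (u ` {0..T})"
    by (auto intro!: bdd_aboveI2[where M = "dist x x'"])
  have u_le: "u s \<le> d" if "s \<in> {0..T}" for s
    unfolding d_def using bdd that by (rule cSUP_upper2) simp
  have d: "0 \<le> d"
    using u_le[of 0] T by (simp add: u_def) (meson norm_ge_zero order_trans)
  have bound: "norm (x t - x' t) \<le> a + L * T * \<rho> + (d + m) / 8 * exp (8 * L * t)" if t: "t \<in> {0..T}" for t
  proof -
    have sub: "{0..t} \<subseteq> {0..T}"
      using t by auto
    have int: "set_integrable lborel {0..t} \<beta>" "set_integrable lborel {0..t} \<beta>'"
      using eq sub unfolding integrated_eq_def by (auto intro: set_integrable_subset)
    \<comment> \<open>Integrating \<open>exp (8 * L * s)\<close> produces the factor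
      \<open>1 / (8 * L)\<close>, which turns the Lipschitz constant in front of
      \<open>d + m\<close> into \<open>1 / 8\<close>.\<close>
    define B where "B = (\<lambda>s. L * \<rho> + L * (d + m) * exp (8 * L * s))"
    have B_int: "set_integrable lborel {0..t} B"
      unfolding B_def by (rule borel_integrable_atLeastAtMost') (intro continuous_intros)
    have "norm (LINT s:{0..t}|lborel. \<beta> s - \<beta>' s) \<le> (LINT s:{0..t}|lborel. norm (\<beta> s - \<beta>' s))"
      unfolding set_lebesgue_integral_def
      by (rule order_trans[OF integral_norm_bound]) (simp add: norm_scaleR)
    also have "\<dots> \<le> (LINT s:{0..t}|lborel. B s)"
    proof (rule set_integral_mono)
      show "set_integrable lborel {0..t} (\<lambda>s. norm (\<beta> s - \<beta>' s))"
        using int by (intro set_integrable_norm set_integral_diff) auto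
      fix s assume s: "s \<in> {0..t}"
      have "norm (x s - x' s) = exp (8 * L * s) * u s"
        by (simp add: u_def inv)
      also have "\<dots> \<le> exp (8 * L * s) * d"
        using u_le sub s by (intro mult_left_mono) auto
      finally have "L * (norm (x s - x' s) + \<rho> + m * exp (8 * L * s))
          \<le> L * (exp (8 * L * s) * d + \<rho> + m * exp (8 * L * s))"
        using L by simp
      then show "norm (\<beta> s - \<beta>' s) \<le> B s"
        using lip[OF subsetD[OF sub s]] by (simp add: B_def algebra_simps)
    qed (fact B_int)
    also have "\<dots> = (L * \<rho> * t + (d + m) / 8 * exp (8 * L * t)) - (L * \<rho> * 0 + (d + m) / 8 * exp (8 * L * 0))"
    proof -
      have "(\<integral>s. B s * indicator {0..t} s \<partial>lborel)
          = (L * \<rho> * t + (d + m) / 8 * exp (8 * L * t)) - (L * \<rho> * 0 + (d + m) / 8 * exp (8 * L * 0))"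
      proof (rule integral_FTC_Icc_real)
        show "0 \<le> t" using t by simp
      next
        fix s
        show "((\<lambda>s. L * \<rho> * s + (d + m) / 8 * exp (8 * L * s)) has_field_derivative B s) (at s)"
          unfolding B_def by (auto intro!: derivative_eq_intros)
        show "isCont B s"
          unfolding B_def by (intro continuous_intros)
      qed
      then show ?thesis
        by (simp add: set_lebesgue_integral_def mult.commute)
    qed
    also have "\<dots> \<le> L * T * \<rho> + (d + m) / 8 * exp (8 * L * t)"
    proof -
      have "L * \<rho> * t \<le> L * \<rho> * T"
        using t L \<rho> by (intro mult_left_mono) auto
      moreover have "0 \<le> (d + m) / 8 * exp (8 * L * 0)"
        using d m by simp
      moreover have "L * \<rho> * T = L * T * \<rho>"
        by simp
      ultimately show ?thesis
        by linarith
    qed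
    finally have I: "norm (LINT s:{0..t}|lborel. \<beta> s - \<beta>' s) \<le> L * T * \<rho> + (d + m) / 8 * exp (8 * L * t)" .
    have "x t - x' t = (z - z') + (LINT s:{0..t}|lborel. \<beta> s - \<beta>' s) + ((w t - w' t) - (w 0 - w' 0))"
    proof -
      have "x t = z + (LINT s:{0..t}|lborel. \<beta> s) + (w t - w 0)"
        "x' t = z' + (LINT s:{0..t}|lborel. \<beta>' s) + (w' t - w' 0)"
        using eq t unfolding integrated_eq_def by blast+
      then show ?thesis
        unfolding set_integral_diff(2)[OF int] by simp
    qed
    also have "norm \<dots> \<le> norm (z - z') + norm (LINT s:{0..t}|lborel. \<beta> s - \<beta>' s) + (norm (w t - w' t) + norm (w 0 - w' 0))"
      by (intro order_trans[OF norm_triangle_ineq] add_mono order_refl norm_triangle_ineq norm_triangle_ineq4)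
    also have "\<dots> \<le> norm (z - z') + (L * T * \<rho> + (d + m) / 8 * exp (8 * L * t)) + (dist w w' + dist w w')"
      using I dist_bounded[of w _ w'] by (intro add_mono) (auto simp: dist_norm)
    finally show ?thesis
      by (simp add: a_def)
  qed
  have "u t \<le> a + L * T * \<rho> + (d + m) / 8" if t: "t \<in> {0..T}" for t
  proof -
    have "u t \<le> exp (- (8 * L * t)) * (a + L * T * \<rho> + (d + m) / 8 * exp (8 * L * t))"
      unfolding u_def by (intro mult_left_mono bound t) auto
    also have "\<dots> = exp (- (8 * L * t)) * (a + L * T * \<rho>) + (d + m) / 8"
      using inv(2)[of t "(d + m) / 8"] by (simp only: distrib_left mult.commute[of "(d + m) / 8"])
    also have "exp (- (8 * L * t)) * (a + L * T * \<rho>) \<le> 1 * (a + L * T * \<rho>)"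
      using L T t a \<rho> by (intro mult_right_mono) auto
    finally show ?thesis
      by simp
  qed
  then have "d \<le> a + L * T * \<rho> + (d + m) / 8"
    unfolding d_def using T by (intro cSUP_least) auto
  moreover have "0 \<le> a + L * T * \<rho>"
    using L T \<rho> a by simp
  \<comment> \<open>Absorbing \<open>e / 8\<close> gives \<open>8 / 7 * A + m / 7\<close>, rounded
    up. What matters later is that the coefficient of \<open>m\<close> stays below
    \<open>1 / 2\<close> after doubling it, up to equality:
    \<open>2 * (m / 4) = m / 2\<close>.\<close>
  moreover have "e \<le> 2 * A + m / 4" if "e \<le> A + (e + m) / 8" "0 \<le> A" for e A :: real
    using that m by (simp add: field_simps)
  ultimately have "d \<le> 2 * (a + L * T * \<rho>) + m / 4"
    by blast
  then have "u t \<le> 2 * (a + L * T * \<rho>) + m / 4"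
    using u_le[OF t] by linarith
  then have "exp (8 * L * t) * u t \<le> exp (8 * L * t) * (2 * (a + L * T * \<rho>) + m / 4)"
    by (intro mult_left_mono) auto
  then show ?thesis
    by (simp add: u_def inv a_def)
qed

text \<open>Superadditivity of the power, from \<open>x powr p = x * x powr (p - 1)\<close> and
  monotonicity of the second factor. It allows taking \<open>p\<close>-th roots in the Lipschitz
  condition and closes the estimate for the time marginals.\<close>

lemma powr_add_ge:
  fixes a b p :: real
  assumes "0 \<le> a" "0 \<le> b" "1 \<le> p"
  shows "a powr p + b powr p \<le> (a + b) powr p"
proof -
  have *: "x powr p = x * x powr (p - 1)" if "0 \<le> x" for x :: real
    using powr_mult_base[OF that, of "p - 1"] by simp
  have "a powr p + b powr p \<le> a * (a + b) powr (p - 1) + b * (a + b) powr (p - 1)"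
    unfolding *[OF assms(1)] *[OF assms(2)]
    using assms by (intro add_mono mult_left_mono powr_mono2) auto
  also have "\<dots> = (a + b) powr p"
    using assms by (simp add: *[of "a + b"] distrib_right)
  finally show ?thesis .
qed

lemma powr_add4_le:
  fixes a b c d q :: real
  assumes "0 \<le> a" "0 \<le> b" "0 \<le> c" "0 \<le> d" "0 \<le> q"
  shows "(a + b + c + d) powr q \<le> 4 powr q * (a powr q + b powr q + c powr q + d powr q)"
proof -
  define e where "e = max (max a b) (max c d)"
  have "(a + b + c + d) powr q \<le> (4 * e) powr q"
    using assms by (intro powr_mono2) (auto simp: e_def)
  also have "\<dots> = 4 powr q * e powr q"
    using assms by (simp add: powr_mult e_def)
  also have "e powr q \<le> a powr q + b powr q + c powr q + d powr q"
    unfolding e_def max_def by (auto intro: add_nonneg_nonneg)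
  finally show ?thesis
    by simp
qed

lemma powr_le_powr_iff:
  fixes a b p :: real
  assumes "0 \<le> a" "0 \<le> b" "0 < p"
  shows "a powr p \<le> b powr p \<longleftrightarrow> a \<le> b"
  using assms by (meson not_le powr_less_mono2 powr_mono2 less_imp_le)

lemma weighted_cost_mono:
  assumes h: "coupling_weights M N h"
    and le: "\<And>i. i \<in> {1..N} \<Longrightarrow> AE \<omega> in M. D i \<omega> \<le> D' i \<omega>"
  shows "weighted_cost M N h D \<le> weighted_cost M N h D'"
  unfolding weighted_cost_def
proof (intro divide_right_mono_ennreal sum_mono nn_integral_mono_AE)
  fix i assume i: "i \<in> {1..N}"
  show "AE \<omega> in M. ennreal (h i \<omega> * D i \<omega>) \<le> ennreal (h i \<omega> * D' i \<omega>)"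
    using le[OF i] AE_space
    by eventually_elim (auto intro!: ennreal_leI mult_left_mono coupling_weightsD(2)[OF h i])
qed

lemma weighted_cost_affine:
  assumes N: "1 \<le> N" and h: "coupling_weights M N h" and a: "0 \<le> a" and e: "0 \<le> e"
    and D: "\<And>i. i \<in> {1..N} \<Longrightarrow> D i \<in> borel_measurable M"
    and D0: "\<And>i \<omega>. i \<in> {1..N} \<Longrightarrow> 0 \<le> D i \<omega>"
  shows "weighted_cost M N h (\<lambda>i \<omega>. a * D i \<omega> + e) = ennreal a * weighted_cost M N h D + ennreal e"
proof -
  have "(\<integral>\<^sup>+\<omega>. ennreal (h i \<omega> * (a * D i \<omega> + e)) \<partial>M)
      = ennreal a * (\<integral>\<^sup>+\<omega>. ennreal (h i \<omega> * D i \<omega>) \<partial>M) + ennreal e" if i: "i \<in> {1..N}" for i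
  proof -
    note [measurable] = D[OF i] coupling_weightsD(1)[OF h i]
    have "(\<integral>\<^sup>+\<omega>. ennreal (h i \<omega> * (a * D i \<omega> + e)) \<partial>M)
        = (\<integral>\<^sup>+\<omega>. ennreal a * ennreal (h i \<omega> * D i \<omega>) + ennreal e * ennreal (h i \<omega>) \<partial>M)"
    proof (rule nn_integral_cong)
      fix \<omega> assume "\<omega> \<in> space M"
      then have "0 \<le> h i \<omega>" "0 \<le> D i \<omega>"
        using coupling_weightsD(2)[OF h i] D0[OF i] by auto
      then show "ennreal (h i \<omega> * (a * D i \<omega> + e)) = ennreal a * ennreal (h i \<omega> * D i \<omega>) + ennreal e * ennreal (h i \<omega>)"
        using a e by (simp add: algebra_simps flip: ennreal_mult ennreal_plus)
    qed
    also have "\<dots> = ennreal a * (\<integral>\<^sup>+\<omega>. ennreal (h i \<omega> * D i \<omega>) \<partial>M) + ennreal e"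
      using coupling_weightsD(3)[OF h i] by (simp add: nn_integral_add nn_integral_cmult)
    finally show ?thesis .
  qed
  then have "weighted_cost M N h (\<lambda>i \<omega>. a * D i \<omega> + e)
      = (\<Sum>i=1..N. ennreal a * (\<integral>\<^sup>+\<omega>. ennreal (h i \<omega> * D i \<omega>) \<partial>M) + ennreal e) / of_nat N"
    unfolding weighted_cost_def by (intro arg_cong2[where f = "(/)"] sum.cong) auto
  also have "\<dots> = (ennreal a * (\<Sum>i=1..N. \<integral>\<^sup>+\<omega>. ennreal (h i \<omega> * D i \<omega>) \<partial>M)) / of_nat N
      + (ennreal e * of_nat N) / of_nat N"
    by (simp add: sum.distrib sum_distrib_left divide_ennreal_def distrib_right mult.commute[of _ "ennreal e"])
  also have "(ennreal e * of_nat N) / of_nat N = ennreal e"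
    using N by (intro mult_divide_eq_ennreal) auto
  finally show ?thesis
    by (simp add: weighted_cost_def divide_ennreal_def mult.assoc)
qed

lemma coupling_weights_le:
  assumes "coupling_weights M N h" "i \<in> {1..N}" "\<omega> \<in> space M"
  shows "h i \<omega> \<le> real N"
  using member_le_sum[of i "{1..N}" "\<lambda>i. h i \<omega>"] coupling_weightsD(2,4)[OF assms(1)] assms by auto

text \<open>Serves only as an a priori finiteness bound for one fixed \<open>N\<close>, where the
  crude factor \<open>N\<close> from bounding the weights is harmless.\<close>

lemma weighted_cost_const_le:
  assumes N: "1 \<le> N" and h: "coupling_weights M N h" and int: "integrable M D" and D0: "\<And>\<omega>. 0 \<le> D \<omega>"
  shows "weighted_cost M N h (\<lambda>i. D) \<le> ennreal (real N * (\<integral>\<omega>. D \<omega> \<partial>M))"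
proof -
  define c where "c = ennreal (real N * (\<integral>\<omega>. D \<omega> \<partial>M))"
  have "weighted_cost M N h (\<lambda>i. D) \<le> (\<Sum>i=1..N. c) / of_nat N"
    unfolding weighted_cost_def
  proof (intro divide_right_mono_ennreal sum_mono)
    fix i assume i: "i \<in> {1..N}"
    have "(\<integral>\<^sup>+\<omega>. ennreal (h i \<omega> * D \<omega>) \<partial>M) \<le> (\<integral>\<^sup>+\<omega>. ennreal (real N * D \<omega>) \<partial>M)"
      using coupling_weights_le[OF h i] D0 by (intro nn_integral_mono ennreal_leI mult_right_mono) auto
    also have "\<dots> = c"
      unfolding c_def using int D0 by (subst nn_integral_eq_integral) auto
    finally show "(\<integral>\<^sup>+\<omega>. ennreal (h i \<omega> * D \<omega>) \<partial>M) \<le> c" .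
  qed
  also have "(\<Sum>i=1..N. c) = c * of_nat N"
    by (simp add: mult.commute)
  also have "c * of_nat N / of_nat N = c"
    using N by (intro mult_divide_eq_ennreal) auto
  finally show ?thesis
    by (simp add: c_def)
qed

lemma enn2real_wasserstein_powr_le:
  assumes "transport_cost E p \<mu> \<nu> \<le> ennreal c" "0 \<le> c" "0 < p"
  shows "enn2real (wasserstein E p \<mu> \<nu>) powr p \<le> c"
proof -
  have fin: "transport_cost E p \<mu> \<nu> \<noteq> \<infinity>"
    using assms(1) ennreal_less_top[of c] by (auto simp: top_unique)
  have "enn2real (wasserstein E p \<mu> \<nu>) powr p = enn2real (transport_cost E p \<mu> \<nu>)"
    using assms fin by (simp add: wasserstein_def powr_powr)
  also have "\<dots> \<le> c"
    using assms by (intro enn2real_leI) auto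
  finally show ?thesis .
qed

text \<open>The diagonal coupling has cost zero. This removes the measure argument when two
  realisations of the same limit equation are compared.\<close>

lemma wasserstein_self:
  assumes Y [measurable]: "Y \<in> M \<rightarrow>\<^sub>M E" and p: "0 < p"
    and dist [measurable]: "(\<lambda>z. dist (fst z) (snd z)) \<in> borel_measurable (E \<Otimes>\<^sub>M E)"
  shows "wasserstein E p (distr M E Y) (distr M E Y) = 0"
proof -
  define \<pi> where "\<pi> = distr M (E \<Otimes>\<^sub>M E) (\<lambda>\<omega>. (Y \<omega>, Y \<omega>))"
  have "\<pi> \<in> couplings E (distr M E Y) (distr M E Y)"
    unfolding couplings_def \<pi>_def by (simp add: distr_distr o_def)
  then have "transport_cost E p (distr M E Y) (distr M E Y)
      \<le> (\<integral>\<^sup>+z. ennreal (dist (fst z) (snd z) powr p) \<partial>\<pi>)"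
    unfolding transport_cost_def by (rule INF_lower)
  also have "\<dots> = 0"
    unfolding \<pi>_def by (simp add: nn_integral_distr)
  finally show ?thesis
    by (simp add: wasserstein_def)
qed

text \<open>The pathwise estimates need a Lipschitz bound that is linear rather than in
  \<open>p\<close>-th powers; superadditivity of the power permits taking the root.\<close>

lemma drift_lipschitz:
  fixes K p :: real and b :: "real \<Rightarrow> 'e::euclidean_space \<Rightarrow> 'e measure \<Rightarrow> 'a::euclidean_space"
  assumes p: "1 \<le> p"
    and b: "\<And>t x x' \<mu> \<mu>'. t \<in> {0..T} \<Longrightarrow> \<mu> \<in> Pp borel p \<Longrightarrow> \<mu>' \<in> Pp borel p \<Longrightarrow>
         norm (b t x \<mu> - b t x' \<mu>') powr p
           \<le> K * (norm (x - x') powr p + enn2real (wasserstein borel p \<mu> \<mu>') powr p)"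
  obtains L where "0 < L"
    "\<And>t x x' \<mu> \<mu>'. t \<in> {0..T} \<Longrightarrow> \<mu> \<in> Pp borel p \<Longrightarrow> \<mu>' \<in> Pp borel p \<Longrightarrow>
         norm (b t x \<mu> - b t x' \<mu>') \<le> L * (norm (x - x') + enn2real (wasserstein borel p \<mu> \<mu>'))"
proof
  \<comment> \<open>The maximum with 1 makes \<open>L\<close> positive whatever the sign of
    \<open>K\<close>.\<close>
  define L where "L = max 1 K powr (1 / p)"
  show L: "0 < L"
    by (simp add: L_def)
  fix t x x' and \<mu> \<mu>' :: "'e measure" assume *: "t \<in> {0..T}" "\<mu> \<in> Pp borel p" "\<mu>' \<in> Pp borel p"
  define w where "w = enn2real (wasserstein borel p \<mu> \<mu>')"
  have "norm (b t x \<mu> - b t x' \<mu>') powr p \<le> K * (norm (x - x') powr p + w powr p)"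
    using b[OF *] by (simp add: w_def)
  also have "\<dots> \<le> max 1 K * (norm (x - x') + w) powr p"
    using p by (intro mult_mono powr_add_ge) (auto simp: w_def)
  also have "\<dots> = (L * (norm (x - x') + w)) powr p"
    using p by (simp add: L_def powr_mult powr_powr w_def)
  finally show "norm (b t x \<mu> - b t x' \<mu>') \<le> L * (norm (x - x') + enn2real (wasserstein borel p \<mu> \<mu>'))"
    using p L by (subst (asm) powr_le_powr_iff) (auto simp: w_def)
qed

lemma integrable_powr_dominated:
  fixes f :: "'w \<Rightarrow> real"
  assumes "finite_measure M" and f: "f \<in> borel_measurable M" and q: "0 \<le> q" and C: "0 \<le> C"
    and le: "AE \<omega> in M. 0 \<le> f \<omega> \<and> f \<omega> \<le> C * (1 + u \<omega> + v \<omega> + w \<omega>)"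
    and pos: "\<And>\<omega>. 0 \<le> u \<omega>" "\<And>\<omega>. 0 \<le> v \<omega>" "\<And>\<omega>. 0 \<le> w \<omega>"
    and int: "integrable M (\<lambda>\<omega>. u \<omega> powr q)" "integrable M (\<lambda>\<omega>. v \<omega> powr q)" "integrable M (\<lambda>\<omega>. w \<omega> powr q)"
  shows "integrable M (\<lambda>\<omega>. f \<omega> powr q)"
proof (rule Bochner_Integration.integrable_bound)
  interpret finite_measure M by fact
  show "integrable M (\<lambda>\<omega>. C powr q * (4 powr q * (1 + u \<omega> powr q + v \<omega> powr q + w \<omega> powr q)))"
    using int by simp
  show "(\<lambda>\<omega>. f \<omega> powr q) \<in> borel_measurable M"
    using f by simp
  show "AE \<omega> in M. norm (f \<omega> powr q)
      \<le> norm (C powr q * (4 powr q * (1 + u \<omega> powr q + v \<omega> powr q + w \<omega> powr q)))"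
    using le
  proof eventually_elim
    case (elim \<omega>)
    have "f \<omega> powr q \<le> (C * (1 + u \<omega> + v \<omega> + w \<omega>)) powr q"
      using elim q by (intro powr_mono2) auto
    also have "\<dots> = C powr q * (1 + u \<omega> + v \<omega> + w \<omega>) powr q"
      using C pos by (simp add: powr_mult)
    also have "\<dots> \<le> C powr q * (4 powr q * (1 powr q + u \<omega> powr q + v \<omega> powr q + w \<omega> powr q))"
      using pos q by (intro mult_left_mono powr_add4_le) auto
    finally show ?case
      by simp
  qed
qed

lemma measurable_dist_pair_borel:
  "(\<lambda>z. dist (fst z) (snd z)) \<in> borel_measurable
     (borel \<Otimes>\<^sub>M (borel :: 'a::{metric_space, second_countable_topology} measure))"
  by measurable

lemma norm_Pair_diff_le: "norm ((a, b) - (c, d)) \<le> norm (a - c) + norm (b - d)"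
  using norm_Pair_le[of "a - c" "b - d"] by simp

text \<open>Comparing a generic realisation with one fixed realisation bounds the whole path, although
  only the marginal laws are assumed to have finite moments.\<close>

lemma mckean_vlasov_moment:
  fixes \<zeta> :: "'w \<Rightarrow> 'a::euclidean_space" and R :: "'w \<Rightarrow> (real \<Rightarrow>\<^sub>C 'b::euclidean_space)"
  assumes M: "prob_space M" and T: "0 < T" and p: "1 \<le> p" and L: "0 < L"
    and lip: "\<And>t x x' \<mu> \<mu>'. t \<in> {0..T} \<Longrightarrow> \<mu> \<in> Pp borel p \<Longrightarrow> \<mu>' \<in> Pp borel p \<Longrightarrow>
         norm (b t x \<mu> - b t x' \<mu>') \<le> L * (norm (x - x') + enn2real (wasserstein borel p \<mu> \<mu>'))"
    and sol: "mckean_vlasov_solution M T p b \<zeta> W R X"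
    and R: "R \<in> M \<rightarrow>\<^sub>M CT T"
    and int: "integrable M (\<lambda>\<omega>. norm (\<zeta> \<omega>) powr p)" "integrable M (\<lambda>\<omega>. norm (W \<omega>) powr p)"
      "integrable M (\<lambda>\<omega>. norm (R \<omega>) powr p)"
  shows "integrable M (\<lambda>\<omega>. norm (X \<omega>) powr p)"
proof -
  interpret prob_space M by fact
  define \<mu> where "\<mu> = (\<lambda>s. distr M borel (\<lambda>\<omega>'. (X \<omega>' s, R \<omega>' s)))"
  define good where "good \<omega> \<longleftrightarrow> integrated_eq T (\<lambda>s. b s (X \<omega> s, R \<omega> s) (\<mu> s)) (\<zeta> \<omega>) (W \<omega>) (X \<omega>)" for \<omega>
  have X: "X \<in> M \<rightarrow>\<^sub>M CT T" and \<mu>: "\<And>t. t \<in> {0..T} \<Longrightarrow> \<mu> t \<in> Pp borel p" and ae: "AE \<omega> in M. good \<omega>"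
    using sol unfolding mckean_vlasov_solution_def \<mu>_def good_def by auto
  note [measurable] = measurable_compose[OF X measurable_apply_CT] measurable_compose[OF R measurable_apply_CT]
  \<comment> \<open>All realisations see the same law \<open>\<mu> s\<close>, so their drifts differ
    only through the state and the stability estimate applies with \<open>m = 0\<close>.\<close>
  have self: "wasserstein borel p (\<mu> s) (\<mu> s) = 0" for s
    unfolding \<mu>_def using p by (intro wasserstein_self measurable_dist_pair_borel) auto
  have "\<exists>\<omega>\<in>space M. good \<omega>"
  proof (rule ccontr)
    assume *: "\<not> (\<exists>\<omega>\<in>space M. good \<omega>)"
    have "AE \<omega> in M. False"
      using ae AE_space by eventually_elim (use * in auto)
    then show False
      by simp
  qed
  then obtain \<omega>0 where \<omega>0: "good \<omega>0" "\<omega>0 \<in> space M"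
    by auto
  \<comment> \<open>The additive bound \<open>e * (S0 + S)\<close> below is relaxed to
    \<open>e * ((1 + S0) * (1 + S))\<close>; this constant then collects everything depending on the
    reference realisation \<open>\<omega>0\<close>.\<close>
  define C where "C = norm (X \<omega>0) + exp (8 * L * T) * (2 * (4 + L * T) * (1 + norm (\<zeta> \<omega>0) + norm (W \<omega>0) + norm (R \<omega>0)))"
  show ?thesis
  proof (rule integrable_powr_dominated[where C = C])
    show "(\<lambda>\<omega>. norm (X \<omega>)) \<in> borel_measurable M"
      by (rule measurable_compose[OF measurable_CT_imp_borel[OF X] borel_measurable_norm])
    show "AE \<omega> in M. 0 \<le> norm (X \<omega>) \<and> norm (X \<omega>) \<le> C * (1 + norm (\<zeta> \<omega>) + norm (W \<omega>) + norm (R \<omega>))"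
      using ae AE_space
    proof eventually_elim
      case (elim \<omega>)
      define S0 where "S0 = norm (\<zeta> \<omega>0) + norm (W \<omega>0) + norm (R \<omega>0)"
      define S where "S = norm (\<zeta> \<omega>) + norm (W \<omega>) + norm (R \<omega>)"
      define e where "e = exp (8 * L * T) * (2 * (4 + L * T))"
      have nn: "0 \<le> S0" "0 \<le> S" "0 \<le> e" "0 \<le> L * T"
        using L T by (auto simp: S0_def S_def e_def)
      have pos: "0 \<le> norm (\<zeta> \<omega>)" "0 \<le> norm (W \<omega>)" "0 \<le> norm (R \<omega>)"
        "0 \<le> norm (\<zeta> \<omega>0)" "0 \<le> norm (W \<omega>0)" "0 \<le> norm (R \<omega>0)"
        by auto
      have "dist (X \<omega>) (X \<omega>0) \<le> e * (S0 + S)"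
      proof (rule dist_paths_le)
        fix t assume t: "t \<in> {0..T}"
        have "norm (X \<omega> t - X \<omega>0 t) \<le> exp (8 * L * t) *
            (2 * (norm (\<zeta> \<omega> - \<zeta> \<omega>0) + 2 * dist (W \<omega>) (W \<omega>0) + L * T * dist (R \<omega>) (R \<omega>0)) + 0 / 4)"
        proof (rule integrated_eq_diff_bound[OF elim(1)[unfolded good_def] \<omega>0(1)[unfolded good_def] L T _ _ _ t])
          fix s assume s: "s \<in> {0..T}"
          have "norm (b s (X \<omega> s, R \<omega> s) (\<mu> s) - b s (X \<omega>0 s, R \<omega>0 s) (\<mu> s))
              \<le> L * norm ((X \<omega> s, R \<omega> s) - (X \<omega>0 s, R \<omega>0 s))"
            using lip[OF s \<mu>[OF s] \<mu>[OF s]] self by (simp del: diff_Pair)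
          also have "\<dots> \<le> L * (norm (X \<omega> s - X \<omega>0 s) + dist (R \<omega>) (R \<omega>0))"
            using L dist_bounded[of "R \<omega>" s "R \<omega>0"]
            by (intro mult_left_mono order_trans[OF norm_Pair_diff_le]) (auto simp: dist_norm)
          finally show "norm (b s (X \<omega> s, R \<omega> s) (\<mu> s) - b s (X \<omega>0 s, R \<omega>0 s) (\<mu> s))
              \<le> L * (norm (X \<omega> s - X \<omega>0 s) + dist (R \<omega>) (R \<omega>0) + 0 * exp (8 * L * s))"
            by simp
        qed auto
        also have "\<dots> \<le> exp (8 * L * T) * (2 * ((4 + L * T) * (S0 + S)))"
        proof (intro mult_mono)
          have tri: "norm (\<zeta> \<omega> - \<zeta> \<omega>0) \<le> norm (\<zeta> \<omega>) + norm (\<zeta> \<omega>0)"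
            "dist (W \<omega>) (W \<omega>0) \<le> norm (W \<omega>) + norm (W \<omega>0)"
            "dist (R \<omega>) (R \<omega>0) \<le> norm (R \<omega>) + norm (R \<omega>0)"
            by (simp_all add: dist_norm norm_triangle_ineq4)
          have "norm (\<zeta> \<omega> - \<zeta> \<omega>0) + 2 * dist (W \<omega>) (W \<omega>0) \<le> 4 * (S0 + S)"
            using tri(1,2) pos unfolding S0_def S_def distrib_left by linarith
          moreover have "L * T * dist (R \<omega>) (R \<omega>0) \<le> L * T * (S0 + S)"
            using tri(3) nn pos unfolding S0_def S_def by (intro mult_left_mono) linarith+
          ultimately have "norm (\<zeta> \<omega> - \<zeta> \<omega>0) + 2 * dist (W \<omega>) (W \<omega>0) + L * T * dist (R \<omega>) (R \<omega>0)
              \<le> 4 * (S0 + S) + L * T * (S0 + S)"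
            by (rule add_mono)
          then show "2 * (norm (\<zeta> \<omega> - \<zeta> \<omega>0) + 2 * dist (W \<omega>) (W \<omega>0) + L * T * dist (R \<omega>) (R \<omega>0)) + 0 / 4
              \<le> 2 * ((4 + L * T) * (S0 + S))"
            by (simp add: distrib_right)
        qed (use t L nn in auto)
        finally show "dist (X \<omega> t) (X \<omega>0 t) \<le> e * (S0 + S)"
          unfolding dist_norm e_def by (simp only: mult.assoc)
      qed (use T X elim \<omega>0 in \<open>auto dest: measurable_CT_space\<close>)
      moreover have "norm (X \<omega>) \<le> norm (X \<omega>0) + dist (X \<omega>) (X \<omega>0)"
        by (simp add: dist_norm norm_triangle_sub)
      ultimately have "norm (X \<omega>) \<le> norm (X \<omega>0) * 1 + e * (S0 + S)"
        by simp
      also have "\<dots> \<le> norm (X \<omega>0) * (1 + S) + e * ((1 + S0) * (1 + S))"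
        using nn by (intro add_mono mult_left_mono) (auto simp: algebra_simps)
      also have "\<dots> = C * (1 + norm (\<zeta> \<omega>) + norm (W \<omega>) + norm (R \<omega>))"
        by (simp add: C_def e_def S_def S0_def) algebra
      finally show ?case
        by simp
    qed
  qed (use p L T int in \<open>auto simp: C_def intro!: finite_measure_axioms add_nonneg_nonneg mult_nonneg_nonneg\<close>)
qed

lemma empirical_in_Pp:
  assumes "1 \<le> N"
  shows "empirical borel N y \<in> Pp (borel :: 'e::euclidean_space measure) p"
  using assms
  by (auto simp: Pp_def prob_space_empirical nn_integral_empirical ennreal_divide_eq_top_iff less_top[symmetric])

text \<open>The drift difference contains the distance of the time marginals, which is itself
  bounded by the cost of the solutions under the same weights \<open>h\<close>. In the exponentially
  weighted norm this yields \<open>m powr p \<le> B + (m / 2) powr p\<close>, hence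
  \<open>(m / 2) powr p \<le> B\<close>; the pathwise estimate then compares the whole
  paths.\<close>

lemma mean_field_stability:
  fixes \<zeta>bar :: "'w \<Rightarrow> 'a::euclidean_space" and Rbar :: "'w \<Rightarrow> (real \<Rightarrow>\<^sub>C 'b::euclidean_space)"
    and x w :: "nat \<Rightarrow> (real \<Rightarrow>\<^sub>C 'a)" and r :: "nat \<Rightarrow> (real \<Rightarrow>\<^sub>C 'b)"
  assumes M: "prob_space M" and T: "0 < T" and p: "1 \<le> p" and L: "0 < L"
    and lip: "\<And>t x x' \<mu> \<mu>'. t \<in> {0..T} \<Longrightarrow> \<mu> \<in> Pp borel p \<Longrightarrow> \<mu>' \<in> Pp borel p \<Longrightarrow>
         norm (b t x \<mu> - b t x' \<mu>') \<le> L * (norm (x - x') + enn2real (wasserstein borel p \<mu> \<mu>'))"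
    and sol: "mckean_vlasov_solution M T p b \<zeta>bar Wbar Rbar Xbar"
    and \<zeta>bar [measurable]: "\<zeta>bar \<in> borel_measurable M"
    and Wbar: "Wbar \<in> M \<rightarrow>\<^sub>M CT T" and Rbar: "Rbar \<in> M \<rightarrow>\<^sub>M CT T"
    and int: "integrable M (\<lambda>\<omega>. norm (Xbar \<omega>) powr p)" "integrable M (\<lambda>\<omega>. norm (Rbar \<omega>) powr p)"
    and N: "1 \<le> N" and h: "coupling_weights M N h"
    and eq: "\<And>i. i \<in> {1..N} \<Longrightarrow> integrated_eq T
         (\<lambda>s. b s (x i s, r i s) (empirical borel N (\<lambda>j. (x j s, r j s)))) (z i) (w i) (x i)"
    and x: "\<And>i. i \<in> {1..N} \<Longrightarrow> x i \<in> paths T" and r: "\<And>i. i \<in> {1..N} \<Longrightarrow> r i \<in> paths T"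
    and c: "0 \<le> c" and cost: "weighted_cost M N h (\<lambda>i \<omega>. norm (z i - \<zeta>bar \<omega>) powr p
        + dist (w i) (Wbar \<omega>) powr p + dist (r i) (Rbar \<omega>) powr p) \<le> ennreal c"
  shows "transport_cost (CT T) p (empirical (CT T) N (\<lambda>i. pair_path (x i) (r i)))
      (distr M (CT T) (\<lambda>\<omega>. pair_path (Xbar \<omega>) (Rbar \<omega>)))
    \<le> ennreal (exp (8 * L * T) powr p * (2 * (8 * (2 * L * T + 4)) powr p) * c)"
proof -
  interpret prob_space M by fact
  define \<mu> where "\<mu> = (\<lambda>s. distr M borel (\<lambda>\<omega>. (Xbar \<omega> s, Rbar \<omega> s)))"
  define \<mu>N where "\<mu>N = (\<lambda>s. empirical borel N (\<lambda>j. (x j s, r j s)))"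
  define d where "d = (\<lambda>s. enn2real (wasserstein borel p (\<mu>N s) (\<mu> s)))"
  define good where "good \<omega> \<longleftrightarrow> integrated_eq T (\<lambda>s. b s (Xbar \<omega> s, Rbar \<omega> s) (\<mu> s)) (\<zeta>bar \<omega>) (Wbar \<omega>) (Xbar \<omega>)" for \<omega>
  have Xbar: "Xbar \<in> M \<rightarrow>\<^sub>M CT T" and \<mu>: "\<And>t. t \<in> {0..T} \<Longrightarrow> \<mu> t \<in> Pp borel p" and ae: "AE \<omega> in M. good \<omega>"
    using sol unfolding mckean_vlasov_solution_def \<mu>_def good_def by auto
  have \<mu>N: "\<mu>N t \<in> Pp borel p" for t
    unfolding \<mu>N_def by (rule empirical_in_Pp) fact
  have eval [measurable]: "(\<lambda>\<omega>. Xbar \<omega> t) \<in> borel_measurable M" "(\<lambda>\<omega>. Wbar \<omega> t) \<in> borel_measurable M"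
    "(\<lambda>\<omega>. Rbar \<omega> t) \<in> borel_measurable M" for t
    using Xbar Wbar Rbar by (auto intro: measurable_compose[OF _ measurable_apply_CT])
  have [measurable]: "(\<lambda>\<omega>. dist (w i) (Wbar \<omega>)) \<in> borel_measurable M"
    "(\<lambda>\<omega>. dist (r i) (Rbar \<omega>)) \<in> borel_measurable M" for i
    by (rule borel_measurable_dist_bcontfun; simp)+
  have [measurable]: "(\<lambda>\<omega>. pair_path (Xbar \<omega>) (Rbar \<omega>)) \<in> M \<rightarrow>\<^sub>M CT T"
    by (rule measurable_pair_path[OF T Xbar Rbar])
  have eqN: "integrated_eq T (\<lambda>s. b s (x i s, r i s) (\<mu>N s)) (z i) (w i) (x i)" if "i \<in> {1..N}" for i
    unfolding \<mu>N_def using eq[OF that] .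
  \<comment> \<open>The coefficients to dominate are 2 for the initial values, 4 for the driving
    paths and \<open>2 * L * T + 1\<close> for the paths \<open>r\<close>, where the 1 comes from
    adding the distance of the second components.\<close>
  define \<kappa> where "\<kappa> = 2 * L * T + 4"
  have \<kappa>: "0 \<le> \<kappa>" and LT: "0 \<le> L * T"
    using L T by (auto simp: \<kappa>_def)
  define S where "S = (\<lambda>i \<omega>. norm (z i - \<zeta>bar \<omega>) + dist (w i) (Wbar \<omega>) + dist (r i) (Rbar \<omega>))"
  have S0: "0 \<le> S i \<omega>" for i \<omega>
    by (simp add: S_def)
  have [measurable]: "S i \<in> borel_measurable M" for i
    unfolding S_def by measurable

  have diff: "norm (x i t - Xbar \<omega> t) + dist (r i) (Rbar \<omega>) \<le> exp (8 * L * t) * (\<kappa> * S i \<omega> + m / 4)"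
    if m: "0 \<le> m" "\<And>s. s \<in> {0..T} \<Longrightarrow> d s \<le> m * exp (8 * L * s)"
      and i: "i \<in> {1..N}" and g: "good \<omega>" and t: "t \<in> {0..T}" for m i \<omega> t
  proof -
    have "norm (x i t - Xbar \<omega> t) \<le> exp (8 * L * t) *
        (2 * (norm (z i - \<zeta>bar \<omega>) + 2 * dist (w i) (Wbar \<omega>) + L * T * dist (r i) (Rbar \<omega>)) + m / 4)"
    proof (rule integrated_eq_diff_bound[OF eqN[OF i] g[unfolded good_def] L T _ _ _ t])
      fix s assume s: "s \<in> {0..T}"
      have "norm (b s (x i s, r i s) (\<mu>N s) - b s (Xbar \<omega> s, Rbar \<omega> s) (\<mu> s))
          \<le> L * (norm ((x i s, r i s) - (Xbar \<omega> s, Rbar \<omega> s)) + d s)"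
        unfolding d_def by (rule lip[OF s \<mu>N \<mu>[OF s]])
      also have "\<dots> \<le> L * (norm (x i s - Xbar \<omega> s) + dist (r i) (Rbar \<omega>) + m * exp (8 * L * s))"
        using L dist_bounded[of "r i" s "Rbar \<omega>"] m(2)[OF s]
        by (intro mult_left_mono add_mono order_trans[OF norm_Pair_diff_le]) (auto simp: dist_norm)
      finally show "norm (b s (x i s, r i s) (\<mu>N s) - b s (Xbar \<omega> s, Rbar \<omega> s) (\<mu> s))
          \<le> L * (norm (x i s - Xbar \<omega> s) + dist (r i) (Rbar \<omega>) + m * exp (8 * L * s))" .
    qed (use m in auto)
    moreover have "1 * dist (r i) (Rbar \<omega>) \<le> exp (8 * L * t) * dist (r i) (Rbar \<omega>)"
      using t L by (intro mult_right_mono) auto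
    ultimately have "norm (x i t - Xbar \<omega> t) + dist (r i) (Rbar \<omega>) \<le> exp (8 * L * t) *
        (2 * (norm (z i - \<zeta>bar \<omega>) + 2 * dist (w i) (Wbar \<omega>) + L * T * dist (r i) (Rbar \<omega>)) + m / 4
          + dist (r i) (Rbar \<omega>))"
      by (simp add: distrib_left)
    also have "\<dots> \<le> exp (8 * L * t) * (\<kappa> * S i \<omega> + m / 4)"
    proof (intro mult_left_mono)
      have "0 \<le> L * T * norm (z i - \<zeta>bar \<omega>)" "0 \<le> L * T * dist (w i) (Wbar \<omega>)"
        using LT by auto
      moreover have "\<kappa> * S i \<omega> = 2 * (L * T * norm (z i - \<zeta>bar \<omega>)) + 2 * (L * T * dist (w i) (Wbar \<omega>))
          + 2 * (L * T * dist (r i) (Rbar \<omega>)) + 4 * norm (z i - \<zeta>bar \<omega>) + 4 * dist (w i) (Wbar \<omega>)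
          + 4 * dist (r i) (Rbar \<omega>)"
        by (simp add: \<kappa>_def S_def algebra_simps)
      moreover have "2 * (a + 2 * b + c) + m / 4 + e \<le> 2 * u + 2 * v + 2 * c + 4 * a + 4 * b + 4 * e + m / 4"
        if "0 \<le> a" "0 \<le> e" "0 \<le> u" "0 \<le> v" for a b c e u v :: real
        using that by simp
      ultimately show "2 * (norm (z i - \<zeta>bar \<omega>) + 2 * dist (w i) (Wbar \<omega>) + L * T * dist (r i) (Rbar \<omega>)) + m / 4
          + dist (r i) (Rbar \<omega>) \<le> \<kappa> * S i \<omega> + m / 4"
        by simp
    qed auto
    finally show ?thesis .
  qed

  \<comment> \<open>The 8 is \<open>2 * 4\<close>: the splittings of the \<open>p\<close>-th power
    of \<open>\<kappa> * S + m / 4\<close> and of the three terms of \<open>S\<close> cost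
    \<open>2 powr p\<close> and \<open>4 powr p\<close>.\<close>
  define B where "B = (8 * \<kappa>) powr p * c"
  have B: "0 \<le> B"
    using c by (simp add: B_def)
  \<comment> \<open>Stated for any dominated cost \<open>D\<close>, as it is applied to the
    marginals at each time \<open>t\<close> and, with \<open>t = T\<close>, to the whole paths. The
    splitting turns \<open>m / 4\<close> into \<open>m / 2\<close>.\<close>
  have cost_S: "weighted_cost M N h D \<le> ennreal (exp (8 * L * t) powr p * (B + (m / 2) powr p))"
    if m: "0 \<le> m" and D: "\<And>i. i \<in> {1..N} \<Longrightarrow>
      AE \<omega> in M. D i \<omega> \<le> (exp (8 * L * t) * (\<kappa> * S i \<omega> + m / 4)) powr p" for m t D
  proof -
    define e where "e = exp (8 * L * t) powr p"
    define D0 where "D0 = (\<lambda>i \<omega>. norm (z i - \<zeta>bar \<omega>) powr p + dist (w i) (Wbar \<omega>) powr p + dist (r i) (Rbar \<omega>) powr p)"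
    have [measurable]: "D0 i \<in> borel_measurable M" for i
      unfolding D0_def by measurable
    have "(exp (8 * L * t) * (\<kappa> * S i \<omega> + m / 4)) powr p
        \<le> e * (8 * \<kappa>) powr p * D0 i \<omega> + e * (m / 2) powr p" for i \<omega>
    proof -
      have "(\<kappa> * S i \<omega> + m / 4) powr p \<le> 2 powr p * ((\<kappa> * S i \<omega>) powr p + (m / 4) powr p)"
        using \<kappa> S0 m p by (intro powr_add_le) auto
      also have "\<dots> = 2 powr p * (\<kappa> powr p * S i \<omega> powr p) + (m / 2) powr p"
        using powr_mult[of \<kappa> "S i \<omega>" p] powr_mult[of 2 "m / 4" p] \<kappa> S0 m
        by (simp only: distrib_left) simp
      also have "\<dots> \<le> 2 powr p * (\<kappa> powr p * (4 powr p * D0 i \<omega>)) + (m / 2) powr p"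
        using powr_add4_le[of "norm (z i - \<zeta>bar \<omega>)" "dist (w i) (Wbar \<omega>)" "dist (r i) (Rbar \<omega>)" 0 p] p
        by (intro add_right_mono mult_left_mono) (auto simp: S_def D0_def)
      also have "2 powr p * (\<kappa> powr p * (4 powr p * D0 i \<omega>)) = (8 * \<kappa>) powr p * D0 i \<omega>"
      proof -
        have "(8 * \<kappa>) powr p = (2 * 4 * \<kappa>) powr p"
          by simp
        also have "\<dots> = 2 powr p * 4 powr p * \<kappa> powr p"
          using \<kappa> by (simp only: powr_mult)
        finally show ?thesis
          by simp
      qed
      finally have "(\<kappa> * S i \<omega> + m / 4) powr p \<le> (8 * \<kappa>) powr p * D0 i \<omega> + (m / 2) powr p"
        by simp
      then have "e * (\<kappa> * S i \<omega> + m / 4) powr p \<le> e * ((8 * \<kappa>) powr p * D0 i \<omega> + (m / 2) powr p)"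
        by (intro mult_left_mono) (auto simp: e_def)
      moreover have "(exp (8 * L * t) * (\<kappa> * S i \<omega> + m / 4)) powr p = e * (\<kappa> * S i \<omega> + m / 4) powr p"
        unfolding e_def by (rule powr_mult)
      ultimately show ?thesis
        by (simp only: distrib_left[of e] mult.assoc[of e])
    qed
    note pw = this
    have "weighted_cost M N h D \<le> weighted_cost M N h (\<lambda>i \<omega>. e * (8 * \<kappa>) powr p * D0 i \<omega> + e * (m / 2) powr p)"
      by (intro weighted_cost_mono[OF h] AE_mp[OF D AE_I2] impI) (assumption, erule order_trans[OF _ pw])
    also have "\<dots> = ennreal (e * (8 * \<kappa>) powr p) * weighted_cost M N h D0 + ennreal (e * (m / 2) powr p)"
      by (rule weighted_cost_affine[OF N h]) (auto simp: e_def D0_def)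
    also have "\<dots> \<le> ennreal (e * (8 * \<kappa>) powr p) * ennreal c + ennreal (e * (m / 2) powr p)"
      using cost unfolding D0_def by (intro add_right_mono mult_left_mono) auto
    also have "\<dots> = ennreal (e * (B + (m / 2) powr p))"
      using c by (simp add: B_def e_def distrib_left mult.assoc flip: ennreal_mult ennreal_plus)
    finally show ?thesis
      by (simp add: e_def)
  qed

  have d_le: "d t powr p \<le> a"
    if "0 \<le> a" "weighted_cost M N h (\<lambda>i \<omega>. (norm (x i t - Xbar \<omega> t) + dist (r i) (Rbar \<omega>)) powr p) \<le> ennreal a" for a t
  proof -
    have "transport_cost borel p (\<mu>N t) (\<mu> t)
        \<le> weighted_cost M N h (\<lambda>i \<omega>. dist (x i t, r i t) (Xbar \<omega> t, Rbar \<omega> t) powr p)"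
      unfolding \<mu>N_def \<mu>_def
      by (rule transport_cost_le_weighted_cost[OF M N h]) (auto intro: measurable_dist_pair_borel)
    also have "\<dots> \<le> weighted_cost M N h (\<lambda>i \<omega>. (norm (x i t - Xbar \<omega> t) + dist (r i) (Rbar \<omega>)) powr p)"
    proof (intro weighted_cost_mono[OF h] AE_I2 powr_mono2)
      fix i \<omega>
      show "dist (x i t, r i t) (Xbar \<omega> t, Rbar \<omega> t) \<le> norm (x i t - Xbar \<omega> t) + dist (r i) (Rbar \<omega>)"
        using dist_bounded[of "r i" t "Rbar \<omega>"] norm_Pair_diff_le[of "x i t" "r i t" "Xbar \<omega> t" "Rbar \<omega> t"]
        by (simp add: dist_norm del: diff_Pair)
    qed (use p in auto)
    also have "\<dots> \<le> ennreal a"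
      by fact
    finally show ?thesis
      unfolding d_def using that p by (intro enn2real_wasserstein_powr_le) auto
  qed

  \<comment> \<open>A crude bound uniform in time. It makes the supremum \<open>m\<close> below a
    genuine finite supremum, without which the absorption would be void.\<close>
  obtain m0 where m0: "\<And>t. d t \<le> m0"
  proof -
    define Q where "Q = (\<Sum>i=1..N. norm (x i) + norm (r i))"
    define D where "D = (\<lambda>\<omega>. (Q + norm (Xbar \<omega>) + norm (Rbar \<omega>)) powr p)"
    have Q: "0 \<le> Q" "\<And>i. i \<in> {1..N} \<Longrightarrow> norm (x i) + norm (r i) \<le> Q"
      unfolding Q_def by (auto intro!: sum_nonneg member_le_sum)
    have "integrable M D"
      unfolding D_def
    proof (rule integrable_powr_dominated[where C = "1 + Q" and w = "\<lambda>_. 0"])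
      show "AE \<omega> in M. 0 \<le> Q + norm (Xbar \<omega>) + norm (Rbar \<omega>) \<and>
          Q + norm (Xbar \<omega>) + norm (Rbar \<omega>) \<le> (1 + Q) * (1 + norm (Xbar \<omega>) + norm (Rbar \<omega>) + 0)"
        using Q(1) by (auto simp: algebra_simps intro!: add_nonneg_nonneg mult_nonneg_nonneg)
      show "(\<lambda>\<omega>. Q + norm (Xbar \<omega>) + norm (Rbar \<omega>)) \<in> borel_measurable M"
        using measurable_compose[OF measurable_CT_imp_borel[OF Xbar] borel_measurable_norm]
          measurable_compose[OF measurable_CT_imp_borel[OF Rbar] borel_measurable_norm]
        by (intro borel_measurable_add borel_measurable_const)
    qed (use int p Q in \<open>auto intro: finite_measure_axioms\<close>)
    then have bound: "weighted_cost M N h (\<lambda>_. D) \<le> ennreal (real N * (\<integral>\<omega>. D \<omega> \<partial>M))"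
      by (rule weighted_cost_const_le[OF N h]) (simp add: D_def)
    have "d t powr p \<le> real N * (\<integral>\<omega>. D \<omega> \<partial>M)" for t
    proof (rule d_le)
      have "weighted_cost M N h (\<lambda>i \<omega>. (norm (x i t - Xbar \<omega> t) + dist (r i) (Rbar \<omega>)) powr p)
          \<le> weighted_cost M N h (\<lambda>_. D)"
        unfolding D_def
      proof (intro weighted_cost_mono[OF h] AE_I2 powr_mono2)
        fix i \<omega> assume i: "i \<in> {1..N}"
        have "norm (x i t - Xbar \<omega> t) + dist (r i) (Rbar \<omega>) \<le> dist (x i) (Xbar \<omega>) + dist (r i) (Rbar \<omega>)"
          using dist_bounded[of "x i" t "Xbar \<omega>"] by (simp add: dist_norm)
        also have "\<dots> \<le> (norm (x i) + norm (Xbar \<omega>)) + (norm (r i) + norm (Rbar \<omega>))"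
          unfolding dist_norm by (intro add_mono norm_triangle_ineq4)
        also have "\<dots> \<le> Q + norm (Xbar \<omega>) + norm (Rbar \<omega>)"
          using Q(2)[OF i] by simp
        finally show "norm (x i t - Xbar \<omega> t) + dist (r i) (Rbar \<omega>) \<le> Q + norm (Xbar \<omega>) + norm (Rbar \<omega>)" .
      qed (use p in auto)
      with bound show "weighted_cost M N h (\<lambda>i \<omega>. (norm (x i t - Xbar \<omega> t) + dist (r i) (Rbar \<omega>)) powr p)
          \<le> ennreal (real N * (\<integral>\<omega>. D \<omega> \<partial>M))"
        by (rule order_trans[rotated])
    qed (auto simp: D_def intro!: mult_nonneg_nonneg Bochner_Integration.integral_nonneg)
    then have "d t powr p \<le> ((real N * (\<integral>\<omega>. D \<omega> \<partial>M)) powr (1 / p)) powr p" for t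
      using p by (simp add: powr_powr) (meson abs_ge_self order_trans)
    then have "d t \<le> (real N * (\<integral>\<omega>. D \<omega> \<partial>M)) powr (1 / p)" for t
      using p by (subst (asm) powr_le_powr_iff) (auto simp: d_def)
    then show ?thesis
      by (rule that)
  qed

  \<comment> \<open>The weight is that of the pathwise estimate, so that
    \<open>d s \<le> m * exp (8 * L * s)\<close> is exactly the form allowed in its Lipschitz
    bound.\<close>
  define m where "m = (SUP s\<in>{0..T}. exp (- (8 * L * s)) * d s)"
  have d0: "0 \<le> d s" for s
    by (simp add: d_def)
  have m0': "0 \<le> m0"
    using d0[of 0] m0[of 0] by linarith
  have "exp (- (8 * L * s)) * d s \<le> 1 * m0" if "s \<in> {0..T}" for s
    using that L m0 m0' d0 by (intro mult_mono) auto
  then have bdd: "bdd_above ((\<lambda>s. exp (- (8 * L * s)) * d s) ` {0..T})"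
    by (intro bdd_aboveI2[where M = "1 * m0"])
  have m_ge: "exp (- (8 * L * s)) * d s \<le> m" if "s \<in> {0..T}" for s
    unfolding m_def using bdd that by (rule cSUP_upper2) simp
  have m: "0 \<le> m"
    using m_ge[of 0] T d0[of 0] by simp
  have d_m: "d s \<le> m * exp (8 * L * s)" if "s \<in> {0..T}" for s
    using m_ge[OF that] by (simp add: exp_minus field_simps)

  have "exp (- (8 * L * t)) * d t \<le> (B + (m / 2) powr p) powr (1 / p)" if t: "t \<in> {0..T}" for t
  proof -
    have "d t powr p \<le> exp (8 * L * t) powr p * (B + (m / 2) powr p)"
    proof (rule d_le)
      show "weighted_cost M N h (\<lambda>i \<omega>. (norm (x i t - Xbar \<omega> t) + dist (r i) (Rbar \<omega>)) powr p)
          \<le> ennreal (exp (8 * L * t) powr p * (B + (m / 2) powr p))"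
      proof (rule cost_S[OF m])
        fix i assume i: "i \<in> {1..N}"
        show "AE \<omega> in M. (norm (x i t - Xbar \<omega> t) + dist (r i) (Rbar \<omega>)) powr p
            \<le> (exp (8 * L * t) * (\<kappa> * S i \<omega> + m / 4)) powr p"
          using ae by eventually_elim (use p diff[OF m d_m i _ t] in \<open>auto intro!: powr_mono2\<close>)
      qed
    qed (use B in simp)
    also have "\<dots> = (exp (8 * L * t) * (B + (m / 2) powr p) powr (1 / p)) powr p"
      using p B by (simp add: powr_mult powr_powr)
    finally have "d t \<le> exp (8 * L * t) * (B + (m / 2) powr p) powr (1 / p)"
      using p d0 by (subst (asm) powr_le_powr_iff) auto
    then show ?thesis
      by (simp add: exp_minus field_simps)
  qed
  then have "m \<le> (B + (m / 2) powr p) powr (1 / p)"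
    unfolding m_def[symmetric] using T by (subst (1) m_def) (intro cSUP_least, auto)
  then have "m powr p \<le> ((B + (m / 2) powr p) powr (1 / p)) powr p"
    using m p by (intro powr_mono2) auto
  also have "\<dots> = B + (m / 2) powr p"
    using p B by (simp add: powr_powr)
  finally have "m powr p \<le> B + (m / 2) powr p" .
  \<comment> \<open>Here \<open>p \<ge> 1\<close> enters: half of \<open>m powr p\<close> already
    dominates \<open>(m / 2) powr p\<close>, so that term can be subtracted from both sides.\<close>
  moreover have "(m / 2) powr p + (m / 2) powr p \<le> m powr p"
    using powr_add_ge[of "m / 2" "m / 2" p] m p by simp
  ultimately have mB: "(m / 2) powr p \<le> B"
    by simp

  have "transport_cost (CT T) p (empirical (CT T) N (\<lambda>i. pair_path (x i) (r i)))
      (distr M (CT T) (\<lambda>\<omega>. pair_path (Xbar \<omega>) (Rbar \<omega>)))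
      \<le> weighted_cost M N h (\<lambda>i \<omega>. dist (pair_path (x i) (r i)) (pair_path (Xbar \<omega>) (Rbar \<omega>)) powr p)"
    by (rule transport_cost_le_weighted_cost[OF M N h])
      (auto intro: measurable_dist_CT intro!: pair_path_in_paths x r)
  also have "\<dots> \<le> ennreal (exp (8 * L * T) powr p * (B + (m / 2) powr p))"
  proof (rule cost_S[OF m])
    fix i assume i: "i \<in> {1..N}"
    show "AE \<omega> in M. dist (pair_path (x i) (r i)) (pair_path (Xbar \<omega>) (Rbar \<omega>)) powr p
            \<le> (exp (8 * L * T) * (\<kappa> * S i \<omega> + m / 4)) powr p"
      using ae AE_space
    proof eventually_elim
      case (elim \<omega>)
      have "dist (pair_path (x i) (r i)) (pair_path (Xbar \<omega>) (Rbar \<omega>)) \<le> exp (8 * L * T) * (\<kappa> * S i \<omega> + m / 4)"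
      proof (rule dist_paths_le[where T = T])
        fix t assume t: "t \<in> {0..T}"
        have "dist (pair_path (x i) (r i) t) (pair_path (Xbar \<omega>) (Rbar \<omega>) t)
            \<le> norm (x i t - Xbar \<omega> t) + dist (r i) (Rbar \<omega>)"
          using dist_bounded[of "r i" t "Rbar \<omega>"] norm_Pair_diff_le[of "x i t" "r i t" "Xbar \<omega> t" "Rbar \<omega> t"]
          by (simp add: dist_norm del: diff_Pair)
        also have "\<dots> \<le> exp (8 * L * t) * (\<kappa> * S i \<omega> + m / 4)"
          by (rule diff[OF m d_m i elim(1) t])
        also have "\<dots> \<le> exp (8 * L * T) * (\<kappa> * S i \<omega> + m / 4)"
          using t L \<kappa> S0 m by (intro mult_right_mono) auto
        finally show "dist (pair_path (x i) (r i) t) (pair_path (Xbar \<omega>) (Rbar \<omega>) t)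
            \<le> exp (8 * L * T) * (\<kappa> * S i \<omega> + m / 4)" .
      qed (use T x[OF i] r[OF i] Xbar Rbar elim in \<open>auto intro!: pair_path_in_paths dest: measurable_CT_space\<close>)
      then show ?case
        using p by (intro powr_mono2) auto
    qed
  qed
  also have "\<dots> \<le> ennreal (exp (8 * L * T) powr p * (B + B))"
    using mB by (intro ennreal_leI mult_left_mono) auto
  also have "exp (8 * L * T) powr p * (B + B) = exp (8 * L * T) powr p * (2 * (8 * (2 * L * T + 4)) powr p) * c"
    by (simp add: B_def \<kappa>_def)
  finally show ?thesis .
qed


section \<open>Couplings from fine partitions\<close>

text \<open>The mass \<open>1 - \<delta>\<close> of each cell is transported within the cell, the rest by the product
  coupling.\<close>

lemma coupling_from_cells:
  fixes f :: "'c \<Rightarrow> nat \<Rightarrow> real" and g :: "'c \<Rightarrow> 'w \<Rightarrow> real"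
  assumes M: "prob_space M" and N: "1 \<le> N" and I: "finite I" and \<delta>: "0 < \<delta>" "\<delta> < 1"
    and f0: "\<And>c i. 0 \<le> f c i" and f1: "\<And>i. (\<Sum>c\<in>I. f c i) \<le> 1"
    and g [measurable]: "\<And>c. g c \<in> borel_measurable M"
    and g0: "\<And>c \<omega>. 0 \<le> g c \<omega>" and g1: "\<And>\<omega>. (\<Sum>c\<in>I. g c \<omega>) \<le> 1"
    and mass: "\<And>c. c \<in> I \<Longrightarrow> 0 < (\<integral>\<omega>. g c \<omega> \<partial>M)"
      "\<And>c. c \<in> I \<Longrightarrow> (1 - \<delta>) * (\<integral>\<omega>. g c \<omega> \<partial>M) \<le> (\<Sum>i=1..N. f c i) / real N"
    and e: "0 \<le> e" and D_cell: "\<And>c i \<omega>. c \<in> I \<Longrightarrow> i \<in> {1..N} \<Longrightarrow> 0 < f c i \<Longrightarrow> 0 < g c \<omega> \<Longrightarrow> D i \<omega> \<le> e"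
    and A: "0 \<le> A" "0 \<le> \<theta>" and UV: "\<And>i. 0 \<le> U i" "\<And>\<omega>. 0 \<le> V \<omega>" "integrable M V"
    and D_le: "\<And>i \<omega>. i \<in> {1..N} \<Longrightarrow> D i \<omega> \<le> A + \<theta> * (U i + V \<omega>)"
    and \<tau>0: "1 - (1 - \<delta>) * (\<Sum>c\<in>I. \<integral>\<omega>. g c \<omega> \<partial>M) \<le> \<tau>0"
  obtains h where "coupling_weights M N h"
    "weighted_cost M N h D \<le> ennreal (e + \<tau>0 * A + \<theta> * ((\<Sum>i=1..N. U i) / real N + (\<integral>\<omega>. V \<omega> \<partial>M)))"
proof -
  interpret prob_space M by fact
  define m where "m c = (\<integral>\<omega>. g c \<omega> \<partial>M)" for c
  define mN where "mN c = (\<Sum>i=1..N. f c i) / real N" for c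
  have mN: "0 < mN c" "(1 - \<delta>) * m c \<le> mN c" if "c \<in> I" for c
  proof -
    show *: "(1 - \<delta>) * m c \<le> mN c"
      using mass(2)[OF that] by (simp add: m_def mN_def)
    have "0 < (1 - \<delta>) * m c"
      using mass(1)[OF that] \<delta> by (simp add: m_def)
    with * show "0 < mN c"
      by linarith
  qed
  \<comment> \<open>\<open>diag\<close> joins points to \<Omega> within cells. \<open>F\<close> and
    \<open>G\<close> are the masses it leaves over at the points and on \<Omega>; the average of
    \<open>F\<close> and the mean of \<open>G\<close> are both \<open>\<tau>\<close>, so
    \<open>F i * G \<omega> / \<tau>\<close> is the product coupling of the leftovers.\<close>
  define F where "F i = 1 - (1 - \<delta>) * (\<Sum>c\<in>I. f c i * m c / mN c)" for i
  define G where "G \<omega> = 1 - (1 - \<delta>) * (\<Sum>c\<in>I. g c \<omega>)" for \<omega>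
  define \<tau> where "\<tau> = 1 - (1 - \<delta>) * (\<Sum>c\<in>I. m c)"
  define diag where "diag i \<omega> = (1 - \<delta>) * (\<Sum>c\<in>I. f c i * g c \<omega> / mN c)" for i \<omega>
  define h where "h i \<omega> = diag i \<omega> + F i * G \<omega> / \<tau>" for i \<omega>
  have [measurable]: "G \<in> borel_measurable M" "diag i \<in> borel_measurable M" "h i \<in> borel_measurable M" for i
    unfolding G_def diag_def h_def[abs_def] by measurable
  have g_int: "integrable M (g c)" if "c \<in> I" for c
  proof (rule integrable_const_bound[where B = 1])
    have "g c \<omega> \<le> 1" for \<omega>
      using member_le_sum[OF that _ I, of "\<lambda>c. g c \<omega>"] g0 g1[of \<omega>] by auto
    then show "AE \<omega> in M. norm (g c \<omega>) \<le> 1"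
      using g0 by simp
  qed simp
  \<comment> \<open>Withholding the share \<open>\<delta>\<close> has two effects:
    \<open>\<tau>\<close> stays positive even if the cells carry all mass, and \<open>F\<close>
    stays nonnegative although the empirical mass of a cell may fall slightly below its
    limit.\<close>
  have G: "\<delta> \<le> G \<omega>" "G \<omega> \<le> 1" for \<omega>
  proof -
    have "(1 - \<delta>) * (\<Sum>c\<in>I. g c \<omega>) \<le> (1 - \<delta>) * 1"
      using \<delta> g1 by (intro mult_left_mono) auto
    then show "\<delta> \<le> G \<omega>"
      by (simp add: G_def)
    show "G \<omega> \<le> 1"
      using \<delta> g0 by (simp add: G_def sum_nonneg)
  qed
  have G0: "0 \<le> G \<omega>" for \<omega>
    using G(1)[of \<omega>] \<delta> by linarith
  have G_int: "integrable M G"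
    using G G0 by (intro integrable_const_bound[where B = 1]) (auto simp: abs_of_nonneg)
  have EG: "(\<integral>\<omega>. G \<omega> \<partial>M) = \<tau>"
    unfolding G_def \<tau>_def m_def using g_int by (simp add: prob_space)
  have "(\<integral>\<omega>. \<delta> \<partial>M) \<le> (\<integral>\<omega>. G \<omega> \<partial>M)"
    using G_int G by (intro integral_mono) auto
  then have \<tau>: "0 < \<tau>" "\<tau> \<le> \<tau>0"
    using EG \<delta> \<tau>0 by (auto simp: prob_space \<tau>_def m_def)
  have F: "0 \<le> F i" "F i \<le> 1" for i
  proof -
    have "(1 - \<delta>) * (\<Sum>c\<in>I. f c i * m c / mN c) = (\<Sum>c\<in>I. f c i * ((1 - \<delta>) * m c / mN c))"
      by (simp add: sum_distrib_left mult_ac)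
    also have "\<dots> \<le> (\<Sum>c\<in>I. f c i * 1)"
      using mN f0 by (intro sum_mono mult_left_mono) auto
    also have "\<dots> \<le> 1"
      using f1 by simp
    finally show "0 \<le> F i"
      by (simp add: F_def)
    have "0 \<le> (\<Sum>c\<in>I. f c i * m c / mN c)"
      using mN f0 mass by (intro sum_nonneg divide_nonneg_nonneg mult_nonneg_nonneg) (auto simp: m_def less_imp_le)
    then show "F i \<le> 1"
      using \<delta> by (simp add: F_def)
  qed
  have sum_f: "(\<Sum>i=1..N. f c i) = real N * mN c" for c
    using N by (simp add: mN_def)
  have sumF: "(\<Sum>i=1..N. F i) = real N * \<tau>"
  proof -
    have "(\<Sum>i=1..N. \<Sum>c\<in>I. f c i * m c / mN c) = (\<Sum>c\<in>I. (\<Sum>i=1..N. f c i) * m c / mN c)"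
      by (subst sum.swap) (simp add: sum_distrib_right sum_divide_distrib)
    also have "\<dots> = real N * (\<Sum>c\<in>I. m c)"
      unfolding sum_f sum_distrib_left using mN(1) by (intro sum.cong) (auto simp: less_imp_neq[symmetric])
    finally show ?thesis
      unfolding F_def sum_subtractf \<tau>_def sum_distrib_left[symmetric] by (simp add: algebra_simps)
  qed
  have diag0: "0 \<le> diag i \<omega>" for i \<omega>
    unfolding diag_def using \<delta> f0 g0 mN(1)
    by (intro mult_nonneg_nonneg sum_nonneg divide_nonneg_nonneg) (auto simp: less_imp_le)
  have diag_int: "integrable M (diag i)" for i
    unfolding diag_def using g_int by auto
  have Ediag: "(\<integral>\<omega>. diag i \<omega> \<partial>M) = 1 - F i" for i
    unfolding diag_def F_def m_def using g_int by simp
  have h: "coupling_weights M N h"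
    unfolding coupling_weights_def
  proof (intro conjI ballI)
    fix i \<omega> assume "i \<in> {1..N}"
    show "h i \<in> borel_measurable M"
      by simp
    show h0: "0 \<le> h i \<omega>" for \<omega>
      using diag0 F G0 \<tau> by (simp add: h_def)
    have "(\<integral>\<^sup>+\<omega>. ennreal (h i \<omega>) \<partial>M) = ennreal (\<integral>\<omega>. h i \<omega> \<partial>M)"
      using h0 diag_int G_int by (intro nn_integral_eq_integral) (auto simp: h_def)
    also have "(\<integral>\<omega>. h i \<omega> \<partial>M) = 1"
      using diag_int G_int \<tau> by (simp add: h_def Ediag EG)
    finally show "(\<integral>\<^sup>+\<omega>. ennreal (h i \<omega>) \<partial>M) = 1"
      by simp
  next
    fix \<omega>
    have "(\<Sum>i=1..N. \<Sum>c\<in>I. f c i * g c \<omega> / mN c) = (\<Sum>c\<in>I. (\<Sum>i=1..N. f c i) * g c \<omega> / mN c)"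
      by (subst sum.swap) (simp add: sum_distrib_right sum_divide_distrib)
    also have "\<dots> = real N * (\<Sum>c\<in>I. g c \<omega>)"
      unfolding sum_f sum_distrib_left using mN(1) by (intro sum.cong) (auto simp: less_imp_neq[symmetric])
    finally have "(\<Sum>i=1..N. diag i \<omega>) = (1 - \<delta>) * (real N * (\<Sum>c\<in>I. g c \<omega>))"
      by (simp add: diag_def flip: sum_distrib_left)
    moreover have "(\<Sum>i=1..N. F i * G \<omega> / \<tau>) = real N * G \<omega>"
      using sumF \<tau> by (simp flip: sum_distrib_right sum_divide_distrib)
    ultimately show "(\<Sum>i=1..N. h i \<omega>) = real N"
      by (simp add: h_def sum.distrib G_def algebra_simps)
  qed
  have bound: "h i \<omega> * D i \<omega> \<le> diag i \<omega> * e + F i * A / \<tau> * G \<omega> + F i * \<theta> * U i / \<tau> * G \<omega> + F i * \<theta> / \<tau> * V \<omega>"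
    if i: "i \<in> {1..N}" for i \<omega>
  proof -
    have "diag i \<omega> * D i \<omega> = (1 - \<delta>) * (\<Sum>c\<in>I. f c i * g c \<omega> / mN c * D i \<omega>)"
      by (simp add: diag_def sum_distrib_right)
    also have "\<dots> \<le> (1 - \<delta>) * (\<Sum>c\<in>I. f c i * g c \<omega> / mN c * e)"
    proof (rule mult_left_mono[OF sum_mono])
      fix c assume c: "c \<in> I"
      show "f c i * g c \<omega> / mN c * D i \<omega> \<le> f c i * g c \<omega> / mN c * e"
      proof (cases "f c i = 0 \<or> g c \<omega> = 0")
        case False
        then have "0 < f c i" "0 < g c \<omega>"
          using f0[of c i] g0[of c \<omega>] by auto
        then show ?thesis
          using D_cell[OF c i] mN(1)[OF c] by (intro mult_left_mono) auto
      qed auto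
    qed (use \<delta> in auto)
    also have "\<dots> = diag i \<omega> * e"
      by (simp add: diag_def sum_distrib_right)
    finally have 1: "diag i \<omega> * D i \<omega> \<le> diag i \<omega> * e" .
    have "F i * G \<omega> / \<tau> * D i \<omega> \<le> F i * G \<omega> / \<tau> * (A + \<theta> * (U i + V \<omega>))"
      using D_le[OF i] F G0 \<tau> by (intro mult_left_mono) auto
    also have "\<dots> = F i * A / \<tau> * G \<omega> + F i * \<theta> * U i / \<tau> * G \<omega> + F i * \<theta> / \<tau> * (G \<omega> * V \<omega>)"
      using \<tau> by (simp add: field_simps)
    \<comment> \<open>No relation between \<open>G\<close> and \<open>V\<close> is available, so
      \<open>G \<le> 1\<close> is used. The remaining \<open>1 / \<tau>\<close> cancels after
      averaging over \<open>i\<close>, because the \<open>F i\<close> sum to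
      \<open>N * \<tau>\<close>.\<close>
    also have "F i * \<theta> / \<tau> * (G \<omega> * V \<omega>) \<le> F i * \<theta> / \<tau> * (1 * V \<omega>)"
      using F A \<tau> G UV by (intro mult_left_mono mult_right_mono) auto
    finally show ?thesis
      using 1 by (simp add: h_def distrib_right)
  qed
  have "(\<integral>\<^sup>+\<omega>. ennreal (h i \<omega> * D i \<omega>) \<partial>M) \<le> ennreal (e + F i * A + \<theta> * U i + F i * (\<theta> / \<tau> * (\<integral>\<omega>. V \<omega> \<partial>M)))"
    if i: "i \<in> {1..N}" for i
  proof -
    let ?B = "\<lambda>\<omega>. diag i \<omega> * e + F i * A / \<tau> * G \<omega> + F i * \<theta> * U i / \<tau> * G \<omega> + F i * \<theta> / \<tau> * V \<omega>"
    have "(\<integral>\<^sup>+\<omega>. ennreal (h i \<omega> * D i \<omega>) \<partial>M) \<le> (\<integral>\<^sup>+\<omega>. ennreal (?B \<omega>) \<partial>M)"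
      by (intro nn_integral_mono ennreal_leI bound i)
    also have "\<dots> = ennreal (\<integral>\<omega>. ?B \<omega> \<partial>M)"
      using diag_int G_int UV diag0 e F A \<tau> G0
      by (intro nn_integral_eq_integral) (auto intro!: AE_I2 add_nonneg_nonneg mult_nonneg_nonneg divide_nonneg_pos)
    also have "(\<integral>\<omega>. ?B \<omega> \<partial>M) = (1 - F i) * e + F i * A + F i * \<theta> * U i + F i * (\<theta> / \<tau> * (\<integral>\<omega>. V \<omega> \<partial>M))"
      using diag_int G_int UV \<tau> by (simp add: Ediag EG)
    also have "\<dots> \<le> e + F i * A + \<theta> * U i + F i * (\<theta> / \<tau> * (\<integral>\<omega>. V \<omega> \<partial>M))"
    proof -
      have "F i * (\<theta> * U i) \<le> 1 * (\<theta> * U i)" "(1 - F i) * e \<le> 1 * e"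
        using F A UV e by (intro mult_right_mono; simp)+
      then show ?thesis
        by (simp add: mult.assoc)
    qed
    finally show ?thesis
      by (simp add: ennreal_leI)
  qed
  then have "weighted_cost M N h D
      \<le> (\<Sum>i=1..N. ennreal (e + F i * A + \<theta> * U i + F i * (\<theta> / \<tau> * (\<integral>\<omega>. V \<omega> \<partial>M)))) / of_nat N"
    unfolding weighted_cost_def by (intro divide_right_mono_ennreal sum_mono)
  also have "\<dots> = ennreal ((\<Sum>i=1..N. e + F i * A + \<theta> * U i + F i * (\<theta> / \<tau> * (\<integral>\<omega>. V \<omega> \<partial>M))) / real N)"
  proof -
    have nn: "0 \<le> e + F i * A + \<theta> * U i + F i * (\<theta> / \<tau> * (\<integral>\<omega>. V \<omega> \<partial>M))" for i
      using e F A \<tau> UV by (intro add_nonneg_nonneg mult_nonneg_nonneg divide_nonneg_pos Bochner_Integration.integral_nonneg) auto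
    then show ?thesis
      using N by (subst sum_ennreal) (auto simp: ennreal_of_nat_eq_real_of_nat intro!: divide_ennreal sum_nonneg)
  qed
  also have "(\<Sum>i=1..N. e + F i * A + \<theta> * U i + F i * (\<theta> / \<tau> * (\<integral>\<omega>. V \<omega> \<partial>M))) / real N
      = e + \<tau> * A + \<theta> * ((\<Sum>i=1..N. U i) / real N + (\<integral>\<omega>. V \<omega> \<partial>M))"
    using N \<tau> unfolding sum.distrib sum_distrib_right[symmetric] sum_distrib_left[symmetric] sumF
    by (simp add: field_simps)
  also have "\<dots> \<le> e + \<tau>0 * A + \<theta> * ((\<Sum>i=1..N. U i) / real N + (\<integral>\<omega>. V \<omega> \<partial>M))"
    using \<tau> A by (intro add_right_mono add_left_mono mult_right_mono) auto
  finally show ?thesis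
    using that h by (simp add: ennreal_leI)
qed

text \<open>A partition of unity up to small mass, with supports of diameter at most
  \<open>e\<close>. Lipschitz functions replace indicators because their averages converge under
  Wasserstein convergence without any condition on cell boundaries.\<close>

definition fine_cells :: "real \<Rightarrow> nat \<Rightarrow> (nat \<Rightarrow> 'e::metric_space \<Rightarrow> real) \<Rightarrow> bool"
  where "fine_cells e l \<phi> \<longleftrightarrow>
    (\<forall>j. \<exists>C. C-lipschitz_on UNIV (\<phi> j)) \<and> (\<forall>j x. 0 \<le> \<phi> j x) \<and> (\<forall>x. (\<Sum>j<l. \<phi> j x) \<le> 1) \<and>
    (\<forall>j x y. 0 < \<phi> j x \<longrightarrow> 0 < \<phi> j y \<longrightarrow> dist x y \<le> e)"

lemma fine_cellsD:
  assumes "fine_cells e l \<phi>"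
  shows "\<exists>C. C-lipschitz_on UNIV (\<phi> j)" "0 \<le> \<phi> j x" "(\<Sum>j<l. \<phi> j x) \<le> 1"
    "0 < \<phi> j x \<Longrightarrow> 0 < \<phi> j y \<Longrightarrow> dist x y \<le> e"
  using assms unfolding fine_cells_def by blast+

lemma fine_cells_le_1:
  assumes "fine_cells e l \<phi>" "j < l"
  shows "\<phi> j x \<le> 1"
  using member_le_sum[of j "{..<l}" "\<lambda>j. \<phi> j x"] fine_cellsD(2,3)[OF assms(1)] assms(2)
  by (auto intro: order_trans)

lemma fine_cells_measurable:
  assumes "fine_cells e l \<phi>"
  shows "\<phi> j \<in> borel_measurable borel"
  using fine_cellsD(1)[OF assms, of j] lipschitz_on_continuous_on borel_measurable_continuous_onI by blast

text \<open>Bumps around the points of a dense sequence are added up and truncated at 1; the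
  increments of the truncated sums are the cells. Each is supported in one bump, and the sums reach
  1 at every value of \<open>Y\<close>, so dominated convergence makes finitely many cells
  sufficient.\<close>

lemma fine_cells_exist:
  fixes Y :: "'w \<Rightarrow> 'e::metric_space"
  assumes M: "prob_space M" and Y [measurable]: "Y \<in> borel_measurable M"
    and D: "countable D" "\<And>\<omega> e. \<omega> \<in> space M \<Longrightarrow> 0 < e \<Longrightarrow> \<exists>g\<in>D. dist g (Y \<omega>) < e"
    and e: "0 < e"
  shows "\<exists>l \<phi>. fine_cells e l \<phi> \<and> 1 - e \<le> (\<integral>\<omega>. (\<Sum>j<l. \<phi> j (Y \<omega>)) \<partial>M)"
proof -
  interpret prob_space M by fact
  \<comment> \<open>The bump is at least 1 within distance \<open>e / 4\<close> of its centre and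
    vanishes from \<open>e / 2\<close> on, which gives supports of diameter at most
    \<open>e\<close>.\<close>
  define u where "u j x = max 0 (2 - 4 * dist (from_nat_into D j) x / e)" for j x
  define S where "S j x = min 1 (\<Sum>i<j. u i x)" for j x
  define \<phi> where "\<phi> j x = S (Suc j) x - S j x" for j x
  have u0: "0 \<le> u j x" for j x
    by (simp add: u_def)
  have lip_u: "\<bar>u j x - u j y\<bar> \<le> 4 / e * dist x y" for j x y
  proof -
    have "\<bar>max 0 (2 - a) - max 0 (2 - b)\<bar> \<le> \<bar>a - b\<bar>" for a b :: real
      by (simp add: max_def abs_minus_commute)
    then have "\<bar>u j x - u j y\<bar> \<le> \<bar>4 * dist (from_nat_into D j) x / e - 4 * dist (from_nat_into D j) y / e\<bar>"
      unfolding u_def .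
    also have "4 * dist (from_nat_into D j) x / e - 4 * dist (from_nat_into D j) y / e
        = 4 / e * (dist (from_nat_into D j) x - dist (from_nat_into D j) y)"
      by (simp add: diff_divide_distrib right_diff_distrib)
    also have "\<bar>\<dots>\<bar> = 4 / e * \<bar>dist (from_nat_into D j) x - dist (from_nat_into D j) y\<bar>"
      unfolding abs_mult using e by simp
    also have "\<dots> \<le> 4 / e * dist x y"
    proof (rule mult_left_mono)
      show "\<bar>dist (from_nat_into D j) x - dist (from_nat_into D j) y\<bar> \<le> dist x y"
        using dist_triangle2[of "from_nat_into D j" x y] dist_triangle[of "from_nat_into D j" y x] by linarith
    qed (use e in simp)
    finally show ?thesis .
  qed
  have lip_S: "\<bar>S j x - S j y\<bar> \<le> real j * (4 / e) * dist x y" for j x y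
  proof -
    have "\<bar>S j x - S j y\<bar> \<le> \<bar>(\<Sum>i<j. u i x) - (\<Sum>i<j. u i y)\<bar>"
      unfolding S_def by (simp add: min_def)
    also have "\<dots> \<le> (\<Sum>i<j. \<bar>u i x - u i y\<bar>)"
      unfolding sum_subtractf[symmetric] by (rule sum_abs)
    also have "\<dots> \<le> (\<Sum>i<j. 4 / e * dist x y)"
      by (intro sum_mono lip_u)
    finally show ?thesis
      by (simp add: mult.assoc)
  qed
  have sum_\<phi>: "(\<Sum>j<l. \<phi> j x) = S l x" for l x
    using sum_lessThan_telescope[of "\<lambda>j. S j x" l] by (simp add: \<phi>_def S_def[of 0])
  have "fine_cells e l \<phi>" for l
    unfolding fine_cells_def
  proof (intro conjI allI impI)
    fix j
    have "(real (Suc j) * (4 / e) + real j * (4 / e))-lipschitz_on UNIV (\<phi> j)"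
    proof (rule lipschitz_onI)
      fix x y
      show "dist (\<phi> j x) (\<phi> j y) \<le> (real (Suc j) * (4 / e) + real j * (4 / e)) * dist x y"
        using lip_S[of "Suc j" x y] lip_S[of j x y] unfolding \<phi>_def dist_real_def distrib_right by linarith
    qed (use e in auto)
    then show "\<exists>C. C-lipschitz_on UNIV (\<phi> j)" ..
  next
    fix j x
    show "0 \<le> \<phi> j x"
      using u0[of j x] by (simp add: \<phi>_def S_def)
  next
    fix x show "(\<Sum>j<l. \<phi> j x) \<le> 1"
      by (simp add: sum_\<phi> S_def)
  next
    fix j x y assume "0 < \<phi> j x" "0 < \<phi> j y"
    then have "0 < u j x" "0 < u j y"
      using u0[of j x] u0[of j y] by (auto simp: \<phi>_def S_def min_def split: if_splits)
    then have "dist (from_nat_into D j) x < e / 2" "dist (from_nat_into D j) y < e / 2"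
      using e by (auto simp: u_def max_def field_simps split: if_splits)
    then show "dist x y \<le> e"
      using dist_triangle3[of x y "from_nat_into D j"] by linarith
  qed
  moreover have "(\<lambda>l. \<integral>\<omega>. S l (Y \<omega>) \<partial>M) \<longlonglongrightarrow> (\<integral>\<omega>. 1 \<partial>M)"
  proof (rule integral_dominated_convergence[where w = "\<lambda>_. 1"])
    have "S l \<in> borel_measurable borel" for l
      using lip_S[of l] e
      by (intro borel_measurable_continuous_onI lipschitz_on_continuous_on[where L = "real l * (4 / e)"] lipschitz_onI)
        (auto simp: dist_real_def)
    then show "(\<lambda>\<omega>. S l (Y \<omega>)) \<in> borel_measurable M" for l
      by measurable
    show "AE \<omega> in M. (\<lambda>l. S l (Y \<omega>)) \<longlonglongrightarrow> 1"
    proof (rule AE_I2)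
      fix \<omega> assume "\<omega> \<in> space M"
      then obtain g where g: "g \<in> D" "dist g (Y \<omega>) < e / 4"
        using D(2)[of \<omega> "e / 4"] e by auto
      then obtain j where j: "g = from_nat_into D j"
        using from_nat_into_surj[OF D(1)] by metis
      have "1 \<le> u j (Y \<omega>)"
        using g(2) e unfolding u_def j by (simp add: field_simps)
      then have "S l (Y \<omega>) = 1" if "Suc j \<le> l" for l
        using member_le_sum[of j "{..<l}" "\<lambda>i. u i (Y \<omega>)"] u0 that by (simp add: S_def)
      then show "(\<lambda>l. S l (Y \<omega>)) \<longlonglongrightarrow> 1"
        by (intro tendsto_eventually) (auto simp: eventually_at_top_linorder)
    qed
    show "AE \<omega> in M. norm (S l (Y \<omega>)) \<le> 1" for l
    proof -
      have "0 \<le> S l x" "S l x \<le> 1" for x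
        using u0 by (simp_all add: S_def sum_nonneg)
      then show ?thesis
        by simp
    qed
  qed auto
  then have "eventually (\<lambda>l. 1 - e < (\<integral>\<omega>. S l (Y \<omega>) \<partial>M)) sequentially"
    using e by (intro order_tendstoD) (auto simp: prob_space)
  then obtain l where "1 - e < (\<integral>\<omega>. S l (Y \<omega>) \<partial>M)"
    by (auto simp: eventually_at_top_linorder)
  ultimately show ?thesis
    by (intro exI[of _ l] exI[of _ \<phi>]) (auto simp: sum_\<phi>)
qed


section \<open>Averages of independent variables\<close>

text \<open>Events of \<open>f (X i)\<close> are events of \<open>X i\<close>. Composing with real
  functions thus turns three families with different value types into one real family indexed by a
  sum type.\<close>

lemma (in prob_space) indep_families_indep_vars:
  fixes f1 :: "'e1 \<Rightarrow> real" and f2 :: "'e2 \<Rightarrow> real" and f3 :: "'e3 \<Rightarrow> real"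
  assumes ind: "indep_families M E1 X1 I1 E2 X2 I2 E3 X3 I3"
    and X: "\<And>i. i \<in> I1 \<Longrightarrow> X1 i \<in> M \<rightarrow>\<^sub>M E1" "\<And>i. i \<in> I2 \<Longrightarrow> X2 i \<in> M \<rightarrow>\<^sub>M E2" "\<And>i. i \<in> I3 \<Longrightarrow> X3 i \<in> M \<rightarrow>\<^sub>M E3"
    and f: "f1 \<in> borel_measurable E1" "f2 \<in> borel_measurable E2" "f3 \<in> borel_measurable E3"
  shows "indep_vars (\<lambda>_. borel) (case_sum (\<lambda>i \<omega>. f1 (X1 i \<omega>)) (case_sum (\<lambda>i \<omega>. f2 (X2 i \<omega>)) (\<lambda>i \<omega>. f3 (X3 i \<omega>))))
    (I1 <+> I2 <+> I3)"
  unfolding indep_vars_def2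
proof
  show "\<forall>i\<in>I1 <+> I2 <+> I3. random_variable borel
      (case_sum (\<lambda>i \<omega>. f1 (X1 i \<omega>)) (case_sum (\<lambda>i \<omega>. f2 (X2 i \<omega>)) (\<lambda>i \<omega>. f3 (X3 i \<omega>))) i)"
    using X f by (auto intro: measurable_compose)
  have sub: "{(\<lambda>\<omega>. f (X \<omega>)) -` A \<inter> space M |A. A \<in> sets borel} \<subseteq> rv_events M E X"
    if "X \<in> M \<rightarrow>\<^sub>M E" "f \<in> borel_measurable E" for X :: "'a \<Rightarrow> 'e" and E and f :: "'e \<Rightarrow> real"
  proof safe
    fix A :: "real set" assume "A \<in> sets borel"
    then have "f -` A \<inter> space E \<in> sets E"
      using that(2) by (rule measurable_sets[rotated])
    moreover have "(\<lambda>\<omega>. f (X \<omega>)) -` A \<inter> space M = X -` (f -` A \<inter> space E) \<inter> space M"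
      using measurable_space[OF that(1)] by auto
    ultimately show "(\<lambda>\<omega>. f (X \<omega>)) -` A \<inter> space M \<in> rv_events M E X"
      unfolding rv_events_def by blast
  qed
  show "indep_sets (\<lambda>i. {case_sum (\<lambda>i \<omega>. f1 (X1 i \<omega>)) (case_sum (\<lambda>i \<omega>. f2 (X2 i \<omega>)) (\<lambda>i \<omega>. f3 (X3 i \<omega>))) i -` A
      \<inter> space M |A. A \<in> sets borel}) (I1 <+> I2 <+> I3)"
  proof (rule indep_sets_mono_sets[OF ind[unfolded indep_families_def]])
    fix i assume "i \<in> I1 <+> I2 <+> I3"
    then show "{case_sum (\<lambda>i \<omega>. f1 (X1 i \<omega>)) (case_sum (\<lambda>i \<omega>. f2 (X2 i \<omega>)) (\<lambda>i \<omega>. f3 (X3 i \<omega>))) i -` A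
        \<inter> space M |A. A \<in> sets borel}
      \<subseteq> case_sum (\<lambda>i. rv_events M E1 (X1 i)) (case_sum (\<lambda>i. rv_events M E2 (X2 i)) (\<lambda>i. rv_events M E3 (X3 i))) i"
      using sub[OF X(1) f(1)] sub[OF X(2) f(2)] sub[OF X(3) f(3)]
      by (elim PlusE) (simp_all only: sum.case)
  qed
qed

text \<open>Off-diagonal products have mean zero by independence and centring, so only the squares
  survive.\<close>

lemma (in prob_space) expectation_square_sum_indep:
  fixes X :: "'i \<Rightarrow> 'a \<Rightarrow> real"
  assumes I: "finite I" and ind: "indep_vars (\<lambda>_. borel) X I"
    and bound: "\<And>i \<omega>. i \<in> I \<Longrightarrow> \<bar>X i \<omega>\<bar> \<le> b" and zero: "\<And>i. i \<in> I \<Longrightarrow> expectation (X i) = 0"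
  shows "integrable M (\<lambda>\<omega>. (\<Sum>i\<in>I. X i \<omega>)\<^sup>2)"
    and "expectation (\<lambda>\<omega>. (\<Sum>i\<in>I. X i \<omega>)\<^sup>2) = (\<Sum>i\<in>I. expectation (\<lambda>\<omega>. (X i \<omega>)\<^sup>2))"
proof -
  have rv: "random_variable borel (X i)" if "i \<in> I" for i
    using ind that by (auto simp: indep_vars_def)
  have int: "integrable M (X i)" if "i \<in> I" for i
    using rv[OF that] bound[OF that] by (intro integrable_const_bound[where B = b]) auto
  have int2: "integrable M (\<lambda>\<omega>. X i \<omega> * X j \<omega>)" if ij: "i \<in> I" "j \<in> I" for i j
  proof (rule integrable_const_bound[where B = "b * b"])
    have "\<bar>X i \<omega>\<bar> * \<bar>X j \<omega>\<bar> \<le> b * b" for \<omega>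
      using bound[OF ij(1), of \<omega>] bound[OF ij(2), of \<omega>] by (intro mult_mono) auto
    then show "AE \<omega> in M. norm (X i \<omega> * X j \<omega>) \<le> b * b"
      by (simp add: abs_mult)
  qed (use rv ij in measurable)
  have sq: "(\<Sum>i\<in>I. X i \<omega>)\<^sup>2 = (\<Sum>i\<in>I. \<Sum>j\<in>I. X i \<omega> * X j \<omega>)" for \<omega>
    by (simp add: power2_eq_square sum_product)
  show "integrable M (\<lambda>\<omega>. (\<Sum>i\<in>I. X i \<omega>)\<^sup>2)"
    unfolding sq using int2 by auto
  have cross: "expectation (\<lambda>\<omega>. X i \<omega> * X j \<omega>) = (if i = j then expectation (\<lambda>\<omega>. (X i \<omega>)\<^sup>2) else 0)"
    if ij: "i \<in> I" "j \<in> I" for i j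
  proof (cases "i = j")
    case False
    have "expectation (\<lambda>\<omega>. \<Prod>k\<in>{i, j}. X k \<omega>) = (\<Prod>k\<in>{i, j}. expectation (X k))"
      using ij int by (intro indep_vars_lebesgue_integral indep_vars_subset[OF ind]) auto
    then show ?thesis
      using False zero ij by simp
  qed (simp add: power2_eq_square)
  have "expectation (\<lambda>\<omega>. (\<Sum>i\<in>I. X i \<omega>)\<^sup>2) = (\<Sum>i\<in>I. \<Sum>j\<in>I. expectation (\<lambda>\<omega>. X i \<omega> * X j \<omega>))"
    unfolding sq using int2 by simp
  also have "\<dots> = (\<Sum>i\<in>I. \<Sum>j\<in>I. if i = j then expectation (\<lambda>\<omega>. (X i \<omega>)\<^sup>2) else 0)"
    by (intro sum.cong refl cross)
  also have "\<dots> = (\<Sum>i\<in>I. expectation (\<lambda>\<omega>. (X i \<omega>)\<^sup>2))"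
    using I by (simp add: sum.delta)
  finally show "expectation (\<lambda>\<omega>. (\<Sum>i\<in>I. X i \<omega>)\<^sup>2) = (\<Sum>i\<in>I. expectation (\<lambda>\<omega>. (X i \<omega>)\<^sup>2))" .
qed

text \<open>Only boundedness of the averages is needed, so truncation at level \<open>2\<^sup>k\<close> and
  Chebyshev's inequality along \<open>N = 2\<^sup>k\<close> replace the strong law of large numbers.\<close>

lemma (in prob_space) bounded_averages:
  fixes Y :: "nat \<Rightarrow> 'a \<Rightarrow> real"
  assumes ind: "indep_vars (\<lambda>_. borel) Y {1..}" and Y0: "\<And>i \<omega>. 0 \<le> Y i \<omega>"
    and r: "1 < r" "r \<le> 2" and int: "\<And>i. 1 \<le> i \<Longrightarrow> integrable M (\<lambda>\<omega>. Y i \<omega> powr r)"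
    and C: "\<And>i. 1 \<le> i \<Longrightarrow> expectation (\<lambda>\<omega>. Y i \<omega> powr r) \<le> C"
  shows "AE \<omega> in M. \<exists>B. \<forall>N\<ge>1. (\<Sum>i=1..N. Y i \<omega>) \<le> B * real N"
proof -
  have rv [measurable]: "random_variable borel (Y i)" if "1 \<le> i" for i
    using ind that by (auto simp: indep_vars_def)
  have C0: "0 \<le> C"
  proof -
    have "0 \<le> expectation (\<lambda>\<omega>. Y 1 \<omega> powr r)"
      by (intro Bochner_Integration.integral_nonneg) auto
    then show ?thesis
      using C[of 1] by linarith
  qed
  define n where "n k = (2::real) ^ k" for k :: nat
  have n: "1 \<le> n k" for k
    by (simp add: n_def)
  define Z where "Z k i \<omega> = min (Y i \<omega>) (n k)" for k i \<omega>
  define Z' where "Z' k i \<omega> = Z k i \<omega> - expectation (Z k i)" for k i \<omega>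
  have Z01: "0 \<le> Z k i \<omega>" "Z k i \<omega> \<le> n k" for k i \<omega>
    using Y0[of i \<omega>] n[of k] by (auto simp: Z_def)
  have Z_rv [measurable]: "random_variable borel (Z k i)" "random_variable borel (Z' k i)" if "1 \<le> i" for k i
    unfolding Z_def[abs_def] Z'_def[abs_def] using rv[OF that] by measurable
  have Z_int: "integrable M (Z k i)" if "1 \<le> i" for k i
    using Z_rv(1)[OF that] Z01 by (intro integrable_const_bound[where B = "n k"]) auto
  have EZ: "0 \<le> expectation (Z k i)" "expectation (Z k i) \<le> 1 + C" if i: "1 \<le> i" for k i
  proof -
    show "0 \<le> expectation (Z k i)"
      using Z01 by (intro Bochner_Integration.integral_nonneg) auto
    have "Z k i \<omega> \<le> 1 + Y i \<omega> powr r" for \<omega>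
    proof (cases "Y i \<omega> \<le> 1")
      case False
      then have "Y i \<omega> powr 1 \<le> Y i \<omega> powr r"
        using r by (intro powr_mono) auto
      then show ?thesis
        using False by (simp add: Z_def)
    qed (simp add: Z_def add_increasing2)
    then have "expectation (Z k i) \<le> expectation (\<lambda>\<omega>. 1 + Y i \<omega> powr r)"
      using Z_int[OF i] int[OF i] by (intro integral_mono) auto
    also have "\<dots> \<le> 1 + C"
      using int[OF i] C[OF i] by (simp add: prob_space)
    finally show "expectation (Z k i) \<le> 1 + C" .
  qed
  have EZ2: "expectation (\<lambda>\<omega>. (Z' k i \<omega>)\<^sup>2) \<le> n k powr (2 - r) * C" if i: "1 \<le> i" for k i
  proof -
    have int2: "integrable M (\<lambda>\<omega>. (Z k i \<omega>)\<^sup>2)"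
      using Z01 Z_rv[OF i] n[of k]
      by (intro integrable_const_bound[where B = "(n k)\<^sup>2"]) (auto intro!: power_mono)
    have "expectation (\<lambda>\<omega>. (Z' k i \<omega>)\<^sup>2) = expectation (\<lambda>\<omega>. (Z k i \<omega>)\<^sup>2) - (expectation (Z k i))\<^sup>2"
      unfolding Z'_def using Z_int[OF i] int2 by (rule variance_eq)
    also have "\<dots> \<le> expectation (\<lambda>\<omega>. (Z k i \<omega>)\<^sup>2)"
      by simp
    also have "\<dots> \<le> expectation (\<lambda>\<omega>. n k powr (2 - r) * Y i \<omega> powr r)"
    proof (rule integral_mono)
      fix \<omega>
      \<comment> \<open>Truncation at \<open>n k\<close> trades the missing second moment for the
        factor \<open>n k powr (2 - r)\<close>; the exponent is nonnegative because
        \<open>r \<le> 2\<close>.\<close>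
      have "(Z k i \<omega>)\<^sup>2 = Z k i \<omega> powr (2 - r) * Z k i \<omega> powr r"
        using Z01(1)[of k i \<omega>] by (cases "Z k i \<omega> = 0") (simp_all flip: powr_add)
      also have "\<dots> \<le> n k powr (2 - r) * Y i \<omega> powr r"
        using Z01[of k i \<omega>] r by (intro mult_mono powr_mono2) (auto simp: Z_def)
      finally show "(Z k i \<omega>)\<^sup>2 \<le> n k powr (2 - r) * Y i \<omega> powr r" .
    qed (use int2 int[OF i] in auto)
    also have "\<dots> \<le> n k powr (2 - r) * C"
      using C[OF i] by (simp add: mult_left_mono)
    finally show ?thesis .
  qed
  \<comment> \<open>\<open>A k\<close>: the centred truncated sum of \<open>2 ^ k\<close> terms is
    as large as \<open>n k\<close>. \<open>A' k\<close>: truncation changes, or just touches, some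
    term. Both probabilities are at most \<open>C * n k powr (1 - r)\<close>, which is geometric in
    \<open>k\<close> as \<open>r > 1\<close>.\<close>
  define A where "A k = {\<omega> \<in> space M. (n k)\<^sup>2 \<le> (\<Sum>i=1..2^k. Z' k i \<omega>)\<^sup>2}" for k
  define A' where "A' k = (\<Union>i\<in>{1..2^k}. {\<omega> \<in> space M. n k powr r \<le> Y i \<omega> powr r})" for k
  have [measurable]: "A k \<in> sets M" "A' k \<in> sets M" for k
    unfolding A_def A'_def by (measurable; simp)+
  have A: "prob (A k) \<le> n k powr (1 - r) * C" for k
  proof -
    have "indep_vars (\<lambda>_. borel) (\<lambda>i \<omega>. min (Y i \<omega>) (n k) - expectation (Z k i)) {1..2^k}"
      by (rule indep_vars_compose2[where Y = "\<lambda>i y. min y (n k) - expectation (Z k i)", OF indep_vars_subset[OF ind]]) auto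
    then have ind': "indep_vars (\<lambda>_. borel) (Z' k) {1..2^k}"
      by (simp add: Z'_def[abs_def] Z_def)
    have zero: "expectation (Z' k i) = 0" if "i \<in> {1..2^k}" for i
      using Z_int[of i k] that unfolding Z'_def by (simp add: prob_space)
    have bound: "\<bar>Z' k i \<omega>\<bar> \<le> n k + (1 + C)" if "i \<in> {1..2^k}" for i \<omega>
      using Z01[of k i \<omega>] EZ[of i k] that unfolding Z'_def by auto
    note * = expectation_square_sum_indep[OF _ ind' bound zero]
    have "prob (A k) \<le> expectation (\<lambda>\<omega>. (\<Sum>i=1..2^k. Z' k i \<omega>)\<^sup>2) / (n k)\<^sup>2"
      unfolding A_def using *(1) n[of k]
      by (intro integral_Markov_inequality_measure[where A = "{}"]) auto
    also have "expectation (\<lambda>\<omega>. (\<Sum>i=1..2^k. Z' k i \<omega>)\<^sup>2) = (\<Sum>i=1..2^k. expectation (\<lambda>\<omega>. (Z' k i \<omega>)\<^sup>2))"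
      by (rule *(2)) auto
    also have "\<dots> / (n k)\<^sup>2 \<le> (\<Sum>i::nat=1..2^k. n k powr (2 - r) * C) / (n k)\<^sup>2"
      using EZ2 by (intro divide_right_mono sum_mono) auto
    also have "\<dots> = n k * (n k powr (2 - r) * C) / (n k)\<^sup>2"
      by (simp add: n_def)
    also have "\<dots> = n k powr (1 - r) * C"
      using n[of k] by (simp add: power2_eq_square powr_diff field_simps)
    finally show ?thesis .
  qed
  have A': "prob (A' k) \<le> n k powr (1 - r) * C" for k
  proof -
    have "prob (A' k) \<le> (\<Sum>i=1..2^k. prob {\<omega> \<in> space M. n k powr r \<le> Y i \<omega> powr r})"
      unfolding A'_def by (rule finite_measure_subadditive_finite) auto
    also have "\<dots> \<le> (\<Sum>i::nat=1..2^k. C / n k powr r)"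
    proof (rule sum_mono)
      fix i :: nat assume "i \<in> {1..2^k}"
      then have i: "1 \<le> i" by simp
      have "prob {\<omega> \<in> space M. n k powr r \<le> Y i \<omega> powr r} \<le> expectation (\<lambda>\<omega>. Y i \<omega> powr r) / n k powr r"
        using int[OF i] n[of k] by (intro integral_Markov_inequality_measure[where A = "{}"]) auto
      also have "\<dots> \<le> C / n k powr r"
        using C[OF i] by (simp add: divide_right_mono)
      finally show "prob {\<omega> \<in> space M. n k powr r \<le> Y i \<omega> powr r} \<le> C / n k powr r" .
    qed
    also have "\<dots> = n k * (C / n k powr r)"
      by (simp add: n_def)
    also have "\<dots> = n k powr (1 - r) * C"
      using n[of k] by (simp add: powr_diff)
    finally show ?thesis .
  qed
  have "summable (\<lambda>k. prob (A k \<union> A' k))"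
  proof (rule summable_comparison_test')
    have "n k powr (1 - r) = (2 powr (1 - r)) ^ k" for k
      by (simp add: n_def powr_power flip: powr_realpow)
        (simp add: powr_powr powr_realpow[symmetric] mult.commute)
    moreover have "(2::real) powr (1 - r) < 2 powr 0"
      using r by (intro powr_less_mono) auto
    ultimately show "summable (\<lambda>k. 2 * (n k powr (1 - r) * C))"
      by (auto intro!: summable_mult summable_mult2 summable_geometric)
    fix k :: nat
    have "prob (A k \<union> A' k) \<le> prob (A k) + prob (A' k)"
      by (rule measure_Un_le) auto
    then show "norm (prob (A k \<union> A' k)) \<le> 2 * (n k powr (1 - r) * C)"
      using A[of k] A'[of k] by simp
  qed
  then have "AE \<omega> in M. eventually (\<lambda>k. \<omega> \<in> space M - (A k \<union> A' k)) sequentially"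
    by (intro borel_cantelli_AE1) (auto simp: emeasure_eq_measure)
  then show ?thesis
  proof eventually_elim
    case (elim \<omega>)
    then obtain K where K: "\<And>k. K \<le> k \<Longrightarrow> \<omega> \<in> space M - (A k \<union> A' k)"
      by (auto simp: eventually_at_top_linorder)
    \<comment> \<open>The constant adds 1 for the centred sum and \<open>1 + C\<close> for the
      means.\<close>
    have dyadic: "(\<Sum>i=1..2^k. Y i \<omega>) \<le> n k * (C + 2)" if "K \<le> k" for k
    proof -
      have "Y i \<omega> < n k" if "i \<in> {1..2^k}" for i
      proof -
        have "\<not> n k powr r \<le> Y i \<omega> powr r"
          using K[OF \<open>K \<le> k\<close>] that unfolding A'_def by auto
        then show ?thesis
          using r n[of k] Y0[of i \<omega>] by (meson not_le powr_mono2 less_imp_le order_trans zero_le_one)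
      qed
      then have "(\<Sum>i=1..2^k. Y i \<omega>) = (\<Sum>i=1..2^k. Z k i \<omega>)"
        by (intro sum.cong) (auto simp: Z_def)
      also have "\<dots> = (\<Sum>i=1..2^k. Z' k i \<omega>) + (\<Sum>i=1..2^k. expectation (Z k i))"
        by (simp add: Z'_def flip: sum.distrib)
      also have "(\<Sum>i=1..2^k. Z' k i \<omega>) \<le> n k"
        using K[OF that] n[of k] unfolding A_def by (auto intro!: less_imp_le dest: power2_less_imp_less simp: not_le)
      also have "(\<Sum>i=1..2^k. expectation (Z k i)) \<le> (\<Sum>i::nat=1..2^k. 1 + C)"
        using EZ by (intro sum_mono) auto
      also have "(\<Sum>i::nat=1..2^k. 1 + C) = n k * (1 + C)"
        by (simp add: n_def)
      finally show ?thesis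
        by (simp add: algebra_simps)
    qed
    have mono: "(\<Sum>i=1..N. Y i \<omega>) \<le> (\<Sum>i=1..N'. Y i \<omega>)" if "N \<le> N'" for N N'
      using that Y0 by (intro sum_mono2) auto
    \<comment> \<open>The summand \<open>n K\<close> covers the finitely many
      \<open>N \<le> 2 ^ K\<close>, the summand 2 the loss from rounding a larger \<open>N\<close>
      up to a power of 2.\<close>
    define B where "B = (n K + 2) * (C + 2)"
    have "(\<Sum>i=1..N. Y i \<omega>) \<le> B * real N" if N: "1 \<le> N" for N
    proof (cases "N \<le> 2 ^ K")
      case True
      have "(\<Sum>i=1..N. Y i \<omega>) \<le> n K * (C + 2)"
        using mono[OF True] dyadic[of K] by simp
      also have "\<dots> \<le> B * 1"
        using C0 by (simp add: B_def mult_right_mono)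
      also have "\<dots> \<le> B * real N"
        using N C0 n[of K] by (intro mult_left_mono) (auto simp: B_def)
      finally show ?thesis .
    next
      case False
      then have "2 \<le> N"
        using one_le_power[of "2::nat" K] by linarith
      then obtain k where k: "2 ^ k < N" "N \<le> 2 ^ (k + 1)"
        using ex_power_ivl2[of 2 N] by auto
      have "(2::nat) ^ K < 2 ^ (k + 1)"
        using False k by linarith
      then have "K < k + 1"
        by (rule power_less_imp_less_exp[rotated]) simp
      then have "(\<Sum>i=1..N. Y i \<omega>) \<le> n (k + 1) * (C + 2)"
        using mono[OF k(2)] dyadic[of "k + 1"] by simp
      also have "\<dots> \<le> 2 * real N * (C + 2)"
      proof (rule mult_right_mono)
        have "real (2 ^ k) < real N"
          using k(1) by (simp only: of_nat_less_iff)
        then show "n (k + 1) \<le> 2 * real N"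
          by (simp add: n_def)
      qed (use C0 in simp)
      also have "\<dots> = 2 * (C + 2) * real N"
        by simp
      also have "\<dots> \<le> B * real N"
        unfolding B_def using C0 n[of K] by (intro mult_right_mono) auto
      finally show ?thesis .
    qed
    then show ?case
      by blast
  qed
qed

text \<open>The variables \<open>R N i\<close> are independent of the rest only for each fixed \<open>N\<close>, so a
  summable bound for each \<open>N\<close> is needed. Hoeffding's inequality provides it.\<close>

lemma (in prob_space) triangular_averages_tendsto_0:
  fixes Q :: "nat \<Rightarrow> nat \<Rightarrow> 'a \<Rightarrow> real"
  assumes ind: "\<And>N. indep_vars (\<lambda>_. borel) (Q N) {1..N}"
    and bound: "\<And>N i \<omega>. i \<in> {1..N} \<Longrightarrow> Q N i \<omega> \<in> {-1..1}"
    and zero: "\<And>N i. i \<in> {1..N} \<Longrightarrow> expectation (Q N i) = 0"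
  shows "AE \<omega> in M. (\<lambda>N. (\<Sum>i=1..N. Q N i \<omega>) / real N) \<longlonglongrightarrow> 0"
proof -
  define A where "A e N = {\<omega> \<in> space M. e * real N \<le> \<bar>\<Sum>i=1..N. Q N i \<omega>\<bar>}" for e :: real and N
  have rv [measurable]: "random_variable borel (Q N i)" if "i \<in> {1..N}" for N i
    using ind[of N] that by (auto simp: indep_vars_def)
  have [measurable]: "A e N \<in> sets M" for e N
    unfolding A_def by measurable
  have A: "prob (A e N) \<le> 2 * exp (- e\<^sup>2 / 2) ^ N" if e: "0 < e" for e N
  proof (cases "N = 0")
    case False
    interpret H: Hoeffding_ineq M "{1..N}" "Q N" "\<lambda>_. -1" "\<lambda>_. 1" "\<Sum>i=1..N. expectation (Q N i)"
      by unfold_locales (use ind bound in auto)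
    have "(\<Sum>i=1..N. expectation (Q N i)) = 0"
      using zero by simp
    then have "prob (A e N) \<le> 2 * exp (- 2 * (e * real N)\<^sup>2 / (\<Sum>i=1..N. (1 - (-1))\<^sup>2))"
      using H.Hoeffding_ineq_abs_ge[of "e * real N"] e False unfolding A_def by simp
    \<comment> \<open>Each variable ranges over an interval of length 2, so the squared lengths add
      up to \<open>4 * N\<close> and the bound is geometric in \<open>N\<close>.\<close>
    also have "- 2 * (e * real N)\<^sup>2 / (\<Sum>i=1..N. (1 - (-1))\<^sup>2) = real N * (- e\<^sup>2 / 2)"
      using False by (simp add: power2_eq_square field_simps)
    finally show ?thesis
      by (simp only: exp_of_nat_mult)
  qed (simp add: order_trans[OF prob_le_1])
  have "AE \<omega> in M. eventually (\<lambda>N. \<omega> \<in> space M - A e N) sequentially" if e: "0 < e" for e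
  proof (rule borel_cantelli_AE1)
    show "summable (\<lambda>N. prob (A e N))"
    proof (rule summable_comparison_test')
      show "summable (\<lambda>N. 2 * exp (- e\<^sup>2 / 2) ^ N)"
        using e by (intro summable_mult summable_geometric) auto
      show "norm (prob (A e N)) \<le> 2 * exp (- e\<^sup>2 / 2) ^ N" for N
        using A[OF e] by simp
    qed
  qed (auto simp: emeasure_eq_measure)
  \<comment> \<open>Only thresholds \<open>1 / Suc j\<close> are used, so that one null set serves
    all of them.\<close>
  then have "AE \<omega> in M. \<forall>j. eventually (\<lambda>N. \<omega> \<in> space M - A (1 / real (Suc j)) N) sequentially"
    by (subst AE_all_countable) auto
  then show ?thesis
  proof eventually_elim
    case (elim \<omega>)
    show ?case
    proof (rule tendstoI)
      fix e :: real assume "0 < e"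
      then obtain j where j: "inverse (real (Suc j)) < e"
        using reals_Archimedean by blast
      show "eventually (\<lambda>N. dist ((\<Sum>i=1..N. Q N i \<omega>) / real N) 0 < e) sequentially"
        using elim[rule_format, of j] eventually_gt_at_top[of 0]
      proof eventually_elim
        case (elim N)
        then have "\<bar>\<Sum>i=1..N. Q N i \<omega>\<bar> < 1 / real (Suc j) * real N"
          by (auto simp: A_def)
        then have "\<bar>\<Sum>i=1..N. Q N i \<omega>\<bar> / real N < 1 / real (Suc j)"
          using elim by (simp add: pos_divide_less_eq)
        then show ?case
          using j by (simp add: inverse_eq_divide)
      qed
    qed
  qed
qed


section \<open>Convergence of the empirical measures of the input data\<close>

lemma transport_cost_less_of_wasserstein_less:
  assumes "wasserstein E q \<mu> \<nu> < ennreal e" "0 < q" "0 < e"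
  shows "transport_cost E q \<mu> \<nu> < ennreal (e powr q)"
proof -
  have fin: "transport_cost E q \<mu> \<nu> \<noteq> \<infinity>"
    using assms(1) unfolding wasserstein_def by (metis ennreal_less_top infinity_ennreal_def less_asym)
  then have "ennreal (enn2real (transport_cost E q \<mu> \<nu>) powr (1 / q)) < ennreal e"
    using assms(1) by (simp add: wasserstein_def)
  then have "enn2real (transport_cost E q \<mu> \<nu>) powr (1 / q) < e"
    by (subst (asm) ennreal_less_iff) auto
  then have "(enn2real (transport_cost E q \<mu> \<nu>) powr (1 / q)) powr q < e powr q"
    using assms by (intro powr_less_mono2) auto
  then have "enn2real (transport_cost E q \<mu> \<nu>) < e powr q"
    using assms by (simp add: powr_powr)
  then have "ennreal (enn2real (transport_cost E q \<mu> \<nu>)) < ennreal (e powr q)"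
    by (subst ennreal_less_iff) auto
  then show ?thesis
    using fin by (simp add: less_top)
qed

lemma eventually_transport_cost_less:
  assumes "((\<lambda>n. wasserstein E q (\<mu> n) \<nu>) \<longlongrightarrow> 0) F" "0 < q" "0 < c"
  shows "eventually (\<lambda>n. transport_cost E q (\<mu> n) \<nu> < ennreal c) F"
proof -
  have "eventually (\<lambda>n. wasserstein E q (\<mu> n) \<nu> < ennreal (c powr (1 / q))) F"
    using assms(1) by (rule order_tendstoD) (use assms in simp)
  then show ?thesis
  proof eventually_elim
    case (elim n)
    show ?case
      using transport_cost_less_of_wasserstein_less[OF elim] assms by (simp add: powr_powr)
  qed
qed

lemma wasserstein_tendsto_0:
  assumes "\<And>c. 0 < c \<Longrightarrow> eventually (\<lambda>n. transport_cost E q (\<mu> n) \<nu> \<le> ennreal c) F" "0 < q"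
  shows "((\<lambda>n. wasserstein E q (\<mu> n) \<nu>) \<longlongrightarrow> 0) F"
proof (rule order_tendstoI)
  fix a :: ennreal assume "0 < a"
  then obtain e where e: "0 < e" "ennreal e < a"
    by (metis dense ennreal_cases ennreal_less_zero_iff ennreal_zero_less_top less_top not_less_iff_gr_or_eq
        top_neq_ennreal zero_less_iff_neq_zero)
  have "eventually (\<lambda>n. transport_cost E q (\<mu> n) \<nu> \<le> ennreal (e powr q)) F"
    using assms e by simp
  then show "eventually (\<lambda>n. wasserstein E q (\<mu> n) \<nu> < a) F"
  proof eventually_elim
    case (elim n)
    have fin: "transport_cost E q (\<mu> n) \<nu> \<noteq> \<infinity>"
      using elim by (auto simp: top_unique)
    have "enn2real (transport_cost E q (\<mu> n) \<nu>) \<le> e powr q"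
      using elim by (intro enn2real_leI) auto
    then have "enn2real (transport_cost E q (\<mu> n) \<nu>) powr (1 / q) \<le> (e powr q) powr (1 / q)"
      using assms by (intro powr_mono2) auto
    also have "\<dots> = e"
      using e assms by (simp add: powr_powr)
    finally have "wasserstein E q (\<mu> n) \<nu> \<le> ennreal e"
      using fin by (simp add: wasserstein_def ennreal_leI)
    then show ?case
      using e(2) by (rule le_less_trans)
  qed
qed simp

lemma lipschitz_average_tendsto:
  fixes E :: "'e::metric_space measure" and \<phi> :: "'e \<Rightarrow> real"
  assumes W: "(\<lambda>N. wasserstein E q (empirical E N (y N)) \<nu>) \<longlonglongrightarrow> 0"
    and y: "\<And>N i. i \<in> {1..N} \<Longrightarrow> y N i \<in> space E"
    and \<nu>: "prob_space \<nu>" "sets \<nu> = sets E" and q: "1 \<le> q"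
    and \<phi>: "\<phi> \<in> borel_measurable E" and lip: "C-lipschitz_on UNIV \<phi>" and \<phi>01: "\<And>x. \<phi> x \<in> {0..1}"
    and dist: "(\<lambda>z. dist (fst z) (snd z)) \<in> borel_measurable (E \<Otimes>\<^sub>M E)"
  shows "(\<lambda>N. (\<Sum>i=1..N. \<phi> (y N i)) / real N) \<longlonglongrightarrow> (\<integral>x. \<phi> x \<partial>\<nu>)"
proof (rule tendstoI)
  fix e :: real assume e: "0 < e"
  have C: "0 \<le> C"
    using lip by (rule lipschitz_on_nonneg)
  \<comment> \<open>At cost \<open>d powr q\<close> the Lipschitz estimate gives
    \<open>2 * C * d\<close>; the extra 1 in the denominator keeps the inequality strict and covers
    \<open>C = 0\<close>.\<close>
  define d where "d = e / (2 * C + 1)"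
  have d: "0 < d"
    using e C by (simp add: d_def)
  have small: "C * (d + d powr (1 - q) * d powr q) < e"
  proof -
    have "C * (d + d powr (1 - q) * d powr q) = 2 * C * d"
      using d by (simp add: flip: powr_add)
    also have "\<dots> < (2 * C + 1) * d"
      using d by (simp add: distrib_right)
    also have "\<dots> = e"
      using C by (simp add: d_def)
    finally show ?thesis .
  qed
  have "eventually (\<lambda>N. transport_cost E q (empirical E N (y N)) \<nu> < ennreal (d powr q)) sequentially"
    using W q d by (intro eventually_transport_cost_less) auto
  then show "eventually (\<lambda>N. dist ((\<Sum>i=1..N. \<phi> (y N i)) / real N) (\<integral>x. \<phi> x \<partial>\<nu>) < e) sequentially"
    using eventually_ge_at_top[of 1]
  proof eventually_elim
    case (elim N)
    have "\<bar>(\<integral>x. \<phi> x \<partial>empirical E N (y N)) - (\<integral>x. \<phi> x \<partial>\<nu>)\<bar> \<le> C * (d + d powr (1 - q) * d powr q)"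
      using elim y d q
      by (intro transport_cost_lipschitz[OF elim(1) _ _ _ \<nu> _ _ \<phi> lip \<phi>01 dist] prob_space_empirical) auto
    also have "(\<integral>x. \<phi> x \<partial>empirical E N (y N)) = (\<Sum>i=1..N. \<phi> (y N i)) / real N"
      by (rule integral_empirical[OF elim(2) y \<phi>])
    finally show ?case
      using small by (simp add: dist_real_def)
  qed
qed

lemma integrable_powr_mono:
  fixes f :: "'w \<Rightarrow> real"
  assumes "finite_measure M" "f \<in> borel_measurable M" "\<And>\<omega>. 0 \<le> f \<omega>" "0 \<le> p" "p \<le> q"
    and int: "integrable M (\<lambda>\<omega>. f \<omega> powr q)"
  shows "integrable M (\<lambda>\<omega>. f \<omega> powr p)"
proof (rule Bochner_Integration.integrable_bound)
  interpret finite_measure M by fact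
  show "integrable M (\<lambda>\<omega>. 1 + f \<omega> powr q)"
    using int by simp
  have "x powr p \<le> 1 + x powr q" if "0 \<le> x" for x :: real
  proof (cases "x \<le> 1")
    case True
    then have "x powr p \<le> 1 powr p"
      using assms that by (intro powr_mono2) auto
    then show ?thesis
      by (simp add: add_increasing2)
  next
    case False
    then have "x powr p \<le> x powr q"
      using assms by (intro powr_mono) auto
    then show ?thesis
      by simp
  qed
  then show "AE \<omega> in M. norm (f \<omega> powr p) \<le> norm (1 + f \<omega> powr q)"
    using assms(3) by (intro AE_I2) auto
qed (use assms in simp)

text \<open>Plays the part of uniform integrability: with bounded \<open>q\<close>-th moments, the
  \<open>p\<close>-th power cost of a small leftover mass is small up to an arbitrarily small
  multiple of those moments.\<close>

lemma powr_le_add_powr: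
  fixes p q \<theta> :: real
  assumes "0 \<le> p" "p < q" "0 < \<theta>"
  obtains A where "0 \<le> A" "\<And>x. 0 \<le> x \<Longrightarrow> x powr p \<le> A + \<theta> * x powr q"
proof
  \<comment> \<open>Solves \<open>c powr (p - q) = \<theta>\<close>; beyond \<open>c\<close> the
    lower power is at most \<open>\<theta>\<close> times the higher one.\<close>
  define c where "c = \<theta> powr (1 / (p - q))"
  have c: "0 < c"
    using assms by (simp add: c_def)
  show "0 \<le> c powr p"
    by simp
  fix x :: real assume x: "0 \<le> x"
  show "x powr p \<le> c powr p + \<theta> * x powr q"
  proof (cases "x \<le> c")
    case True
    then have "x powr p \<le> c powr p"
      using x assms by (intro powr_mono2) auto
    then show ?thesis
      using assms by (simp add: add_increasing2)
  next
    case False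
    have "x powr p = x powr (p - q) * x powr q"
      using False c by (simp flip: powr_add)
    also have "\<dots> \<le> c powr (p - q) * x powr q"
      using False c assms by (intro mult_right_mono powr_mono2') auto
    also have "c powr (p - q) = \<theta>"
      using assms by (simp add: c_def powr_powr)
    finally show ?thesis
      by (simp add: add_increasing)
  qed
qed

text \<open>Deterministic in the points: cells that are products of one cell per coordinate are fed
  into the cell coupling. Convergence of cell averages places almost all mass inside cells, and
  bounded \<open>q\<close>-th moments control the rest.\<close>

lemma small_cost_couplings:
  fixes x :: "nat \<Rightarrow> 'a::real_normed_vector" and y :: "nat \<Rightarrow> 'b::real_normed_vector"
    and z :: "nat \<Rightarrow> nat \<Rightarrow> 'c::real_normed_vector"
  assumes M: "prob_space M" and p: "1 \<le> p" "p < q"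
    and bar [measurable]: "X \<in> borel_measurable M" "Y \<in> borel_measurable M" "Z \<in> borel_measurable M"
    and int: "integrable M (\<lambda>\<omega>. norm (X \<omega>) powr q)" "integrable M (\<lambda>\<omega>. norm (Y \<omega>) powr q)"
      "integrable M (\<lambda>\<omega>. norm (Z \<omega>) powr q)"
    and cells: "\<And>k. fine_cells (1 / real (k + 2)) (l1 k) (\<phi>1 k)" "\<And>k. fine_cells (1 / real (k + 2)) (l2 k) (\<phi>2 k)"
      "\<And>k. fine_cells (1 / real (k + 2)) (l3 k) (\<phi>3 k)"
    and mass: "\<And>k. 1 - 1 / real (k + 2) \<le> (\<integral>\<omega>. (\<Sum>j<l1 k. \<phi>1 k j (X \<omega>)) \<partial>M)"
      "\<And>k. 1 - 1 / real (k + 2) \<le> (\<integral>\<omega>. (\<Sum>j<l2 k. \<phi>2 k j (Y \<omega>)) \<partial>M)"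
      "\<And>k. 1 - 1 / real (k + 2) \<le> (\<integral>\<omega>. (\<Sum>j<l3 k. \<phi>3 k j (Z \<omega>)) \<partial>M)"
    and conv: "\<And>k a b c. a < l1 k \<Longrightarrow> b < l2 k \<Longrightarrow> c < l3 k \<Longrightarrow>
      (\<lambda>N. (\<Sum>i=1..N. \<phi>1 k a (x i) * \<phi>2 k b (y i) * \<phi>3 k c (z N i)) / real N)
        \<longlonglongrightarrow> (\<integral>\<omega>. \<phi>1 k a (X \<omega>) * \<phi>2 k b (Y \<omega>) * \<phi>3 k c (Z \<omega>) \<partial>M)"
    and bdd: "eventually (\<lambda>N. (\<Sum>i=1..N. norm (x i) powr q + norm (y i) powr q + norm (z N i) powr q) / real N \<le> B) sequentially"
    and c: "0 < (c :: real)"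
  shows "eventually (\<lambda>N. \<exists>h. coupling_weights M N h \<and> weighted_cost M N h
      (\<lambda>i \<omega>. norm (x i - X \<omega>) powr p + dist (y i) (Y \<omega>) powr p + dist (z N i) (Z \<omega>) powr p) \<le> ennreal c) sequentially"
proof -
  interpret prob_space M by fact
  define V where "V \<omega> = norm (X \<omega>) powr q + norm (Y \<omega>) powr q + norm (Z \<omega>) powr q" for \<omega>
  define U where "U N i = norm (x i) powr q + norm (y i) powr q + norm (z N i) powr q" for N i
  have V: "0 \<le> V \<omega>" "integrable M V" for \<omega>
    using int unfolding V_def by auto
  have U0: "0 \<le> U N i" for N i
    by (simp add: U_def)
  \<comment> \<open>Order of choices: the moment bound \<open>B'\<close> fixes
    \<open>\<theta>\<close> so that the moment term is at most \<open>c / 2\<close>;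
    \<open>\<theta>\<close> fixes \<open>A\<close>; only then is the scale \<open>e\<close> chosen,
    small enough for the terms with \<open>A'\<close>.\<close>
  define B' where "B' = max 0 B + expectation V + 1"
  have B': "0 < B'"
    using V(1) by (simp add: B'_def add_nonneg_pos add_nonneg_nonneg)
  define \<theta> where "\<theta> = c / (2 * 2 powr p * B')"
  have \<theta>: "0 < \<theta>"
    using c B' by (simp add: \<theta>_def)
  obtain A where A: "0 \<le> A" "\<And>u. 0 \<le> u \<Longrightarrow> u powr p \<le> A + \<theta> * u powr q"
    using powr_le_add_powr[of p q \<theta>] p \<theta> by auto
  define A' where "A' = 2 powr p * (6 * A)"
  have A': "0 \<le> A'"
    using A by (simp add: A'_def)
  obtain k :: nat where k: "2 * (3 + 4 * A') / c < real k"
    using reals_Archimedean2 by blast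
  define e where "e = 1 / real (k + 2)"
  have e: "0 < e" "e < 1"
    by (auto simp: e_def)
  have ec: "3 * e + 4 * e * A' \<le> c / 2"
  proof -
    have "2 * (3 + 4 * A') \<le> real (k + 2) * c"
      using k c by (simp add: pos_divide_less_eq distrib_right)
    then have "e * (2 * (3 + 4 * A')) \<le> e * (real (k + 2) * c)"
      using e by (intro mult_left_mono) auto
    also have "\<dots> = c"
      by (simp add: e_def)
    finally show ?thesis
      by (simp add: algebra_simps)
  qed
  define g where "g = (\<lambda>(a, b, c) \<omega>. \<phi>1 k a (X \<omega>) * \<phi>2 k b (Y \<omega>) * \<phi>3 k c (Z \<omega>))"
  define f where "f N = (\<lambda>(a, b, c) i. \<phi>1 k a (x i) * \<phi>2 k b (y i) * \<phi>3 k c (z N i))" for N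
  define J where "J = {..<l1 k} \<times> {..<l2 k} \<times> {..<l3 k}"
  \<comment> \<open>Cells without limit mass are dropped, since the cell coupling divides by
    empirical masses that are kept positive only by a positive limit.\<close>
  define I where "I = {j \<in> J. 0 < expectation (g j)}"
  have fin: "finite I" "finite J"
    by (auto simp: I_def J_def)
  note nn = fine_cellsD(2)[OF cells(1)] fine_cellsD(2)[OF cells(2)] fine_cellsD(2)[OF cells(3)]
  have g_meas: "g j \<in> borel_measurable M" for j
  proof -
    note [measurable] = fine_cells_measurable[OF cells(1), of k] fine_cells_measurable[OF cells(2), of k]
      fine_cells_measurable[OF cells(3), of k]
    show ?thesis
      unfolding g_def by (cases j) simp
  qed
  have fg0: "0 \<le> f N j i" "0 \<le> g j \<omega>" for N j i \<omega>
    by (cases j; simp add: f_def g_def nn)+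
  have sum_prod: "(\<Sum>(a, b, c)\<in>J. u a * v b * w c) = (\<Sum>a<l1 k. u a) * (\<Sum>b<l2 k. v b) * (\<Sum>c<l3 k. w c)"
    for u v w :: "nat \<Rightarrow> real"
    unfolding J_def sum.cartesian_product[symmetric]
    by (simp add: mult.assoc flip: sum_distrib_left sum_distrib_right)
  define S1 where "S1 \<omega> = (\<Sum>j<l1 k. \<phi>1 k j (X \<omega>))" for \<omega>
  define S2 where "S2 \<omega> = (\<Sum>j<l2 k. \<phi>2 k j (Y \<omega>))" for \<omega>
  define S3 where "S3 \<omega> = (\<Sum>j<l3 k. \<phi>3 k j (Z \<omega>))" for \<omega>
  have S01: "S1 \<omega> \<in> {0..1}" "S2 \<omega> \<in> {0..1}" "S3 \<omega> \<in> {0..1}" for \<omega>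
    unfolding S1_def S2_def S3_def using fine_cellsD(3)[OF cells(1)] fine_cellsD(3)[OF cells(2)] fine_cellsD(3)[OF cells(3)]
    by (auto intro!: sum_nonneg nn)
  have S_meas: "S1 \<in> borel_measurable M" "S2 \<in> borel_measurable M" "S3 \<in> borel_measurable M"
    unfolding S1_def S2_def S3_def using bar
    by (auto intro!: borel_measurable_sum measurable_compose[OF _ fine_cells_measurable[OF cells(1)]]
        measurable_compose[OF _ fine_cells_measurable[OF cells(2)]]
        measurable_compose[OF _ fine_cells_measurable[OF cells(3)]])
  have sum_g: "(\<Sum>j\<in>J. g j \<omega>) = S1 \<omega> * S2 \<omega> * S3 \<omega>" for \<omega>
    unfolding S1_def S2_def S3_def sum_prod[symmetric] by (intro sum.cong) (auto simp: g_def)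
  have prod01: "u * v * w \<le> 1" if "u \<in> {0..1}" "v \<in> {0..1}" "w \<in> {0..1}" for u v w :: real
    using that by (intro mult_le_one mult_nonneg_nonneg) auto
  have g1: "(\<Sum>j\<in>J. g j \<omega>) \<le> 1" for \<omega>
    unfolding sum_g by (rule prod01[OF S01])
  have f1: "(\<Sum>j\<in>J. f N j i) \<le> 1" for N i
  proof -
    have "(\<Sum>j\<in>J. f N j i) = (\<Sum>j<l1 k. \<phi>1 k j (x i)) * (\<Sum>j<l2 k. \<phi>2 k j (y i)) * (\<Sum>j<l3 k. \<phi>3 k j (z N i))"
      unfolding sum_prod[symmetric] by (intro sum.cong) (auto simp: f_def)
    also have "\<dots> \<le> 1"
      using fine_cellsD(3)[OF cells(1)] fine_cellsD(3)[OF cells(2)] fine_cellsD(3)[OF cells(3)]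
      by (intro prod01) (auto intro!: sum_nonneg nn)
    finally show ?thesis .
  qed
  have g_int: "integrable M (g j)" if "j \<in> J" for j
  proof (rule integrable_const_bound[where B = 1])
    have "g j \<omega> \<le> 1" for \<omega>
      using member_le_sum[OF that _ fin(2), of "\<lambda>j. g j \<omega>"] g1[of \<omega>] fg0 by auto
    then show "AE \<omega> in M. norm (g j \<omega>) \<le> 1"
      using fg0 by simp
  qed (rule g_meas)
  have mass_g: "1 - 3 * e \<le> (\<Sum>j\<in>I. expectation (g j))"
  proof -
    have S_int: "integrable M S1" "integrable M S2" "integrable M S3" "integrable M (\<lambda>\<omega>. S1 \<omega> * S2 \<omega> * S3 \<omega>)"
      using S_meas S01 prod01[OF S01]
      by (auto intro!: integrable_const_bound[where B = 1] AE_I2 simp: abs_mult abs_of_nonneg)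
    \<comment> \<open>Applying \<open>u + v - 1 \<le> u * v\<close> on \<open>[0,1]\<close> twice
      turns the mass defects of the three coordinates, each at most \<open>e\<close>, into one of at
      most \<open>3 * e\<close>.\<close>
    have "S1 \<omega> + S2 \<omega> + S3 \<omega> - 2 \<le> S1 \<omega> * S2 \<omega> * S3 \<omega>" for \<omega>
    proof -
      have *: "u + v - 1 \<le> u * v" if "u \<in> {0..1}" "v \<in> {0..1}" for u v :: real
        using mult_nonneg_nonneg[of "1 - u" "1 - v"] that by (simp add: algebra_simps)
      have "S1 \<omega> * S2 \<omega> \<in> {0..1}"
        using S01[of \<omega>] by (auto intro: mult_le_one)
      then show ?thesis
        using *[OF S01(1,2), of \<omega> \<omega>] *[of "S1 \<omega> * S2 \<omega>" "S3 \<omega>"] S01(3)[of \<omega>] by linarith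
    qed
    then have "expectation (\<lambda>\<omega>. S1 \<omega> + S2 \<omega> + S3 \<omega> - 2) \<le> expectation (\<lambda>\<omega>. S1 \<omega> * S2 \<omega> * S3 \<omega>)"
      using S_int by (intro integral_mono) auto
    moreover have "expectation (\<lambda>\<omega>. S1 \<omega> + S2 \<omega> + S3 \<omega> - 2) = expectation S1 + expectation S2 + expectation S3 - 2"
      using S_int by (simp add: prob_space)
    moreover have "1 - e \<le> expectation S1" "1 - e \<le> expectation S2" "1 - e \<le> expectation S3"
      using mass[of k] unfolding S1_def S2_def S3_def e_def by auto
    moreover have "expectation (\<lambda>\<omega>. S1 \<omega> * S2 \<omega> * S3 \<omega>) = (\<Sum>j\<in>J. expectation (g j))"
      unfolding sum_g[symmetric] using g_int by simp
    moreover have "(\<Sum>j\<in>J. expectation (g j)) = (\<Sum>j\<in>I. expectation (g j))"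
    proof (rule sum.mono_neutral_right)
      have "0 \<le> expectation (g j)" for j
        using fg0 by (intro Bochner_Integration.integral_nonneg) auto
      then show "\<forall>j\<in>J - I. expectation (g j) = 0"
        unfolding I_def by (auto simp: order.order_iff_strict)
    qed (use fin in \<open>auto simp: I_def\<close>)
    ultimately show ?thesis
      by linarith
  qed
  have ev_mass: "eventually (\<lambda>N. \<forall>j\<in>I. (1 - e) * expectation (g j) \<le> (\<Sum>i=1..N. f N j i) / real N) sequentially"
  proof (intro eventually_ball_finite fin ballI)
    fix j assume j: "j \<in> I"
    have lim: "(\<lambda>N. (\<Sum>i=1..N. f N j i) / real N) \<longlonglongrightarrow> expectation (g j)"
      using j conv[of "fst j" k "fst (snd j)" "snd (snd j)"] unfolding I_def J_def f_def g_def
      by (auto split: prod.splits)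
    have "(1 - e) * expectation (g j) < expectation (g j)"
      using j e by (simp add: I_def)
    then have "eventually (\<lambda>N. (1 - e) * expectation (g j) < (\<Sum>i=1..N. f N j i) / real N) sequentially"
      by (rule order_tendstoD(1)[OF lim])
    then show "eventually (\<lambda>N. (1 - e) * expectation (g j) \<le> (\<Sum>i=1..N. f N j i) / real N) sequentially"
      by eventually_elim simp
  qed
  show ?thesis
    using ev_mass bdd eventually_ge_at_top[of 1]
  proof eventually_elim
    case (elim N)
    define D where "D i \<omega> = norm (x i - X \<omega>) powr p + dist (y i) (Y \<omega>) powr p + dist (z N i) (Z \<omega>) powr p" for i \<omega>
    have pw: "norm (u - v) powr p \<le> 2 powr p * (2 * A + \<theta> * (norm u powr q + norm v powr q))"
      for u v :: "'t::real_normed_vector"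
    proof -
      have "norm (u - v) powr p \<le> (norm u + norm v) powr p"
        using p by (intro powr_mono2 norm_triangle_ineq4) auto
      also have "\<dots> \<le> 2 powr p * (norm u powr p + norm v powr p)"
        using p by (intro powr_add_le) auto
      also have "\<dots> \<le> 2 powr p * (2 * A + \<theta> * (norm u powr q + norm v powr q))"
        using A(2)[of "norm u"] A(2)[of "norm v"] by (intro mult_left_mono) (auto simp: distrib_left)
      finally show ?thesis .
    qed
    have D_le: "D i \<omega> \<le> A' + (2 powr p * \<theta>) * (U N i + V \<omega>)" for i \<omega>
      using pw[of "x i" "X \<omega>"] pw[of "y i" "Y \<omega>"] pw[of "z N i" "Z \<omega>"]
      unfolding D_def dist_norm A'_def U_def V_def by (simp add: algebra_simps)
    have D_cell: "D i \<omega> \<le> 3 * e" if "j \<in> I" "0 < f N j i" "0 < g j \<omega>" for j i \<omega>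
    proof -
      obtain a b c where j: "j = (a, b, c)"
        by (cases j)
      have "\<phi>1 k a (x i) \<noteq> 0" "\<phi>2 k b (y i) \<noteq> 0" "\<phi>3 k c (z N i) \<noteq> 0"
        "\<phi>1 k a (X \<omega>) \<noteq> 0" "\<phi>2 k b (Y \<omega>) \<noteq> 0" "\<phi>3 k c (Z \<omega>) \<noteq> 0"
        using that(2,3) by (auto simp: f_def g_def j)
      then have pos: "0 < \<phi>1 k a (x i)" "0 < \<phi>2 k b (y i)" "0 < \<phi>3 k c (z N i)"
        "0 < \<phi>1 k a (X \<omega>)" "0 < \<phi>2 k b (Y \<omega>)" "0 < \<phi>3 k c (Z \<omega>)"
        using nn by (metis order_le_less)+
      \<comment> \<open>Since \<open>e < 1\<close> and \<open>p \<ge> 1\<close>, the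
        \<open>p\<close>-th power does not exceed \<open>e\<close>; three coordinates give the cell
        cost \<open>3 * e\<close>.\<close>
      have small: "d powr p \<le> e" if "0 \<le> d" "d \<le> e" for d
      proof -
        have "d powr p \<le> e powr p"
          using that p by (intro powr_mono2) auto
        also have "\<dots> \<le> e powr 1"
          using e p by (intro powr_mono') auto
        finally show ?thesis
          using e by simp
      qed
      have "dist (x i) (X \<omega>) \<le> e" "dist (y i) (Y \<omega>) \<le> e" "dist (z N i) (Z \<omega>) \<le> e"
        unfolding e_def using fine_cellsD(4)[OF cells(1) pos(1,4)] fine_cellsD(4)[OF cells(2) pos(2,5)]
          fine_cellsD(4)[OF cells(3) pos(3,6)] by auto
      then have "norm (x i - X \<omega>) powr p \<le> e" "dist (y i) (Y \<omega>) powr p \<le> e" "dist (z N i) (Z \<omega>) powr p \<le> e"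
        by (auto intro!: small simp flip: dist_norm)
      then show ?thesis
        by (simp add: D_def)
    qed
    \<comment> \<open>The share withheld from each cell is again \<open>e\<close>, so it adds one
      more \<open>e\<close> to the defect \<open>3 * e\<close> of the cells.\<close>
    have \<tau>0: "1 - (1 - e) * (\<Sum>j\<in>I. expectation (g j)) \<le> 4 * e"
    proof -
      have "(1 - e) * (1 - 3 * e) \<le> (1 - e) * (\<Sum>j\<in>I. expectation (g j))"
        using mass_g e by (intro mult_left_mono) auto
      moreover have "1 - 4 * e \<le> (1 - e) * (1 - 3 * e)"
        by (simp add: algebra_simps)
      ultimately show ?thesis
        by linarith
    qed
    have sub: "(\<Sum>j\<in>I. u j) \<le> 1" if "\<And>j. 0 \<le> u j" "(\<Sum>j\<in>J. u j) \<le> 1" for u :: "nat \<times> nat \<times> nat \<Rightarrow> real"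
      using sum_mono2[of J I u] fin that by (auto simp: I_def intro: order_trans)
    obtain h where h: "coupling_weights M N h"
      "weighted_cost M N h D \<le> ennreal (3 * e + 4 * e * A' + (2 powr p * \<theta>) * ((\<Sum>i=1..N. U N i) / real N + expectation V))"
    proof (rule coupling_from_cells[OF M elim(3) fin(1) e fg0(1)[of N] sub[OF fg0(1) f1] g_meas fg0(2)
          sub[OF fg0(2) g1] _ _ _ D_cell A' _ U0 V(1) V(2) D_le \<tau>0])
      show "0 < expectation (g j)" if "j \<in> I" for j
        using that by (simp add: I_def)
      show "(1 - e) * expectation (g j) \<le> (\<Sum>i=1..N. f N j i) / real N" if "j \<in> I" for j
        using elim(1) that by blast
    qed (use e \<theta> in auto)
    have "(2 powr p * \<theta>) * ((\<Sum>i=1..N. U N i) / real N + expectation V) \<le> (2 powr p * \<theta>) * B'"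
      using elim(2) \<theta> unfolding U_def B'_def by (intro mult_left_mono) auto
    also have "\<dots> = c / 2"
      using B' by (simp add: \<theta>_def)
    finally have "3 * e + 4 * e * A' + (2 powr p * \<theta>) * ((\<Sum>i=1..N. U N i) / real N + expectation V) \<le> c"
      using ec by linarith
    then have "weighted_cost M N h D \<le> ennreal c"
      using h(2) by (meson ennreal_leI order_trans)
    then show ?case
      using h(1) unfolding D_def by blast
  qed
qed

text \<open>Used to recover a single family from the joint one, whose indices are tagged by a sum
  type.\<close>

lemma (in prob_space) indep_vars_reindex_singletons:
  fixes X :: "'i \<Rightarrow> 'a \<Rightarrow> real"
  assumes ind: "indep_vars (\<lambda>_. borel) X I" and s: "inj_on s J" "s ` J \<subseteq> I"
  shows "indep_vars (\<lambda>_. borel) (\<lambda>j. X (s j)) J"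
proof -
  have "indep_vars (\<lambda>j. PiM {s j} (\<lambda>_. borel)) (\<lambda>j \<omega>. restrict (\<lambda>i. X i \<omega>) {s j}) J"
    by (rule indep_vars_restrict[OF ind]) (use s in \<open>auto simp: disjoint_family_on_def inj_on_def\<close>)
  then have "indep_vars (\<lambda>_. borel) (\<lambda>j \<omega>. (\<lambda>g. g (s j)) (restrict (\<lambda>i. X i \<omega>) {s j})) J"
    by (rule indep_vars_compose2) simp
  then show ?thesis
    by simp
qed

text \<open>The three variables with common index \<open>i\<close> form a block; blocks for
  different \<open>i\<close> are disjoint, so functions of them are independent.\<close>

lemma (in prob_space) indep_families_combine:
  fixes f1 :: "'e1 \<Rightarrow> real" and f2 :: "'e2 \<Rightarrow> real" and f3 :: "'e3 \<Rightarrow> real"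
  assumes ind: "indep_families M E1 X1 I1 E2 X2 I2 E3 X3 I3"
    and X: "\<And>i. i \<in> I1 \<Longrightarrow> X1 i \<in> M \<rightarrow>\<^sub>M E1" "\<And>i. i \<in> I2 \<Longrightarrow> X2 i \<in> M \<rightarrow>\<^sub>M E2" "\<And>i. i \<in> I3 \<Longrightarrow> X3 i \<in> M \<rightarrow>\<^sub>M E3"
    and f: "f1 \<in> borel_measurable E1" "f2 \<in> borel_measurable E2" "f3 \<in> borel_measurable E3"
    and J: "J \<subseteq> I1" "J \<subseteq> I2" "J \<subseteq> I3"
  shows "indep_vars (\<lambda>_. borel) (\<lambda>i \<omega>. (f1 (X1 i \<omega>) * f2 (X2 i \<omega>) - a) * f3 (X3 i \<omega>)) J"
proof -
  define Y where "Y = case_sum (\<lambda>i \<omega>. f1 (X1 i \<omega>)) (case_sum (\<lambda>i \<omega>. f2 (X2 i \<omega>)) (\<lambda>i \<omega>. f3 (X3 i \<omega>)))"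
  define K where "K i = {Inl i, Inr (Inl i), Inr (Inr i)}" for i :: 'b
  have "indep_vars (\<lambda>_. borel) Y (I1 <+> I2 <+> I3)"
    unfolding Y_def by (rule indep_families_indep_vars[OF ind X f])
  then have "indep_vars (\<lambda>i. PiM (K i) (\<lambda>_. borel)) (\<lambda>i \<omega>. restrict (\<lambda>k. Y k \<omega>) (K i)) J"
    by (rule indep_vars_restrict) (use J in \<open>auto simp: K_def disjoint_family_on_def\<close>)
  then have "indep_vars (\<lambda>_. borel) (\<lambda>i \<omega>. (\<lambda>g. (g (Inl i) * g (Inr (Inl i)) - a) * g (Inr (Inr i)))
      (restrict (\<lambda>k. Y k \<omega>) (K i))) J"
  proof (rule indep_vars_compose2)
    fix i
    have [measurable]: "(\<lambda>g. g k) \<in> borel_measurable (PiM (K i) (\<lambda>_. borel))" if "k \<in> K i" for k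
      using that by (rule measurable_component_singleton)
    have [simp]: "Inl i \<in> K i" "Inr (Inl i) \<in> K i" "Inr (Inr i) \<in> K i"
      by (auto simp: K_def)
    show "(\<lambda>g. (g (Inl i) * g (Inr (Inl i)) - a) * g (Inr (Inr i))) \<in> borel_measurable (PiM (K i) (\<lambda>_. borel))"
      by measurable
  qed
  then show ?thesis
    by (simp add: K_def Y_def)
qed

lemma (in prob_space) indep_families_expectation:
  fixes f1 :: "'e1 \<Rightarrow> real" and f2 :: "'e2 \<Rightarrow> real" and f3 :: "'e3 \<Rightarrow> real"
  assumes ind: "indep_families M E1 X1 I1 E2 X2 I2 E3 X3 I3"
    and X: "\<And>i. i \<in> I1 \<Longrightarrow> X1 i \<in> M \<rightarrow>\<^sub>M E1" "\<And>i. i \<in> I2 \<Longrightarrow> X2 i \<in> M \<rightarrow>\<^sub>M E2" "\<And>i. i \<in> I3 \<Longrightarrow> X3 i \<in> M \<rightarrow>\<^sub>M E3"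
    and f: "f1 \<in> borel_measurable E1" "f2 \<in> borel_measurable E2" "f3 \<in> borel_measurable E3"
    and bound: "\<And>x. \<bar>f1 x\<bar> \<le> 1" "\<And>x. \<bar>f2 x\<bar> \<le> 1" "\<And>x. \<bar>f3 x\<bar> \<le> 1"
    and i: "i \<in> I1" "j \<in> I2" "k \<in> I3"
  shows "expectation (\<lambda>\<omega>. f1 (X1 i \<omega>) * f2 (X2 j \<omega>) * f3 (X3 k \<omega>))
    = expectation (\<lambda>\<omega>. f1 (X1 i \<omega>)) * expectation (\<lambda>\<omega>. f2 (X2 j \<omega>)) * expectation (\<lambda>\<omega>. f3 (X3 k \<omega>))"
proof -
  define Y where "Y = case_sum (\<lambda>i \<omega>. f1 (X1 i \<omega>)) (case_sum (\<lambda>i \<omega>. f2 (X2 i \<omega>)) (\<lambda>i \<omega>. f3 (X3 i \<omega>)))"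
  define K where "K = {Inl i, Inr (Inl j), Inr (Inr k)}"
  have ind: "indep_vars (\<lambda>_. borel) Y (I1 <+> I2 <+> I3)"
    unfolding Y_def by (rule indep_families_indep_vars[OF ind X f])
  have K: "K \<subseteq> I1 <+> I2 <+> I3"
    using i by (auto simp: K_def)
  have "expectation (\<lambda>\<omega>. \<Prod>k\<in>K. Y k \<omega>) = (\<Prod>k\<in>K. expectation (Y k))"
  proof (rule indep_vars_lebesgue_integral)
    show "indep_vars (\<lambda>_. borel) Y K"
      by (rule indep_vars_subset[OF ind K])
    show "integrable M (Y k)" if "k \<in> K" for k
    proof (rule integrable_const_bound[where B = 1])
      show "random_variable borel (Y k)"
        using ind K that unfolding indep_vars_def by blast
      show "AE \<omega> in M. norm (Y k \<omega>) \<le> 1"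
        using that bound by (auto simp: K_def Y_def)
    qed
  qed (simp add: K_def)
  then show ?thesis
    by (simp add: K_def Y_def mult.assoc)
qed

lemma measurable_norm_CT: "norm \<in> borel_measurable (CT T)"
  unfolding CT_def by (rule measurable_restrict_space1) (rule borel_measurable_norm)

lemma measurable_CT_comp:
  assumes "f \<in> borel_measurable borel"
  shows "f \<in> borel_measurable (CT T)"
  unfolding CT_def using assms by (rule measurable_restrict_space1)

lemma integrable_of_distr_eq:
  fixes f :: "'e \<Rightarrow> real"
  assumes X: "X \<in> M \<rightarrow>\<^sub>M E" and Y: "Y \<in> M \<rightarrow>\<^sub>M E" and eq: "distr M E X = distr M E Y"
    and f: "f \<in> borel_measurable E"
  shows "integrable M (\<lambda>\<omega>. f (Y \<omega>)) \<Longrightarrow> integrable M (\<lambda>\<omega>. f (X \<omega>))"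
    and "(\<integral>\<omega>. f (X \<omega>) \<partial>M) = (\<integral>\<omega>. f (Y \<omega>) \<partial>M)"
  using integrable_distr_eq[OF X f] integrable_distr_eq[OF Y f] integral_distr[OF X f] integral_distr[OF Y f] eq
  by auto

text \<open>The cells are fixed for every \<open>k\<close> before a realisation is chosen, so that
  almost sure convergence concerns only countably many test functions. The shift in
  \<open>k + 2\<close> keeps the scale below 1.\<close>

lemma fine_cells_families:
  fixes Y :: "'w \<Rightarrow> 'e::metric_space"
  assumes "prob_space M" "Y \<in> borel_measurable M" "countable D"
    and "\<And>\<omega> e. \<omega> \<in> space M \<Longrightarrow> 0 < e \<Longrightarrow> \<exists>g\<in>D. dist g (Y \<omega>) < e"
  obtains l \<phi> where "\<And>k. fine_cells (1 / real (k + 2)) (l k) (\<phi> k)"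
    "\<And>k. 1 - 1 / real (k + 2) \<le> (\<integral>\<omega>. (\<Sum>j<l k. \<phi> k j (Y \<omega>)) \<partial>M)"
proof -
  have "\<exists>l \<phi>. fine_cells (1 / real (k + 2)) l \<phi> \<and> 1 - 1 / real (k + 2) \<le> (\<integral>\<omega>. (\<Sum>j<l. \<phi> j (Y \<omega>)) \<partial>M)" for k
    using assms by (rule fine_cells_exist) auto
  then obtain l \<phi> where "\<And>k. fine_cells (1 / real (k + 2)) (l k) (\<phi> k) \<and>
      1 - 1 / real (k + 2) \<le> (\<integral>\<omega>. (\<Sum>j<l k. \<phi> k j (Y \<omega>)) \<partial>M)"
    by metis
  then show ?thesis
    using that by blast
qed

lemma countable_dense_metric:
  obtains D :: "'a::{metric_space, second_countable_topology} set" where "countable D"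
    "\<And>x e. 0 < e \<Longrightarrow> \<exists>g\<in>D. dist g x < e"
proof -
  obtain D :: "'a set" where D: "countable D" "\<And>U. open U \<Longrightarrow> U \<noteq> {} \<Longrightarrow> \<exists>d\<in>D. d \<in> U"
    using countable_dense_setE by metis
  have "\<exists>g\<in>D. dist g x < e" if "0 < e" for x e
    using D(2)[of "ball x e"] that by (auto simp: dist_commute)
  then show ?thesis
    using that D(1) by blast
qed

theorem corollary27:
  fixes M :: "'w measure"
    and b :: "real \<Rightarrow> (real^'d) \<times> (real^'n) \<Rightarrow> ((real^'d) \<times> (real^'n)) measure \<Rightarrow> real^'d"
    and \<zeta> :: "nat \<Rightarrow> 'w \<Rightarrow> real^'d"
    and W :: "nat \<Rightarrow> 'w \<Rightarrow> (real \<Rightarrow>\<^sub>C (real^'d))"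
    and R :: "nat \<Rightarrow> nat \<Rightarrow> 'w \<Rightarrow> (real \<Rightarrow>\<^sub>C (real^'n))"
    and X :: "nat \<Rightarrow> nat \<Rightarrow> 'w \<Rightarrow> (real \<Rightarrow>\<^sub>C (real^'d))"
    and \<zeta>bar :: "'w \<Rightarrow> real^'d"
    and Wbar Xbar :: "'w \<Rightarrow> (real \<Rightarrow>\<^sub>C (real^'d))"
    and Rbar :: "'w \<Rightarrow> (real \<Rightarrow>\<^sub>C (real^'n))"
    and T p p' K :: real
  assumes "0 < T" and "1 \<le> p" and "p < p'"
    and b_measurable:
      "(\<lambda>(t, x, \<mu>). b t x \<mu>)
         \<in> restrict_space borel {0..T} \<Otimes>\<^sub>M (borel \<Otimes>\<^sub>M Pp_borel borel p) \<rightarrow>\<^sub>M borel"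
    and b_lipschitz:
      "\<And>t x x' \<mu> \<mu>'. t \<in> {0..T} \<Longrightarrow> \<mu> \<in> Pp borel p \<Longrightarrow> \<mu>' \<in> Pp borel p \<Longrightarrow>
         norm (b t x \<mu> - b t x' \<mu>') powr p
           \<le> K * (norm (x - x') powr p + enn2real (wasserstein borel p \<mu> \<mu>') powr p)"
    and "prob_space M"
    and \<zeta>_Lq: "\<And>i. i \<ge> 1 \<Longrightarrow> \<zeta> i \<in> Lq M borel p'"
    and W_Lq: "\<And>i. i \<ge> 1 \<Longrightarrow> W i \<in> Lq M (CT T) p'"
    and R_Lq: "\<And>N i. i \<in> {1..N} \<Longrightarrow> R N i \<in> Lq M (CT T) p'"
    and \<zeta>_identically_distributed:
      "\<And>i. i \<ge> 1 \<Longrightarrow> distr M borel (\<zeta> i) = distr M borel (\<zeta> 1)"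
    and W_identically_distributed:
      "\<And>i. i \<ge> 1 \<Longrightarrow> distr M (CT T) (W i) = distr M (CT T) (W 1)"
    and independent:
      "\<And>N. indep_families M borel \<zeta> {1..} (CT T) W {1..} (CT T) (R N) {1..N}"
    and \<zeta>bar: "\<zeta>bar \<in> M \<rightarrow>\<^sub>M borel" "distr M borel \<zeta>bar = distr M borel (\<zeta> 1)"
    and Wbar: "Wbar \<in> M \<rightarrow>\<^sub>M CT T" "distr M (CT T) Wbar = distr M (CT T) (W 1)"
    and Rbar: "Rbar \<in> M \<rightarrow>\<^sub>M CT T"
    and bar_independent:
      "indep_families M borel (\<lambda>_. \<zeta>bar) {()} (CT T) (\<lambda>_. Wbar) {()} (CT T) (\<lambda>_. Rbar) {()}"
    and X: "\<And>N. N \<ge> 1 \<Longrightarrow> particle_solution M T b N \<zeta> W (R N) (X N)"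
    and Xbar: "mckean_vlasov_solution M T p b \<zeta>bar Wbar Rbar Xbar"
    and R_convergence:
      "AE \<omega> in M. (\<lambda>N. wasserstein (CT T) p' (empirical (CT T) N (\<lambda>i. R N i \<omega>))
                                 (distr M (CT T) Rbar)) \<longlonglongrightarrow> 0"
  shows "AE \<omega> in M. (\<lambda>N. wasserstein (CT T) p
                        (empirical (CT T) N (\<lambda>i. pair_path (X N i \<omega>) (R N i \<omega>)))
                        (distr M (CT T) (\<lambda>\<omega>. pair_path (Xbar \<omega>) (Rbar \<omega>)))) \<longlonglongrightarrow> 0"
proof -
  interpret prob_space M by fact
  have T: "0 < T" and p: "1 \<le> p" "p < p'"
    by fact+
  \<comment> \<open>At the midpoint, \<open>r = p' / q\<close> lies between 1 and 2: the variables
    \<open>norm (\<zeta> i) powr q\<close> then have an \<open>r\<close>-th moment, as the bound on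
    averages demands, while \<open>q\<close> still exceeds \<open>p\<close>.\<close>
  define q where "q = (p + p') / 2"
  define r where "r = p' / q"
  have q: "p < q" "q < p'" "0 < q" "1 \<le> q"
    using p by (auto simp: q_def)
  have r: "1 < r" "r \<le> 2" "q * r = p'"
    using p q by (auto simp: r_def) (simp add: q_def field_simps)
  obtain L where L: "0 < L" and lip:
    "\<And>t x x' \<mu> \<mu>'. t \<in> {0..T} \<Longrightarrow> \<mu> \<in> Pp borel p \<Longrightarrow> \<mu>' \<in> Pp borel p \<Longrightarrow>
       norm (b t x \<mu> - b t x' \<mu>') \<le> L * (norm (x - x') + enn2real (wasserstein borel p \<mu> \<mu>'))"
    by (rule drift_lipschitz[OF p(1) b_lipschitz]) (assumption | rule that)+

  \<comment> \<open>Integrability of the data and of the limit solution\<close>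
  have \<zeta>_m: "\<zeta> i \<in> borel_measurable M" and \<zeta>_int: "integrable M (\<lambda>\<omega>. norm (\<zeta> i \<omega>) powr p')" if "i \<in> {1..}" for i
    using \<zeta>_Lq[of i] that unfolding Lq_def by auto
  have W_m: "W i \<in> M \<rightarrow>\<^sub>M CT T" and W_int: "integrable M (\<lambda>\<omega>. norm (W i \<omega>) powr p')" if "i \<in> {1..}" for i
    using W_Lq[of i] that unfolding Lq_def by auto
  have R_m: "R N i \<in> M \<rightarrow>\<^sub>M CT T" if "i \<in> {1..N}" for N i
    using R_Lq[OF that] unfolding Lq_def by auto
  have norm_powr_CT: "(\<lambda>f. norm f powr s) \<in> borel_measurable (CT T)" for s
    by (rule powr_real_measurable[OF measurable_norm_CT borel_measurable_const])
  have R_paths: "R N i \<omega> \<in> space (CT T)" if "\<omega> \<in> space M" "i \<in> {1..N}" for N i \<omega>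
    using measurable_space[OF R_m[OF that(2)] that(1)] .
  have Xbar_m: "Xbar \<in> M \<rightarrow>\<^sub>M CT T"
    using Xbar unfolding mckean_vlasov_solution_def by auto

  have \<zeta>bar_int: "integrable M (\<lambda>\<omega>. norm (\<zeta>bar \<omega>) powr p')"
    by (rule integrable_of_distr_eq(1)[OF \<zeta>bar(1) \<zeta>_m \<zeta>bar(2) _ \<zeta>_int]) auto
  have Wbar_int: "integrable M (\<lambda>\<omega>. norm (Wbar \<omega>) powr p')"
    by (rule integrable_of_distr_eq(1)[OF Wbar(1) W_m Wbar(2) norm_powr_CT W_int]) auto
  have R_cost: "eventually (\<lambda>N. transport_cost (CT T) p' (empirical (CT T) N (\<lambda>i. R N i \<omega>)) (distr M (CT T) Rbar)
      < ennreal 1) sequentially"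
    if "(\<lambda>N. wasserstein (CT T) p' (empirical (CT T) N (\<lambda>i. R N i \<omega>)) (distr M (CT T) Rbar)) \<longlonglongrightarrow> 0" for \<omega>
    using that p by (intro eventually_transport_cost_less) auto
  have R_moment: "(\<integral>\<^sup>+x. ennreal (norm x powr p') \<partial>empirical (CT T) N (\<lambda>i. R N i \<omega>))
      = ennreal ((\<Sum>i=1..N. norm (R N i \<omega>) powr p') / real N)" if "1 \<le> N" "\<omega> \<in> space M" for N \<omega>
  proof -
    have "(\<integral>\<^sup>+x. ennreal (norm x powr p') \<partial>empirical (CT T) N (\<lambda>i. R N i \<omega>))
        = (\<Sum>i=1..N. ennreal (norm (R N i \<omega>) powr p')) / of_nat N"
      using that norm_powr_CT R_paths by (intro nn_integral_empirical) auto
    also have "\<dots> = ennreal ((\<Sum>i=1..N. norm (R N i \<omega>) powr p') / real N)"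
      using that by (subst sum_ennreal) (auto simp: ennreal_of_nat_eq_real_of_nat intro!: divide_ennreal sum_nonneg)
    finally show ?thesis .
  qed
  have Rbar_moment: "(\<integral>\<^sup>+x. ennreal (norm x powr p') \<partial>distr M (CT T) Rbar) = (\<integral>\<^sup>+\<omega>. ennreal (norm (Rbar \<omega>) powr p') \<partial>M)"
    using Rbar norm_powr_CT by (intro nn_integral_distr) auto
  \<comment> \<open>No moment of \<open>Rbar\<close> is assumed. One realisation and one
    \<open>N\<close> with transport cost below 1 suffice, because a finite sample has all moments;
    such a realisation exists since \<Omega> is not a null set.\<close>
  have Rbar_int: "integrable M (\<lambda>\<omega>. norm (Rbar \<omega>) powr p')"
  proof (rule ccontr)
    assume not_int: "\<not> integrable M (\<lambda>\<omega>. norm (Rbar \<omega>) powr p')"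
    have "AE \<omega> in M. False"
      using R_convergence AE_space
    proof eventually_elim
      case (elim \<omega>)
      have "eventually (\<lambda>N. transport_cost (CT T) p' (empirical (CT T) N (\<lambda>i. R N i \<omega>)) (distr M (CT T) Rbar)
          < ennreal 1 \<and> 1 \<le> N) sequentially"
        by (intro eventually_conj R_cost[OF elim(1)] eventually_ge_at_top)
      then obtain N where N: "transport_cost (CT T) p' (empirical (CT T) N (\<lambda>i. R N i \<omega>)) (distr M (CT T) Rbar) < ennreal 1"
        "1 \<le> N"
        by (auto simp: eventually_at_top_linorder)
      have "(\<integral>\<^sup>+\<omega>. ennreal (norm (Rbar \<omega>) powr p') \<partial>M)
          \<le> ennreal (2 powr p') * (ennreal ((\<Sum>i=1..N. norm (R N i \<omega>) powr p') / real N) + ennreal 1)"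
        unfolding R_moment[OF N(2) elim(2), symmetric] Rbar_moment[symmetric]
        using p by (intro transport_cost_moments[OF N(1)] measurable_norm_CT measurable_dist_CT) auto
      also have "\<dots> < \<infinity>"
        by (simp add: ennreal_mult_less_top)
      finally have "integrable M (\<lambda>\<omega>. norm (Rbar \<omega>) powr p')"
        using measurable_compose[OF Rbar norm_powr_CT] by (intro integrableI_nonneg) auto
      with not_int show False ..
    qed
    then show False
      by simp
  qed
  have int_le: "integrable M (\<lambda>\<omega>. norm (\<zeta>bar \<omega>) powr s)" "integrable M (\<lambda>\<omega>. norm (Wbar \<omega>) powr s)"
    "integrable M (\<lambda>\<omega>. norm (Rbar \<omega>) powr s)" if "0 \<le> s" "s \<le> p'" for s
    using that \<zeta>bar(1) measurable_compose[OF Wbar(1) measurable_norm_CT] measurable_compose[OF Rbar measurable_norm_CT]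
    by (intro integrable_powr_mono[OF _ _ _ that \<zeta>bar_int] integrable_powr_mono[OF _ _ _ that Wbar_int]
        integrable_powr_mono[OF _ _ _ that Rbar_int]; auto intro: finite_measure_axioms)+
  have Xbar_int: "integrable M (\<lambda>\<omega>. norm (Xbar \<omega>) powr p)"
    using p by (intro mckean_vlasov_moment[OF \<open>prob_space M\<close> T p(1) L lip Xbar Rbar] int_le) auto

  \<comment> \<open>Cells for the three limit laws and their almost sure averages\<close>
  obtain D1 :: "(real^'d) set" where D1: "countable D1" "\<And>x e. 0 < e \<Longrightarrow> \<exists>g\<in>D1. dist g x < e"
    by (rule countable_dense_metric) blast
  obtain l1 \<phi>1 where c1: "\<And>k. fine_cells (1 / real (k + 2)) (l1 k) (\<phi>1 k)"
    "\<And>k. 1 - 1 / real (k + 2) \<le> (\<integral>\<omega>. (\<Sum>j<l1 k. \<phi>1 k j (\<zeta>bar \<omega>)) \<partial>M)"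
    by (rule fine_cells_families[OF \<open>prob_space M\<close> \<zeta>bar(1) D1]) auto
  obtain D2 :: "(real \<Rightarrow>\<^sub>C (real^'d)) set" where D2: "countable D2"
    "\<And>f e. f \<in> paths T \<Longrightarrow> 0 < e \<Longrightarrow> \<exists>g\<in>D2. dist g f < e"
    using separable_paths[OF T] by metis
  obtain l2 \<phi>2 where c2: "\<And>k. fine_cells (1 / real (k + 2)) (l2 k) (\<phi>2 k)"
    "\<And>k. 1 - 1 / real (k + 2) \<le> (\<integral>\<omega>. (\<Sum>j<l2 k. \<phi>2 k j (Wbar \<omega>)) \<partial>M)"
    by (rule fine_cells_families[OF \<open>prob_space M\<close> measurable_CT_imp_borel[OF Wbar(1)] D2(1)])
      (auto intro!: D2(2) measurable_CT_space[OF Wbar(1)])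
  obtain D3 :: "(real \<Rightarrow>\<^sub>C (real^'n)) set" where D3: "countable D3"
    "\<And>f e. f \<in> paths T \<Longrightarrow> 0 < e \<Longrightarrow> \<exists>g\<in>D3. dist g f < e"
    using separable_paths[OF T] by metis
  obtain l3 \<phi>3 where c3: "\<And>k. fine_cells (1 / real (k + 2)) (l3 k) (\<phi>3 k)"
    "\<And>k. 1 - 1 / real (k + 2) \<le> (\<integral>\<omega>. (\<Sum>j<l3 k. \<phi>3 k j (Rbar \<omega>)) \<partial>M)"
    by (rule fine_cells_families[OF \<open>prob_space M\<close> measurable_CT_imp_borel[OF Rbar] D3(1)])
      (auto intro!: D3(2) measurable_CT_space[OF Rbar])
  have \<phi>_m: "\<phi>1 k a \<in> borel_measurable borel" "\<phi>2 k a \<in> borel_measurable (CT T)" "\<phi>3 k a \<in> borel_measurable (CT T)" for k a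
    using fine_cells_measurable[OF c1(1)] fine_cells_measurable[OF c2(1)] fine_cells_measurable[OF c3(1)]
    by (auto intro: measurable_CT_comp)
  have \<phi>01: "a < l1 k \<Longrightarrow> \<phi>1 k a x \<in> {0..1}" "a < l2 k \<Longrightarrow> \<phi>2 k a y \<in> {0..1}" "a < l3 k \<Longrightarrow> \<phi>3 k a z \<in> {0..1}"
    for k a x y z
    using fine_cells_le_1[OF c1(1)] fine_cells_le_1[OF c2(1)] fine_cells_le_1[OF c3(1)]
      fine_cellsD(2)[OF c1(1)] fine_cellsD(2)[OF c2(1)] fine_cellsD(2)[OF c3(1)] by auto
  define m where "m k a b = expectation (\<lambda>\<omega>. \<phi>1 k a (\<zeta>bar \<omega>)) * expectation (\<lambda>\<omega>. \<phi>2 k b (Wbar \<omega>))" for k a b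
  have E\<phi>1: "expectation (\<lambda>\<omega>. \<phi>1 k a (\<zeta> i \<omega>)) = expectation (\<lambda>\<omega>. \<phi>1 k a (\<zeta>bar \<omega>))" if "i \<in> {1..}" for k a i
    using \<zeta>_identically_distributed[of i] \<zeta>bar(2) that
    by (intro integrable_of_distr_eq(2)[OF \<zeta>_m[OF that] \<zeta>bar(1) _ \<phi>_m(1)]) auto
  have E\<phi>2: "expectation (\<lambda>\<omega>. \<phi>2 k a (W i \<omega>)) = expectation (\<lambda>\<omega>. \<phi>2 k a (Wbar \<omega>))" if "i \<in> {1..}" for k a i
    using W_identically_distributed[of i] Wbar(2) that
    by (intro integrable_of_distr_eq(2)[OF W_m[OF that] Wbar(1) _ \<phi>_m(2)]) auto
  have Ebar: "expectation (\<lambda>\<omega>. \<phi>1 k a (\<zeta>bar \<omega>) * \<phi>2 k b (Wbar \<omega>) * \<phi>3 k c (Rbar \<omega>))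
      = m k a b * expectation (\<lambda>\<omega>. \<phi>3 k c (Rbar \<omega>))" if "a < l1 k" "b < l2 k" "c < l3 k" for k a b c
    unfolding m_def using \<phi>01[of a k] \<phi>01[of b k] \<phi>01[of c k] that
    by (intro indep_families_expectation[OF bar_independent \<zeta>bar(1) Wbar(1) Rbar \<phi>_m]) auto

  \<comment> \<open>The subtracted \<open>m k a b\<close> is the common mean of the product of the
    first two factors, so each term is centred for any law of \<open>R N i\<close>. For each fixed
    \<open>N\<close> the terms are independent in \<open>i\<close>, which is all that the triangular
    scheme offers.\<close>
  have cells_ae: "AE \<omega> in M. (\<lambda>N. (\<Sum>i=1..N. (\<phi>1 k a (\<zeta> i \<omega>) * \<phi>2 k b (W i \<omega>) - m k a b) * \<phi>3 k c (R N i \<omega>)) / real N) \<longlonglongrightarrow> 0"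
    if abc: "a < l1 k" "b < l2 k" "c < l3 k" for k a b c
  proof (rule triangular_averages_tendsto_0)
    show "indep_vars (\<lambda>_. borel) (\<lambda>i \<omega>. (\<phi>1 k a (\<zeta> i \<omega>) * \<phi>2 k b (W i \<omega>) - m k a b) * \<phi>3 k c (R N i \<omega>)) {1..N}" for N
      by (rule indep_families_combine[OF independent \<zeta>_m W_m R_m \<phi>_m]) auto
    have m01: "m k a b \<in> {0..1}"
    proof -
      have "expectation f \<in> {0..1}" if "f \<in> borel_measurable M" "\<And>\<omega>. f \<omega> \<in> {0..1}" for f :: "'w \<Rightarrow> real"
      proof -
        have "integrable M f"
          using that by (intro integrable_const_bound[where B = 1]) auto
        then have "expectation f \<le> expectation (\<lambda>_. 1)"
          using that by (intro integral_mono) auto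
        then show ?thesis
          using that by (auto simp: prob_space intro!: Bochner_Integration.integral_nonneg)
      qed
      note * = this
      have "expectation (\<lambda>\<omega>. \<phi>1 k a (\<zeta>bar \<omega>)) \<in> {0..1}" "expectation (\<lambda>\<omega>. \<phi>2 k b (Wbar \<omega>)) \<in> {0..1}"
        by (rule *[OF measurable_compose[OF \<zeta>bar(1) \<phi>_m(1)] \<phi>01(1)[OF abc(1)]]
            *[OF measurable_compose[OF Wbar(1) \<phi>_m(2)] \<phi>01(2)[OF abc(2)]])+
      then show ?thesis
        unfolding m_def by (auto intro: mult_le_one)
    qed
    show "(\<phi>1 k a (\<zeta> i \<omega>) * \<phi>2 k b (W i \<omega>) - m k a b) * \<phi>3 k c (R N i \<omega>) \<in> {-1..1}" for N i \<omega>
    proof -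
      have 1: "\<phi>1 k a (\<zeta> i \<omega>) * \<phi>2 k b (W i \<omega>) \<in> {0..1}"
        using \<phi>01(1)[OF abc(1), of "\<zeta> i \<omega>"] \<phi>01(2)[OF abc(2), of "W i \<omega>"] by (auto intro: mult_le_one)
      have "\<bar>(\<phi>1 k a (\<zeta> i \<omega>) * \<phi>2 k b (W i \<omega>) - m k a b) * \<phi>3 k c (R N i \<omega>)\<bar> \<le> 1"
        unfolding abs_mult using 1 m01 \<phi>01(3)[OF abc(3), of "R N i \<omega>"] by (intro mult_le_one) auto
      then show ?thesis
        by auto
    qed
    show "expectation (\<lambda>\<omega>. (\<phi>1 k a (\<zeta> i \<omega>) * \<phi>2 k b (W i \<omega>) - m k a b) * \<phi>3 k c (R N i \<omega>)) = 0" if i: "i \<in> {1..N}" for N i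
    proof -
      have i1: "i \<in> {1..}"
        using i by simp
      note [measurable] = measurable_compose[OF \<zeta>_m[OF i1] \<phi>_m(1)] measurable_compose[OF W_m[OF i1] \<phi>_m(2)]
        measurable_compose[OF R_m[OF i] \<phi>_m(3)]
      have int3: "integrable M (\<lambda>\<omega>. \<phi>3 k c (R N i \<omega>))"
        using \<phi>01(3)[OF abc(3)] by (intro integrable_const_bound[where B = 1]) auto
      have int123: "integrable M (\<lambda>\<omega>. \<phi>1 k a (\<zeta> i \<omega>) * \<phi>2 k b (W i \<omega>) * \<phi>3 k c (R N i \<omega>))"
      proof (rule integrable_const_bound[where B = 1])
        show "AE \<omega> in M. norm (\<phi>1 k a (\<zeta> i \<omega>) * \<phi>2 k b (W i \<omega>) * \<phi>3 k c (R N i \<omega>)) \<le> 1"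
          using \<phi>01(1)[OF abc(1)] \<phi>01(2)[OF abc(2)] \<phi>01(3)[OF abc(3)]
          by (intro AE_I2) (auto simp: abs_mult intro!: mult_le_one)
      qed measurable
      have "expectation (\<lambda>\<omega>. (\<phi>1 k a (\<zeta> i \<omega>) * \<phi>2 k b (W i \<omega>) - m k a b) * \<phi>3 k c (R N i \<omega>))
          = expectation (\<lambda>\<omega>. \<phi>1 k a (\<zeta> i \<omega>) * \<phi>2 k b (W i \<omega>) * \<phi>3 k c (R N i \<omega>))
            - m k a b * expectation (\<lambda>\<omega>. \<phi>3 k c (R N i \<omega>))"
        using int3 int123 by (simp add: left_diff_distrib)
      also have "expectation (\<lambda>\<omega>. \<phi>1 k a (\<zeta> i \<omega>) * \<phi>2 k b (W i \<omega>) * \<phi>3 k c (R N i \<omega>))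
          = m k a b * expectation (\<lambda>\<omega>. \<phi>3 k c (R N i \<omega>))"
        unfolding m_def E\<phi>1[OF i1, symmetric] E\<phi>2[OF i1, symmetric]
        using \<phi>01[of a k] \<phi>01[of b k] \<phi>01[of c k] abc i i1
        by (intro indep_families_expectation[OF independent[of N] \<zeta>_m W_m R_m \<phi>_m]) auto
      finally show ?thesis
        by simp
    qed
  qed
  have A4: "AE \<omega> in M. \<forall>k a b c. a < l1 k \<longrightarrow> b < l2 k \<longrightarrow> c < l3 k \<longrightarrow>
    (\<lambda>N. (\<Sum>i=1..N. (\<phi>1 k a (\<zeta> i \<omega>) * \<phi>2 k b (W i \<omega>) - m k a b) * \<phi>3 k c (R N i \<omega>)) / real N) \<longlonglongrightarrow> 0"
    unfolding AE_all_countable by (intro allI AE_impI cells_ae)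

  \<comment> \<open>Bounded moments along almost every realisation\<close>
  have powr_r: "(u powr q) powr r = u powr p'" for u :: real
    using r by (simp add: powr_powr)
  \<comment> \<open>With \<open>N = 0\<close> the third index set is empty, leaving the joint
    independence of all \<open>\<zeta> i\<close> and \<open>W i\<close>.\<close>
  have norm_ind: "indep_vars (\<lambda>_. borel) (case_sum (\<lambda>i \<omega>. norm (\<zeta> i \<omega>) powr q) (case_sum (\<lambda>i \<omega>. norm (W i \<omega>) powr q)
      (\<lambda>i \<omega>. norm (R 0 i \<omega>) powr q))) ({1..} <+> {1..} <+> {1..0})"
    by (rule indep_families_indep_vars[OF independent[of 0] \<zeta>_m W_m R_m _ norm_powr_CT norm_powr_CT]) auto
  have A1: "AE \<omega> in M. \<exists>B. \<forall>N\<ge>1. (\<Sum>i=1..N. norm (\<zeta> i \<omega>) powr q) \<le> B * real N"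
  proof (rule bounded_averages[where r = r and C = "expectation (\<lambda>\<omega>. norm (\<zeta> 1 \<omega>) powr p')"])
    show "indep_vars (\<lambda>_. borel) (\<lambda>i \<omega>. norm (\<zeta> i \<omega>) powr q) {1..}"
      using indep_vars_reindex_singletons[OF norm_ind, of Inl "{1..}"] by (auto simp: inj_on_def)
    show "expectation (\<lambda>\<omega>. (norm (\<zeta> i \<omega>) powr q) powr r) \<le> expectation (\<lambda>\<omega>. norm (\<zeta> 1 \<omega>) powr p')" if i: "1 \<le> i" for i
    proof -
      have "expectation (\<lambda>\<omega>. norm (\<zeta> i \<omega>) powr p') = expectation (\<lambda>\<omega>. norm (\<zeta> 1 \<omega>) powr p')"
        by (rule integrable_of_distr_eq(2)[OF \<zeta>_m \<zeta>_m \<zeta>_identically_distributed[OF i] _]) (use i in auto)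
      then show ?thesis
        by (simp add: powr_r)
    qed
  qed (use r \<zeta>_int in \<open>auto simp: powr_r\<close>)
  have A2: "AE \<omega> in M. \<exists>B. \<forall>N\<ge>1. (\<Sum>i=1..N. norm (W i \<omega>) powr q) \<le> B * real N"
  proof (rule bounded_averages[where r = r and C = "expectation (\<lambda>\<omega>. norm (W 1 \<omega>) powr p')"])
    show "indep_vars (\<lambda>_. borel) (\<lambda>i \<omega>. norm (W i \<omega>) powr q) {1..}"
      using indep_vars_reindex_singletons[OF norm_ind, of "\<lambda>i. Inr (Inl i)" "{1..}"] by (auto simp: inj_on_def)
    show "expectation (\<lambda>\<omega>. (norm (W i \<omega>) powr q) powr r) \<le> expectation (\<lambda>\<omega>. norm (W 1 \<omega>) powr p')" if i: "1 \<le> i" for i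
    proof -
      have "expectation (\<lambda>\<omega>. norm (W i \<omega>) powr p') = expectation (\<lambda>\<omega>. norm (W 1 \<omega>) powr p')"
        by (rule integrable_of_distr_eq(2)[OF W_m W_m W_identically_distributed[OF i] norm_powr_CT]) (use i in auto)
      then show ?thesis
        by (simp add: powr_r)
    qed
  qed (use r W_int in \<open>auto simp: powr_r\<close>)

  define eqs where "eqs N \<omega> \<longleftrightarrow> (\<forall>i\<in>{1..N}. integrated_eq T
      (\<lambda>s. b s (X N i \<omega> s, R N i \<omega> s) (empirical borel N (\<lambda>j. (X N j \<omega> s, R N j \<omega> s)))) (\<zeta> i \<omega>) (W i \<omega>) (X N i \<omega>))" for N \<omega>
  have X_m: "X N i \<in> M \<rightarrow>\<^sub>M CT T" if "1 \<le> N" "i \<in> {1..N}" for N i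
    using X[OF that(1)] that(2) unfolding particle_solution_def by blast
  \<comment> \<open>The exceptional set of the particle system depends on \<open>N\<close>; a
    countable union makes it common.\<close>
  have A5: "AE \<omega> in M. \<forall>N. 1 \<le> N \<longrightarrow> eqs N \<omega>"
    unfolding AE_all_countable
  proof (intro allI AE_impI)
    fix N :: nat assume "1 \<le> N"
    then show "AE \<omega> in M. eqs N \<omega>"
      using X[of N] unfolding particle_solution_def eqs_def by blast
  qed

  \<comment> \<open>The moment bound for empirical measures at transport cost below 1 from the law
    of \<open>Rbar\<close>.\<close>
  define BR where "BR = 2 powr p' * (expectation (\<lambda>\<omega>. norm (Rbar \<omega>) powr p') + 1)"
  define C where "C = exp (8 * L * T) powr p * (2 * (8 * (2 * L * T + 4)) powr p)"
  have "0 < 8 * (2 * L * T + 4)"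
    using L T by (simp add: add_nonneg_pos)
  then have C: "0 < C"
    by (simp add: C_def)
  \<comment> \<open>From here on one realisation \<omega> outside a null set is fixed and the points
    are deterministic; \<open>\<omega>'\<close> runs through the space carrying the limit
    variables.\<close>
  show ?thesis
    using A1 A2 R_convergence A4 A5 AE_space
  proof eventually_elim
    case (elim \<omega>)
    obtain B1 B2 where B1: "\<And>N. 1 \<le> N \<Longrightarrow> (\<Sum>i=1..N. norm (\<zeta> i \<omega>) powr q) \<le> B1 * real N"
      and B2: "\<And>N. 1 \<le> N \<Longrightarrow> (\<Sum>i=1..N. norm (W i \<omega>) powr q) \<le> B2 * real N"
      using elim(1,2) by blast
    have bdd: "eventually (\<lambda>N. (\<Sum>i=1..N. norm (\<zeta> i \<omega>) powr q + norm (W i \<omega>) powr q + norm (R N i \<omega>) powr q) / real N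
        \<le> B1 + B2 + (1 + BR)) sequentially"
      using R_cost[OF elim(3)] eventually_ge_at_top[of 1]
    proof eventually_elim
      case cost: (elim N)
      have "ennreal ((\<Sum>i=1..N. norm (R N i \<omega>) powr p') / real N)
          \<le> ennreal (2 powr p') * ((\<integral>\<^sup>+\<omega>. ennreal (norm (Rbar \<omega>) powr p') \<partial>M) + ennreal 1)"
        unfolding R_moment[OF cost(2) elim(6), symmetric] Rbar_moment[symmetric]
        using p by (intro transport_cost_moments[OF cost(1)] measurable_norm_CT measurable_dist_CT) auto
      also have "(\<integral>\<^sup>+\<omega>. ennreal (norm (Rbar \<omega>) powr p') \<partial>M) = ennreal (expectation (\<lambda>\<omega>. norm (Rbar \<omega>) powr p'))"
        using Rbar_int by (intro nn_integral_eq_integral) auto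
      also have "ennreal (2 powr p') * (ennreal (expectation (\<lambda>\<omega>. norm (Rbar \<omega>) powr p')) + ennreal 1) = ennreal BR"
        unfolding BR_def by (simp add: ennreal_mult ennreal_plus Bochner_Integration.integral_nonneg)
      finally have "(\<Sum>i=1..N. norm (R N i \<omega>) powr p') / real N \<le> BR"
        by (subst (asm) ennreal_le_iff) (auto simp: BR_def intro!: add_nonneg_nonneg Bochner_Integration.integral_nonneg)
      then have R': "(\<Sum>i=1..N. norm (R N i \<omega>) powr p') \<le> BR * real N"
        using cost(2) by (simp add: pos_divide_le_eq)
      have "norm x powr q \<le> 1 + norm x powr p'" for x :: "real \<Rightarrow>\<^sub>C (real^'n)"
      proof (cases "norm x \<le> 1")
        case True
        then have "norm x powr q \<le> 1 powr q"
          using q by (intro powr_mono2) auto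
        then show ?thesis
          by (simp add: add_increasing2)
      next
        case False
        then have "norm x powr q \<le> norm x powr p'"
          using q by (intro powr_mono) auto
        then show ?thesis
          by simp
      qed
      then have "(\<Sum>i=1..N. norm (R N i \<omega>) powr q) \<le> (\<Sum>i=1..N. 1 + norm (R N i \<omega>) powr p')"
        by (intro sum_mono)
      also have "\<dots> \<le> (1 + BR) * real N"
        using R' by (simp add: sum.distrib distrib_right)
      finally have "(\<Sum>i=1..N. norm (\<zeta> i \<omega>) powr q + norm (W i \<omega>) powr q + norm (R N i \<omega>) powr q)
          \<le> B1 * real N + B2 * real N + (1 + BR) * real N"
        using B1[OF cost(2)] B2[OF cost(2)] unfolding sum.distrib by linarith
      then show ?case
        using cost(2) by (simp add: pos_divide_le_eq distrib_right)
    qed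
    have conv: "(\<lambda>N. (\<Sum>i=1..N. \<phi>1 k a (\<zeta> i \<omega>) * \<phi>2 k b (W i \<omega>) * \<phi>3 k c (R N i \<omega>)) / real N)
        \<longlonglongrightarrow> expectation (\<lambda>\<omega>. \<phi>1 k a (\<zeta>bar \<omega>) * \<phi>2 k b (Wbar \<omega>) * \<phi>3 k c (Rbar \<omega>))"
      if abc: "a < l1 k" "b < l2 k" "c < l3 k" for k a b c
    proof -
      obtain Lc where Lc: "Lc-lipschitz_on UNIV (\<phi>3 k c)"
        using fine_cellsD(1)[OF c3(1)] by blast
      have "(\<lambda>N. (\<Sum>i=1..N. \<phi>3 k c (R N i \<omega>)) / real N) \<longlonglongrightarrow> (\<integral>x. \<phi>3 k c x \<partial>distr M (CT T) Rbar)"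
        by (rule lipschitz_average_tendsto[OF elim(3) R_paths[OF elim(6)] prob_space_distr[OF Rbar] _ _ \<phi>_m(3) Lc
              \<phi>01(3)[OF abc(3)] measurable_dist_CT]) (use p in auto)
      also have "(\<integral>x. \<phi>3 k c x \<partial>distr M (CT T) Rbar) = expectation (\<lambda>\<omega>. \<phi>3 k c (Rbar \<omega>))"
        by (rule integral_distr[OF Rbar \<phi>_m(3)])
      finally have lim: "(\<lambda>N. (\<Sum>i=1..N. \<phi>3 k c (R N i \<omega>)) / real N) \<longlonglongrightarrow> expectation (\<lambda>\<omega>. \<phi>3 k c (Rbar \<omega>))" .
      \<comment> \<open>The centred averages vanish, and what was subtracted is
        \<open>m k a b\<close> times the average of \<open>\<phi>3\<close>, whose limit comes from
        Wasserstein convergence; independence of the limit variables identifies the resulting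
        product.\<close>
      have "(\<lambda>N. (\<Sum>i=1..N. (\<phi>1 k a (\<zeta> i \<omega>) * \<phi>2 k b (W i \<omega>) - m k a b) * \<phi>3 k c (R N i \<omega>)) / real N
          + m k a b * ((\<Sum>i=1..N. \<phi>3 k c (R N i \<omega>)) / real N)) \<longlonglongrightarrow> 0 + m k a b * expectation (\<lambda>\<omega>. \<phi>3 k c (Rbar \<omega>))"
        using elim(4) abc by (intro tendsto_add tendsto_mult tendsto_const lim) blast
      moreover have "(\<Sum>i=1..N. (\<phi>1 k a (\<zeta> i \<omega>) * \<phi>2 k b (W i \<omega>) - m k a b) * \<phi>3 k c (R N i \<omega>)) / real N
          + m k a b * ((\<Sum>i=1..N. \<phi>3 k c (R N i \<omega>)) / real N)
          = (\<Sum>i=1..N. \<phi>1 k a (\<zeta> i \<omega>) * \<phi>2 k b (W i \<omega>) * \<phi>3 k c (R N i \<omega>)) / real N" for N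
        by (simp add: left_diff_distrib sum_subtractf sum_distrib_left diff_divide_distrib)
      ultimately show ?thesis
        unfolding Ebar[OF abc] by simp
    qed
    show ?case
    proof (rule wasserstein_tendsto_0)
      fix c :: real assume c: "0 < c"
      \<comment> \<open>The data are coupled at cost \<open>c / C\<close> so that the stability
        constant \<open>C\<close> cancels.\<close>
      have "eventually (\<lambda>N. \<exists>h. coupling_weights M N h \<and> weighted_cost M N h
          (\<lambda>i \<omega>'. norm (\<zeta> i \<omega> - \<zeta>bar \<omega>') powr p + dist (W i \<omega>) (Wbar \<omega>') powr p + dist (R N i \<omega>) (Rbar \<omega>') powr p)
            \<le> ennreal (c / C)) sequentially"
        by (rule small_cost_couplings[OF \<open>prob_space M\<close> p(1) q(1) \<zeta>bar(1) measurable_CT_imp_borel[OF Wbar(1)]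
              measurable_CT_imp_borel[OF Rbar] _ _ _ c1(1) c2(1) c3(1) c1(2) c2(2) c3(2) conv bdd])
          (use q c C in \<open>auto intro!: int_le\<close>)
      then show "eventually (\<lambda>N. transport_cost (CT T) p (empirical (CT T) N (\<lambda>i. pair_path (X N i \<omega>) (R N i \<omega>)))
          (distr M (CT T) (\<lambda>\<omega>. pair_path (Xbar \<omega>) (Rbar \<omega>))) \<le> ennreal c) sequentially"
        using eventually_ge_at_top[of 1]
      proof eventually_elim
        case N: (elim N)
        then obtain h where h: "coupling_weights M N h" "weighted_cost M N h
          (\<lambda>i \<omega>'. norm (\<zeta> i \<omega> - \<zeta>bar \<omega>') powr p + dist (W i \<omega>) (Wbar \<omega>') powr p + dist (R N i \<omega>) (Rbar \<omega>') powr p)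
            \<le> ennreal (c / C)"
          by blast
        have "transport_cost (CT T) p (empirical (CT T) N (\<lambda>i. pair_path (X N i \<omega>) (R N i \<omega>)))
            (distr M (CT T) (\<lambda>\<omega>. pair_path (Xbar \<omega>) (Rbar \<omega>))) \<le> ennreal (C * (c / C))"
          unfolding C_def
        proof (rule mean_field_stability[OF \<open>prob_space M\<close> T p(1) L lip Xbar \<zeta>bar(1) Wbar(1) Rbar Xbar_int _ N(2) h(1)])
          show "integrable M (\<lambda>\<omega>. norm (Rbar \<omega>) powr p)"
            using p by (intro int_le) auto
          show "integrated_eq T (\<lambda>s. b s (X N i \<omega> s, R N i \<omega> s) (empirical borel N (\<lambda>j. (X N j \<omega> s, R N j \<omega> s))))
              (\<zeta> i \<omega>) (W i \<omega>) (X N i \<omega>)" if "i \<in> {1..N}" for i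
            using elim(5) N(2) that unfolding eqs_def by blast
          show "X N i \<omega> \<in> paths T" if "i \<in> {1..N}" for i
            by (rule measurable_CT_space[OF X_m[OF N(2) that] elim(6)])
          show "R N i \<omega> \<in> paths T" if "i \<in> {1..N}" for i
            using R_paths[OF elim(6) that] by simp
        qed (use h(2) c C in \<open>auto simp: C_def\<close>)
        then show ?case
          using C by simp
      qed
    qed (use p in simp)
  qed
qed

end
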